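(* Let $(V,E)$ be a finite undirected graph without loops or multiple edges, equipped with a $q$-state Potts model ($q\ge 2$) with symmetric complex coupling constants $(J_{ij})_{i,j\in V}$, and let $J'=(J'_{ij})_{i,j\in V}$, $J'_{ij}=J_{ij}a_{ij}$, where $(a_{ij})$ is the adjacency matrix of $(V,E)$. Let $\alpha$ be a co-action of a compact quantum group $(S,\Delta)$ on $C(V)$. If $\alpha$ preserves the hamiltonian of the $q$-state Potts model on $(V,E)$, then the co-representation matrix $Q$ of $\alpha$ commutes with $J'$, i.e. $QJ'=J'Q$.
   Context: All C*-algebras are unital and $\otimes$ is the minimal tensor product. A compact quantum group $(S,\Delta)$ is a unital C*-algebra $S$ with a coassociative unital *-homomorphism $\Delta:S\to S\otimes S$ such that the linear spans of $\Delta(S)(1\otimes S)$ and $\Delta(S)(S\otimes 1)$ are dense in $S\otimes S$. A co-action of $(S,\Delta)$ on a unital C*-algebra $A$ is a *-homomorphism $\alpha:A\to A\otimes S$ with $(\alpha\otimes id)\alpha=(id\otimes\Delta)\alpha$ and with the linear span of $\alpha(A)(1\otimes S)$ norm-dense in $A\otimes S$. All co-actions are assumed faithful: there is no proper Woronowicz C*-subalgebra $S_1\subset S$ such that $\alpha$ is a co-action of $S_1$ on $A$. For a co-action on $C(V)$, with $\chi_i$ the characteristic function of $i\in V$, the co-representation matrix is the $S$-valued matrix $Q=(q_{ij})_{i,j\in V}$ with $\alpha(\chi_i)=\sum_{j\in V}\chi_j\otimes q_{ji}$ (so $S$ is generated by the $q_{ij}$). Potts model: fix an integer $q\ge 2$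 and $J_{ij}\in\mathbb{C}$ with $J_{ij}=J_{ji}$. Configurations are functions $\omega$ from $V$ to a $q$-element set, identified with the cyclic group $\mathbb{Z}_q$; $\Omega_P$ is the set of configurations. The hamiltonian is $H_P(\omega)=\sum_{(i,j)\in E}J_{ij}\delta_{\omega(i),\omega(j)}=\sum_{i,j\in V}J'_{ij}\delta_{\omega(i),\omega(j)}$ (with $E$ regarded as a symmetric set of ordered pairs), where $J'_{ij}=J_{ij}a_{ij}$ and $a_{ij}=1$ if $(i,j)\in E$, $0$ otherwise. Preserving the hamiltonian: $C^*(\mathbb{Z}_q)$ is the group algebra, viewed as functions on $\mathbb{Z}_q$ with convolution $*$ and involution $f^*(g)=\overline{f(g^{-1})}$; $\tau(f)=f(e)$. A configuration with values $g_i\in\mathbb{Z}_q$ is identified with the element $\omega=\sum_{i\in V}\chi_i\otimes\chi_{g_i}$ of $C(V)\otimes C^*(\mathbb{Z}_q)$ (elements of which are viewed as functions $V\to C^*(\mathbb{Z}_q)$). Put $\langle f,h\rangle_{H_P}=\sum_{i,j\in V}J'_{ij}\,\tau(f(i)^* * h(j))$ on $C(V)\otimes C^*(\mathbb{Z}_q)$ (conjugate-linear in the first variable), so that $\langle\omega,\omega\rangle_{H_P}=H_P(\omega)$, and extend it to an $S$-valued form on $C(V)\otimes C^*(\mathbb{Z}_q)\otimes S$ by $\widetilde{\langle f\otimes a,h\otimes b\rangle}_{H_P}=\langle f,h\rangle_{H_P}\,a^*b$. Let $\alpha'$ be the map $\alpha'(\chi_i\otimes x)=\sum_{j\in V}\chi_j\otimes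 x\otimes q_{ji}$. Then $\alpha$ preserves the hamiltonian of the $q$-state Potts model if $\widetilde{\langle\alpha'(\omega),\alpha'(\omega)\rangle}_{H_P}=\langle\omega,\omega\rangle_{H_P}\,1_S$ for all $\omega\in\Omega_P$. *)

theory Defs
  imports "HOL-Analysis.Analysis" "HOL-Algebra.Elementary_Groups"
begin

section \<open>Unital C*-algebras\<close>

text \<open>The superclass \<^class>\<open>real_normed_algebra_1\<close> requires \<open>1 \<noteq> 0\<close>, so the zero
  algebra is not an instance.\<close>

class unital_cstar_algebra = real_normed_algebra_1 + banach +
  fixes scaleC :: "complex \<Rightarrow> 'a \<Rightarrow> 'a" (infixr "*\<^sub>C" 75)
    and star :: "'a \<Rightarrow> 'a"
  assumes scaleC_add_right: "c *\<^sub>C (x + y) = c *\<^sub>C x + c *\<^sub>C y"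
    and scaleC_add_left: "(c + d) *\<^sub>C x = c *\<^sub>C x + d *\<^sub>C x"
    and scaleC_scaleC: "c *\<^sub>C d *\<^sub>C x = (c * d) *\<^sub>C x"
    and scaleC_of_real: "complex_of_real r *\<^sub>C x = r *\<^sub>R x"
    and mult_scaleC_left: "(c *\<^sub>C x) * y = c *\<^sub>C (x * y)"
    and mult_scaleC_right: "x * (c *\<^sub>C y) = c *\<^sub>C (x * y)"
    and norm_scaleC: "norm (c *\<^sub>C x) = cmod c * norm x"
    and star_add: "star (x + y) = star x + star y"
    and star_scaleC: "star (c *\<^sub>C x) = cnj c *\<^sub>C star x"
    and star_mult: "star (x * y) = star y * star x"
    and star_star: "star (star x) = x"
    and cstar_identity: "norm (star x * x) = (norm x)\<^sup>2"

definition star_hom ::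
  "('a::unital_cstar_algebra \<Rightarrow> 'b::unital_cstar_algebra) \<Rightarrow> bool" where
  "star_hom f \<longleftrightarrow>
     (\<forall>x y. f (x + y) = f x + f y) \<and> (\<forall>c x. f (c *\<^sub>C x) = c *\<^sub>C f x) \<and>
     (\<forall>x y. f (x * y) = f x * f y) \<and> (\<forall>x. f (star x) = star (f x))"

definition unital_star_hom ::
  "('a::unital_cstar_algebra \<Rightarrow> 'b::unital_cstar_algebra) \<Rightarrow> bool" where
  "unital_star_hom f \<longleftrightarrow> star_hom f \<and> f 1 = 1"

definition unital_cstar_subalgebra :: "'a::unital_cstar_algebra set \<Rightarrow> bool" where
  "unital_cstar_subalgebra B \<longleftrightarrow>
     1 \<in> B \<and> (\<forall>x\<in>B. \<forall>y\<in>B. x + y \<in> B \<and> x * y \<in> B) \<and>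
     (\<forall>c. \<forall>x\<in>B. c *\<^sub>C x \<in> B) \<and> (\<forall>x\<in>B. star x \<in> B) \<and> closed B"

text \<open>States: positive linear functionals of norm one.\<close>

definition state :: "('a::unital_cstar_algebra \<Rightarrow> complex) \<Rightarrow> bool" where
  "state \<phi> \<longleftrightarrow>
     (\<forall>x y. \<phi> (x + y) = \<phi> x + \<phi> y) \<and> (\<forall>c x. \<phi> (c *\<^sub>C x) = c * \<phi> x) \<and>
     (\<forall>x. \<phi> (star x * x) \<in> \<real>\<^sub>\<ge>\<^sub>0) \<and> (\<forall>x. cmod (\<phi> x) \<le> norm x) \<and> \<phi> 1 = 1"


section \<open>The minimal tensor product\<close>

text \<open>A list \<open>[(a\<^sub>1, b\<^sub>1), \<dots>, (a\<^sub>n, b\<^sub>n)]\<close> represents the element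
  \<open>a\<^sub>1 \<otimes> b\<^sub>1 + \<dots> + a\<^sub>n \<otimes> b\<^sub>n\<close> of the algebraic tensor product. The following are
  its adjoint, the product of two such elements, and the value of \<open>\<phi> \<otimes> \<psi>\<close>.\<close>

definition tens_star ::
  "('a::unital_cstar_algebra \<times> 'b::unital_cstar_algebra) list \<Rightarrow> ('a \<times> 'b) list" where
  "tens_star u = map (\<lambda>(a, b). (star a, star b)) u"

definition tens_mult ::
  "('a::unital_cstar_algebra \<times> 'b::unital_cstar_algebra) list \<Rightarrow> ('a \<times> 'b) list \<Rightarrow> ('a \<times> 'b) list"
  where
  "tens_mult u v = concat (map (\<lambda>(a, b). map (\<lambda>(c, d). (a * c, b * d)) v) u)"

definition tens_functional ::
  "('a::unital_cstar_algebra \<Rightarrow> complex) \<Rightarrow> ('b::unital_cstar_algebra \<Rightarrow> complex)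
     \<Rightarrow> ('a \<times> 'b) list \<Rightarrow> complex" where
  "tens_functional \<phi> \<psi> u = (\<Sum>(a, b)\<leftarrow>u. \<phi> a * \<psi> b)"

text \<open>The minimal (spatial) C*-norm
  \<open>\<parallel>u\<parallel> = sup \<parallel>(\<pi>\<^sub>\<phi> \<otimes> \<pi>\<^sub>\<psi>)(u)\<parallel>\<close>, where \<open>\<phi>\<close> and \<open>\<psi>\<close> range over all states and
  \<open>\<pi>\<^sub>\<phi>\<close>, \<open>\<pi>\<^sub>\<psi>\<close> are their GNS representations with cyclic vectors \<open>\<xi>\<^sub>\<phi>\<close>, \<open>\<xi>\<^sub>\<psi>\<close>.
  The operator norm is evaluated on the dense subspace of vectors
  \<open>(\<pi>\<^sub>\<phi> \<otimes> \<pi>\<^sub>\<psi>)(v) (\<xi>\<^sub>\<phi> \<otimes> \<xi>\<^sub>\<psi>)\<close>, whose squared norm is \<open>(\<phi> \<otimes> \<psi>)(v* v)\<close>; this avoids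
  Hilbert spaces.\<close>

definition min_tensor_norm ::
  "('a::unital_cstar_algebra \<times> 'b::unital_cstar_algebra) list \<Rightarrow> real" where
  "min_tensor_norm u =
     Sup {sqrt (Re (tens_functional \<phi> \<psi> (tens_mult (tens_star (tens_mult u v)) (tens_mult u v)))
              / Re (tens_functional \<phi> \<psi> (tens_mult (tens_star v) v))) | \<phi> \<psi> v.
          state \<phi> \<and> state \<psi> \<and> tens_functional \<phi> \<psi> (tens_mult (tens_star v) v) \<noteq> 0}"

text \<open>\<open>min_tensor t\<close> says that \<open>'c\<close>, with \<open>t a b\<close> in the role of \<open>a \<otimes> b\<close>, is the minimal tensor
  product of \<open>'a\<close> and \<open>'b\<close>: a C*-algebra which is a completion of the algebraic
  tensor product in the norm \<^const>\<open>min_tensor_norm\<close>. This determines \<open>('c, t)\<close> up to a unique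
  isomorphism. The cross-norm clause is a consequence of the norm formula; it is
  listed because it makes the embedding of the algebraic tensor product visible.\<close>

definition min_tensor ::
  "('a::unital_cstar_algebra \<Rightarrow> 'b::unital_cstar_algebra \<Rightarrow> 'c::unital_cstar_algebra) \<Rightarrow> bool"
  where
  "min_tensor t \<longleftrightarrow>
     (\<forall>a a' b. t (a + a') b = t a b + t a' b) \<and>
     (\<forall>a b b'. t a (b + b') = t a b + t a b') \<and>
     (\<forall>c a b. t (c *\<^sub>C a) b = c *\<^sub>C t a b \<and> t a (c *\<^sub>C b) = c *\<^sub>C t a b) \<and>
     (\<forall>a b a' b'. t a b * t a' b' = t (a * a') (b * b')) \<and>
     (\<forall>a b. star (t a b) = t (star a) (star b)) \<and>
     t 1 1 = 1 \<and>
     (\<forall>a b. norm (t a b) = norm a * norm b) \<and>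
     (\<forall>u. norm (\<Sum>(a, b)\<leftarrow>u. t a b) = min_tensor_norm u) \<and>
     closure (span {t a b | a b. True}) = UNIV"

text \<open>The subspace \<open>X \<otimes> Y\<close> for C*-subalgebras \<open>X\<close>, \<open>Y\<close> (the minimal tensor product is injective).
  Here and below \<^const>\<open>span\<close> is the real linear span; the spanning sets are closed under
  complex scalars, so it coincides with the complex span.\<close>

definition tensor_sub ::
  "('a \<Rightarrow> 'b \<Rightarrow> 'c::unital_cstar_algebra) \<Rightarrow> 'a set \<Rightarrow> 'b set \<Rightarrow> 'c set" where
  "tensor_sub t X Y = closure (span {t a b | a b. a \<in> X \<and> b \<in> Y})"

text \<open>The types \<open>'ab\<close>, \<open>'bc\<close> and \<open>'abc\<close> are the tensor products \<open>A \<otimes> B\<close>, \<open>B \<otimes> C\<close> and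
  \<open>(A \<otimes> B) \<otimes> C = A \<otimes> (B \<otimes> C)\<close>.\<close>

definition triple_tensor ::
  "('a::unital_cstar_algebra \<Rightarrow> 'b::unital_cstar_algebra \<Rightarrow> 'ab::unital_cstar_algebra)
   \<Rightarrow> ('b \<Rightarrow> 'c::unital_cstar_algebra \<Rightarrow> 'bc::unital_cstar_algebra)
   \<Rightarrow> ('ab \<Rightarrow> 'c \<Rightarrow> 'abc::unital_cstar_algebra) \<Rightarrow> ('a \<Rightarrow> 'bc \<Rightarrow> 'abc) \<Rightarrow> bool" where
  "triple_tensor t_ab t_bc t_ab_c t_a_bc \<longleftrightarrow>
     min_tensor t_ab \<and> min_tensor t_bc \<and> min_tensor t_ab_c \<and> min_tensor t_a_bc \<and>
     (\<forall>a b c. t_ab_c (t_ab a b) c = t_a_bc a (t_bc b c))"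

text \<open>\<open>F = f \<otimes> g\<close>. For *-homomorphisms \<open>f\<close>, \<open>g\<close> between C*-algebras such an \<open>F\<close> exists and, by
  automatic continuity, is unique.\<close>

definition is_tensor_hom ::
  "('a::unital_cstar_algebra \<Rightarrow> 'b::unital_cstar_algebra \<Rightarrow> 'ab::unital_cstar_algebra)
   \<Rightarrow> ('c::unital_cstar_algebra \<Rightarrow> 'd::unital_cstar_algebra \<Rightarrow> 'cd::unital_cstar_algebra)
   \<Rightarrow> ('a \<Rightarrow> 'c) \<Rightarrow> ('b \<Rightarrow> 'd) \<Rightarrow> ('ab \<Rightarrow> 'cd) \<Rightarrow> bool" where
  "is_tensor_hom t t' f g F \<longleftrightarrow> star_hom F \<and> (\<forall>a b. F (t a b) = t' (f a) (g b))"


section \<open>Compact quantum groups and co-actions\<close>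

text \<open>\<open>S = 's\<close>, \<open>S \<otimes> S = 'ss\<close> (elementary tensors \<open>t\<close>), \<open>S \<otimes> S \<otimes> S = 'sss\<close>. The density
  conditions are stated relative to a subalgebra \<open>S\<^sub>1\<close>, because they are needed
  for Woronowicz subalgebras as well.\<close>

definition cancellation_dense ::
  "('s::unital_cstar_algebra \<Rightarrow> 's \<Rightarrow> 'ss::unital_cstar_algebra) \<Rightarrow> ('s \<Rightarrow> 'ss) \<Rightarrow> 's set \<Rightarrow> bool"
  where
  "cancellation_dense t \<Delta> S\<^sub>1 \<longleftrightarrow>
     closure (span {\<Delta> a * t 1 b | a b. a \<in> S\<^sub>1 \<and> b \<in> S\<^sub>1}) = tensor_sub t S\<^sub>1 S\<^sub>1 \<and>
     closure (span {\<Delta> a * t b 1 | a b. a \<in> S\<^sub>1 \<and> b \<in> S\<^sub>1}) = tensor_sub t S\<^sub>1 S\<^sub>1"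

definition compact_quantum_group ::
  "('s::unital_cstar_algebra \<Rightarrow> 's \<Rightarrow> 'ss::unital_cstar_algebra)
   \<Rightarrow> ('ss \<Rightarrow> 's \<Rightarrow> 'sss::unital_cstar_algebra) \<Rightarrow> ('s \<Rightarrow> 'ss \<Rightarrow> 'sss) \<Rightarrow> ('s \<Rightarrow> 'ss) \<Rightarrow> bool" where
  "compact_quantum_group t t_l t_r \<Delta> \<longleftrightarrow>
     triple_tensor t t t_l t_r \<and> unital_star_hom \<Delta> \<and>
     (\<exists>F G. is_tensor_hom t t_l \<Delta> id F \<and> is_tensor_hom t t_r id \<Delta> G \<and> (\<forall>x. F (\<Delta> x) = G (\<Delta> x))) \<and>
     cancellation_dense t \<Delta> UNIV"

definition woronowicz_subalgebra ::
  "('s::unital_cstar_algebra \<Rightarrow> 's \<Rightarrow> 'ss::unital_cstar_algebra) \<Rightarrow> ('s \<Rightarrow> 'ss) \<Rightarrow> 's set \<Rightarrow> bool"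
  where
  "woronowicz_subalgebra t \<Delta> S\<^sub>1 \<longleftrightarrow>
     unital_cstar_subalgebra S\<^sub>1 \<and> \<Delta> ` S\<^sub>1 \<subseteq> tensor_sub t S\<^sub>1 S\<^sub>1 \<and> cancellation_dense t \<Delta> S\<^sub>1"

text \<open>\<open>\<alpha>\<close> takes values in \<open>A \<otimes> S\<^sub>1\<close> and the span of \<open>\<alpha>(A)(1 \<otimes> S\<^sub>1)\<close> is dense in \<open>A \<otimes> S\<^sub>1\<close>.\<close>

definition coacts_into ::
  "('a::unital_cstar_algebra \<Rightarrow> 's::unital_cstar_algebra \<Rightarrow> 'as::unital_cstar_algebra)
   \<Rightarrow> ('a \<Rightarrow> 'as) \<Rightarrow> 's set \<Rightarrow> bool" where
  "coacts_into t_as \<alpha> S\<^sub>1 \<longleftrightarrow>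
     range \<alpha> \<subseteq> tensor_sub t_as UNIV S\<^sub>1 \<and>
     closure (span {\<alpha> a * t_as 1 s | a s. s \<in> S\<^sub>1}) = tensor_sub t_as UNIV S\<^sub>1"

definition coaction ::
  "('s::unital_cstar_algebra \<Rightarrow> 's \<Rightarrow> 'ss::unital_cstar_algebra) \<Rightarrow> ('s \<Rightarrow> 'ss)
   \<Rightarrow> ('a::unital_cstar_algebra \<Rightarrow> 's \<Rightarrow> 'as::unital_cstar_algebra)
   \<Rightarrow> ('as \<Rightarrow> 's \<Rightarrow> 'ass::unital_cstar_algebra) \<Rightarrow> ('a \<Rightarrow> 'ss \<Rightarrow> 'ass) \<Rightarrow> ('a \<Rightarrow> 'as) \<Rightarrow> bool" where
  "coaction t \<Delta> t_as t_as_s t_a_ss \<alpha> \<longleftrightarrow>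
     triple_tensor t_as t t_as_s t_a_ss \<and> star_hom \<alpha> \<and>
     (\<exists>F G. is_tensor_hom t_as t_as_s \<alpha> id F \<and> is_tensor_hom t_as t_a_ss id \<Delta> G \<and>
            (\<forall>a. F (\<alpha> a) = G (\<alpha> a))) \<and>
     coacts_into t_as \<alpha> UNIV"

text \<open>For \<open>S\<^sub>1\<close> a Woronowicz subalgebra, a co-action of \<open>S\<close> is a co-action of \<open>S\<^sub>1\<close> iff
  \<^const>\<open>coacts_into\<close> holds, since the co-action identity is inherited.\<close>

definition faithful_coaction ::
  "('s::unital_cstar_algebra \<Rightarrow> 's \<Rightarrow> 'ss::unital_cstar_algebra) \<Rightarrow> ('s \<Rightarrow> 'ss)
   \<Rightarrow> ('a::unital_cstar_algebra \<Rightarrow> 's \<Rightarrow> 'as::unital_cstar_algebra)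
   \<Rightarrow> ('as \<Rightarrow> 's \<Rightarrow> 'ass::unital_cstar_algebra) \<Rightarrow> ('a \<Rightarrow> 'ss \<Rightarrow> 'ass) \<Rightarrow> ('a \<Rightarrow> 'as) \<Rightarrow> bool" where
  "faithful_coaction t \<Delta> t_as t_as_s t_a_ss \<alpha> \<longleftrightarrow>
     coaction t \<Delta> t_as t_as_s t_a_ss \<alpha> \<and>
     \<not> (\<exists>S\<^sub>1. S\<^sub>1 \<noteq> UNIV \<and> woronowicz_subalgebra t \<Delta> S\<^sub>1 \<and> coacts_into t_as \<alpha> S\<^sub>1)"


section \<open>The C*-algebra of functions on a finite set\<close>

text \<open>\<open>'v cfun\<close> is \<open>C(V)\<close> with pointwise operations and the supremum norm; a separate type
  is needed because \<^typ>\<open>complex ^ 'v\<close> carries the Euclidean norm.\<close>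

typedef 'v cfun = "UNIV :: ('v \<Rightarrow> complex) set"
  morphisms cfun_apply Cfun by simp

setup_lifting type_definition_cfun

instantiation cfun :: (finite) real_normed_algebra_1
begin

lift_definition zero_cfun :: "'a cfun" is "\<lambda>_. 0" .
lift_definition one_cfun :: "'a cfun" is "\<lambda>_. 1" .
lift_definition plus_cfun :: "'a cfun \<Rightarrow> 'a cfun \<Rightarrow> 'a cfun" is "\<lambda>f g v. f v + g v" .
lift_definition minus_cfun :: "'a cfun \<Rightarrow> 'a cfun \<Rightarrow> 'a cfun" is "\<lambda>f g v. f v - g v" .
lift_definition uminus_cfun :: "'a cfun \<Rightarrow> 'a cfun" is "\<lambda>f v. - f v" .
lift_definition times_cfun :: "'a cfun \<Rightarrow> 'a cfun \<Rightarrow> 'a cfun" is "\<lambda>f g v. f v * g v" .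
lift_definition scaleR_cfun :: "real \<Rightarrow> 'a cfun \<Rightarrow> 'a cfun" is "\<lambda>r f v. r *\<^sub>R f v" .
lift_definition norm_cfun :: "'a cfun \<Rightarrow> real" is "\<lambda>f. Max (range (\<lambda>v. cmod (f v)))" .

definition sgn_cfun :: "'a cfun \<Rightarrow> 'a cfun" where
  "sgn_cfun f = scaleR (inverse (norm f)) f"
definition dist_cfun :: "'a cfun \<Rightarrow> 'a cfun \<Rightarrow> real" where
  "dist_cfun f g = norm (f - g)"
definition uniformity_cfun :: "('a cfun \<times> 'a cfun) filter" where
  "uniformity_cfun = (INF e\<in>{0<..}. principal {(f, g). dist f g < e})"
definition open_cfun :: "'a cfun set \<Rightarrow> bool" where
  "open_cfun U \<longleftrightarrow> (\<forall>f\<in>U. \<forall>\<^sub>F (f', g) in uniformity. f' = f \<longrightarrow> g \<in> U)"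

lemma cfun_norm_ge: "cmod (cfun_apply f v) \<le> norm (f :: 'a cfun)"
  by transfer (auto intro: Max_ge)

lemma cfun_norm_le: "(\<And>v. cmod (cfun_apply f v) \<le> b) \<Longrightarrow> norm (f :: 'a cfun) \<le> b"
  by transfer auto

lemma cfun_norm_attained: "\<exists>v. norm (f :: 'a cfun) = cmod (cfun_apply f v)"
proof -
  have "Max (range (\<lambda>v. cmod (cfun_apply f v))) \<in> range (\<lambda>v. cmod (cfun_apply f v))"
    by (rule Max_in) auto
  then obtain v where "Max (range (\<lambda>v. cmod (cfun_apply f v))) = cmod (cfun_apply f v)" by (rule rangeE)
  thus ?thesis unfolding norm_cfun.rep_eq by (intro exI)
qed

instance proof
  fix a b c :: "'a cfun" and r s :: real
  show "a + b + c = a + (b + c)" "a + b = b + a" "0 + a = a" "- a + a = 0" "a - b = a + - b"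
    "a * b * c = a * (b * c)" "(a + b) * c = a * c + b * c" "a * (b + c) = a * b + a * c"
    "1 * a = a" "a * 1 = a"
    "r *\<^sub>R (a + b) = r *\<^sub>R a + r *\<^sub>R b" "(r + s) *\<^sub>R a = r *\<^sub>R a + s *\<^sub>R a"
    "r *\<^sub>R s *\<^sub>R a = (r * s) *\<^sub>R a" "1 *\<^sub>R a = a"
    "r *\<^sub>R a * b = r *\<^sub>R (a * b)" "a * r *\<^sub>R b = r *\<^sub>R (a * b)"
    by (transfer, auto simp: algebra_simps scaleR_conv_of_real)+
  show "(0 :: 'a cfun) \<noteq> 1" by transfer (auto simp: fun_eq_iff)
  show "sgn a = scaleR (inverse (norm a)) a" "dist a b = norm (a - b)"
    by (simp_all add: sgn_cfun_def dist_cfun_def)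
  show "uniformity = (INF e\<in>{0<..}. principal {(f :: 'a cfun, g). dist f g < e})"
    by (rule uniformity_cfun_def)
  show "open U \<longleftrightarrow> (\<forall>f\<in>U. \<forall>\<^sub>F (f', g) in uniformity. f' = f \<longrightarrow> g \<in> U)" for U :: "'a cfun set"
    by (rule open_cfun_def)
  show "norm a = 0 \<longleftrightarrow> a = 0"
  proof
    assume "norm a = 0"
    hence "cfun_apply a v = 0" for v using cfun_norm_ge[of a v] by simp
    thus "a = 0" by transfer auto
  next
    assume "a = 0" thus "norm a = 0" by transfer simp
  qed
  show "norm (a + b) \<le> norm a + norm b"
  proof (rule cfun_norm_le)
    fix v show "cmod (cfun_apply (a + b) v) \<le> norm a + norm b"
      using norm_triangle_ineq[of "cfun_apply a v" "cfun_apply b v"]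
        cfun_norm_ge[of a v] cfun_norm_ge[of b v] by (simp add: plus_cfun.rep_eq)
  qed
  show "norm (a * b) \<le> norm a * norm b"
  proof (rule cfun_norm_le)
    fix v show "cmod (cfun_apply (a * b) v) \<le> norm a * norm b"
      using mult_mono'[OF cfun_norm_ge[of a v] cfun_norm_ge[of b v]]
      by (simp add: times_cfun.rep_eq norm_mult)
  qed
  show "norm (r *\<^sub>R a) = \<bar>r\<bar> * norm a"
  proof (rule antisym)
    show "norm (r *\<^sub>R a) \<le> \<bar>r\<bar> * norm a"
      by (rule cfun_norm_le) (simp add: scaleR_cfun.rep_eq cfun_norm_ge mult_left_mono)
    obtain v where v: "norm a = cmod (cfun_apply a v)" using cfun_norm_attained by blast
    show "\<bar>r\<bar> * norm a \<le> norm (r *\<^sub>R a)"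
      using cfun_norm_ge[of "r *\<^sub>R a" v] by (simp add: v scaleR_cfun.rep_eq)
  qed
  show "norm (1 :: 'a cfun) = 1" by transfer simp
qed

end

instance cfun :: (finite) banach
proof
  fix X :: "nat \<Rightarrow> 'a cfun"
  assume C: "Cauchy X"
  have d: "dist (cfun_apply f v) (cfun_apply g v) \<le> dist f g" for f g :: "'a cfun" and v
    using cfun_norm_ge[of "f - g" v] by (simp add: dist_norm minus_cfun.rep_eq)
  have "Cauchy (\<lambda>n. cfun_apply (X n) v)" for v
    using C d unfolding Cauchy_def by (meson le_less_trans)
  then obtain l where l: "\<And>v. (\<lambda>n. cfun_apply (X n) v) \<longlonglongrightarrow> l v"
    unfolding Cauchy_convergent_iff convergent_def by metis
  have "(\<lambda>n. \<Sum>v\<in>UNIV. cmod (cfun_apply (X n) v - l v)) \<longlonglongrightarrow> (\<Sum>v\<in>(UNIV :: 'a set). 0)"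
    by (intro tendsto_sum tendsto_norm_zero LIM_zero l)
  hence s: "(\<lambda>n. \<Sum>v\<in>UNIV. cmod (cfun_apply (X n) v - l v)) \<longlonglongrightarrow> 0" by simp
  have b: "norm (X n - Cfun l) \<le> (\<Sum>v\<in>UNIV. cmod (cfun_apply (X n) v - l v))" for n
  proof (rule cfun_norm_le)
    fix v
    have "cmod (cfun_apply (X n) v - l v) \<le> (\<Sum>v\<in>UNIV. cmod (cfun_apply (X n) v - l v))"
      by (rule member_le_sum[of v UNIV "\<lambda>v. cmod (cfun_apply (X n) v - l v)"]) auto
    thus "cmod (cfun_apply (X n - Cfun l) v) \<le> (\<Sum>v\<in>UNIV. cmod (cfun_apply (X n) v - l v))"
      by (simp add: minus_cfun.rep_eq Cfun_inverse)
  qed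
  have "(\<lambda>n. X n - Cfun l) \<longlonglongrightarrow> 0"
    by (rule Lim_null_comparison[OF _ s]) (simp add: b)
  hence "X \<longlonglongrightarrow> Cfun l" by (rule LIM_zero_cancel)
  thus "convergent X" by (auto simp: convergent_def)
qed

instantiation cfun :: (finite) unital_cstar_algebra
begin

lift_definition scaleC_cfun :: "complex \<Rightarrow> 'a cfun \<Rightarrow> 'a cfun" is "\<lambda>c f v. c * f v" .
lift_definition star_cfun :: "'a cfun \<Rightarrow> 'a cfun" is "\<lambda>f v. cnj (f v)" .

instance proof
  fix a b :: "'a cfun" and r :: real and x y :: complex
  show "x *\<^sub>C (a + b) = x *\<^sub>C a + x *\<^sub>C b" "(x + y) *\<^sub>C a = x *\<^sub>C a + y *\<^sub>C a"
    "x *\<^sub>C y *\<^sub>C a = (x * y) *\<^sub>C a" "complex_of_real r *\<^sub>C a = r *\<^sub>R a"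
    "x *\<^sub>C a * b = x *\<^sub>C (a * b)" "a * x *\<^sub>C b = x *\<^sub>C (a * b)"
    "star (a + b) = star a + star b" "star (x *\<^sub>C a) = cnj x *\<^sub>C star a"
    "star (a * b) = star b * star a" "star (star a) = a"
    by (simp_all add: cfun_apply_inject[symmetric] fun_eq_iff scaleC_cfun.rep_eq star_cfun.rep_eq
        plus_cfun.rep_eq times_cfun.rep_eq scaleR_cfun.rep_eq distrib_left distrib_right
        scaleR_conv_of_real[where 'a = complex] mult_ac)
  obtain v where v: "norm a = cmod (cfun_apply a v)" using cfun_norm_attained by blast
  show "norm (x *\<^sub>C a) = cmod x * norm a"
  proof (rule antisym)
    show "norm (x *\<^sub>C a) \<le> cmod x * norm a"
      by (rule cfun_norm_le) (simp add: scaleC_cfun.rep_eq norm_mult cfun_norm_ge mult_left_mono)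
    show "cmod x * norm a \<le> norm (x *\<^sub>C a)"
      using cfun_norm_ge[of "x *\<^sub>C a" v] by (simp add: v scaleC_cfun.rep_eq norm_mult)
  qed
  show "norm (star a * a) = (norm a)\<^sup>2"
  proof (rule antisym)
    show "norm (star a * a) \<le> (norm a)\<^sup>2"
      by (rule cfun_norm_le)
        (simp add: times_cfun.rep_eq star_cfun.rep_eq norm_mult power2_eq_square cfun_norm_ge mult_mono')
    show "(norm a)\<^sup>2 \<le> norm (star a * a)"
      using cfun_norm_ge[of "star a * a" v]
      by (simp add: v times_cfun.rep_eq star_cfun.rep_eq norm_mult power2_eq_square)
  qed
qed

end

definition char_fun :: "'v \<Rightarrow> 'v cfun" where
  "char_fun i = Cfun (\<lambda>k. if k = i then 1 else 0)"

text \<open>\<open>\<alpha>(\<chi>\<^sub>i) = \<Sum>\<^sub>j \<chi>\<^sub>j \<otimes> q\<^sub>j\<^sub>i\<close>, with \<open>Q $ j $ i = q\<^sub>j\<^sub>i\<close>.\<close>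

definition corepresentation_matrix ::
  "('v::finite cfun \<Rightarrow> 's::unital_cstar_algebra \<Rightarrow> 'as::unital_cstar_algebra)
   \<Rightarrow> ('v cfun \<Rightarrow> 'as) \<Rightarrow> 's ^ 'v ^ 'v \<Rightarrow> bool" where
  "corepresentation_matrix t_as \<alpha> Q \<longleftrightarrow>
     (\<forall>i. \<alpha> (char_fun i) = (\<Sum>j\<in>UNIV. t_as (char_fun j) (Q $ j $ i)))"

definition scalar_matrix :: "complex ^ 'v ^ 'v \<Rightarrow> 's::unital_cstar_algebra ^ 'v ^ 'v" where
  "scalar_matrix M = (\<chi> i j. (M $ i $ j) *\<^sub>C 1)"


section \<open>The Potts model\<close>

text \<open>\<open>C*(G)\<close> for a finite group \<open>G\<close>: functions on \<open>carrier G\<close>; values outside the carrier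
  are never used.\<close>

definition conv :: "('g, 'm) monoid_scheme \<Rightarrow> ('g \<Rightarrow> complex) \<Rightarrow> ('g \<Rightarrow> complex) \<Rightarrow> 'g \<Rightarrow> complex" where
  "conv G f h = (\<lambda>g. \<Sum>k\<in>carrier G. f k * h (inv\<^bsub>G\<^esub> k \<otimes>\<^bsub>G\<^esub> g))"

definition conv_star :: "('g, 'm) monoid_scheme \<Rightarrow> ('g \<Rightarrow> complex) \<Rightarrow> 'g \<Rightarrow> complex" where
  "conv_star G f = (\<lambda>g. cnj (f (inv\<^bsub>G\<^esub> g)))"

definition conv_trace :: "('g, 'm) monoid_scheme \<Rightarrow> ('g \<Rightarrow> complex) \<Rightarrow> complex" where
  "conv_trace G f = f \<one>\<^bsub>G\<^esub>"

definition delta :: "'g \<Rightarrow> 'g \<Rightarrow> complex" where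
  "delta g = (\<lambda>h. if h = g then 1 else 0)"

abbreviation Zmod :: "nat \<Rightarrow> int monoid" where
  "Zmod q \<equiv> integer_mod_group q"

definition adjacency :: "('v::finite \<times> 'v) set \<Rightarrow> complex ^ 'v ^ 'v" where
  "adjacency E = (\<chi> i j. if (i, j) \<in> E then 1 else 0)"

text \<open>The matrix \<open>J'\<close>.\<close>

definition edge_coupling :: "('v::finite \<times> 'v) set \<Rightarrow> complex ^ 'v ^ 'v \<Rightarrow> complex ^ 'v ^ 'v" where
  "edge_coupling E J = (\<chi> i j. J $ i $ j * adjacency E $ i $ j)"

definition potts_configs :: "nat \<Rightarrow> ('v \<Rightarrow> int) set" where
  "potts_configs q = {\<omega>. \<forall>i. \<omega> i \<in> carrier (Zmod q)}"

definition potts_hamiltonian ::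
  "('v::finite \<times> 'v) set \<Rightarrow> complex ^ 'v ^ 'v \<Rightarrow> ('v \<Rightarrow> int) \<Rightarrow> complex" where
  "potts_hamiltonian E J \<omega> = (\<Sum>(i, j)\<in>E. J $ i $ j * (if \<omega> i = \<omega> j then 1 else 0))"

text \<open>The form on \<open>C(V) \<otimes> C*(Z\<^sub>q)\<close>, whose elements are functions \<open>V \<rightarrow> C*(Z\<^sub>q)\<close>.\<close>

definition potts_form ::
  "nat \<Rightarrow> ('v::finite \<times> 'v) set \<Rightarrow> complex ^ 'v ^ 'v
   \<Rightarrow> ('v \<Rightarrow> int \<Rightarrow> complex) \<Rightarrow> ('v \<Rightarrow> int \<Rightarrow> complex) \<Rightarrow> complex" where
  "potts_form q E J f h =
     (\<Sum>i\<in>UNIV. \<Sum>j\<in>UNIV. edge_coupling E J $ i $ j *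
        conv_trace (Zmod q) (conv (Zmod q) (conv_star (Zmod q) (f i)) (h j)))"

text \<open>A configuration as the element \<open>\<Sum>\<^sub>i \<chi>\<^sub>i \<otimes> \<chi>\<^bsub>\<omega>(i)\<^esub>\<close>.\<close>

definition config_elem :: "('v \<Rightarrow> int) \<Rightarrow> 'v \<Rightarrow> int \<Rightarrow> complex" where
  "config_elem \<omega> = (\<lambda>i. delta (\<omega> i))"

text \<open>The basis element \<open>\<chi>\<^sub>i \<otimes> \<chi>\<^sub>g\<close>.\<close>

definition basis_elem :: "'v \<Rightarrow> int \<Rightarrow> 'v \<Rightarrow> int \<Rightarrow> complex" where
  "basis_elem i g = (\<lambda>k. if k = i then delta g else (\<lambda>_. 0))"

text \<open>\<open>C(V) \<otimes> C*(Z\<^sub>q) \<otimes> S\<close> consists of functions \<open>X : V \<rightarrow> Z\<^sub>q \<rightarrow> S\<close>, with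
  \<open>X = \<Sum> (\<chi>\<^sub>i \<otimes> \<chi>\<^sub>g) \<otimes> X(i, g)\<close>; the form is extended along this basis expansion. Lemma
  \<open>potts_form_ext_elementary\<close> below gives its values on elementary tensors \<open>f \<otimes> a\<close>.\<close>

definition potts_form_ext ::
  "nat \<Rightarrow> ('v::finite \<times> 'v) set \<Rightarrow> complex ^ 'v ^ 'v
   \<Rightarrow> ('v \<Rightarrow> int \<Rightarrow> 's::unital_cstar_algebra) \<Rightarrow> ('v \<Rightarrow> int \<Rightarrow> 's) \<Rightarrow> 's" where
  "potts_form_ext q E J X Y =
     (\<Sum>i\<in>UNIV. \<Sum>g\<in>carrier (Zmod q). \<Sum>j\<in>UNIV. \<Sum>h\<in>carrier (Zmod q).
        potts_form q E J (basis_elem i g) (basis_elem j h) *\<^sub>C (star (X i g) * Y j h))"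

text \<open>The linear map \<open>\<alpha>'\<close> with \<open>\<alpha>'(\<chi>\<^sub>i \<otimes> x) = \<Sum>\<^sub>j \<chi>\<^sub>j \<otimes> x \<otimes> q\<^sub>j\<^sub>i\<close>.\<close>

definition alpha_prime ::
  "'s::unital_cstar_algebra ^ 'v ^ 'v \<Rightarrow> ('v::finite \<Rightarrow> int \<Rightarrow> complex) \<Rightarrow> 'v \<Rightarrow> int \<Rightarrow> 's" where
  "alpha_prime Q f = (\<lambda>j g. \<Sum>i\<in>UNIV. f i g *\<^sub>C (Q $ j $ i))"

definition preserves_potts_hamiltonian ::
  "nat \<Rightarrow> ('v::finite \<times> 'v) set \<Rightarrow> complex ^ 'v ^ 'v
   \<Rightarrow> 's::unital_cstar_algebra ^ 'v ^ 'v \<Rightarrow> bool" where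
  "preserves_potts_hamiltonian q E J Q \<longleftrightarrow>
     (\<forall>\<omega>\<in>potts_configs q.
        potts_form_ext q E J (alpha_prime Q (config_elem \<omega>)) (alpha_prime Q (config_elem \<omega>))
        = potts_form q E J (config_elem \<omega>) (config_elem \<omega>) *\<^sub>C 1)"

subsection \<open>Agreement with the formulas on elementary tensors\<close>

lemma scaleC_zero_left [simp]: "0 *\<^sub>C (x :: 's::unital_cstar_algebra) = 0"
  using scaleC_of_real[of 0 x] by simp

lemma scaleC_one [simp]: "1 *\<^sub>C (x :: 's::unital_cstar_algebra) = x"
  using scaleC_of_real[of 1 x] by simp

lemma scaleC_sum_left:
  "finite A \<Longrightarrow> (\<Sum>i\<in>A. f i) *\<^sub>C (x :: 's::unital_cstar_algebra) = (\<Sum>i\<in>A. f i *\<^sub>C x)"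
  by (induction A rule: finite_induct) (auto simp: scaleC_add_left)

lemma finite_carrier_Zmod: "q > 0 \<Longrightarrow> finite (carrier (Zmod q))"
  by (simp add: carrier_integer_mod_group)

lemma conv_trace_conv_star:
  "conv_trace (Zmod q) (conv (Zmod q) (conv_star (Zmod q) f) h)
   = (\<Sum>g\<in>carrier (Zmod q). cnj (f g) * h g)"
proof -
  interpret group "Zmod q" by (rule group_integer_mod_group)
  have "(\<Sum>k\<in>carrier (Zmod q). cnj (f (inv\<^bsub>Zmod q\<^esub> k)) * h (inv\<^bsub>Zmod q\<^esub> k))
      = (\<Sum>g\<in>carrier (Zmod q). cnj (f g) * h g)"
    by (rule sum.reindex_bij_witness[of _ "\<lambda>x. inv\<^bsub>Zmod q\<^esub> x" "\<lambda>x. inv\<^bsub>Zmod q\<^esub> x"])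
      (simp_all only: inv_inv inv_closed)
  moreover have "conv_trace (Zmod q) (conv (Zmod q) (conv_star (Zmod q) f) h)
      = (\<Sum>k\<in>carrier (Zmod q). cnj (f (inv\<^bsub>Zmod q\<^esub> k)) * h (inv\<^bsub>Zmod q\<^esub> k))"
    unfolding conv_trace_def conv_def conv_star_def
    by (intro sum.cong refl) (simp only: r_one inv_closed)
  ultimately show ?thesis by simp
qed

lemma potts_form_eq:
  "potts_form q E J f h = (\<Sum>i\<in>UNIV. \<Sum>j\<in>UNIV. \<Sum>g\<in>carrier (Zmod q).
     edge_coupling E J $ i $ j * (cnj (f i g) * h j g))"
  by (simp add: potts_form_def conv_trace_conv_star sum_distrib_left)

lemma potts_form_config:
  assumes "q > 0" "\<omega> \<in> potts_configs q"
  shows "potts_form q E J (config_elem \<omega>) (config_elem \<omega>) = potts_hamiltonian E J \<omega>"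
proof -
  have "(\<Sum>g\<in>carrier (Zmod q). c * (cnj (delta (\<omega> i) g) * delta (\<omega> j) g))
      = c * (if \<omega> i = \<omega> j then 1 else 0)" for i j and c :: complex
  proof -
    have "(\<Sum>g\<in>carrier (Zmod q). c * (cnj (delta (\<omega> i) g) * delta (\<omega> j) g))
        = (\<Sum>g\<in>carrier (Zmod q). if g = \<omega> i then c * delta (\<omega> j) (\<omega> i) else 0)"
      by (intro sum.cong refl) (auto simp: delta_def)
    also have "\<dots> = c * (if \<omega> i = \<omega> j then 1 else 0)"
      using assms by (simp add: finite_carrier_Zmod potts_configs_def delta_def)
    finally show ?thesis .
  qed
  hence "potts_form q E J (config_elem \<omega>) (config_elem \<omega>)
      = (\<Sum>i\<in>UNIV. \<Sum>j\<in>UNIV. edge_coupling E J $ i $ j * (if \<omega> i = \<omega> j then 1 else 0))"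
    by (simp add: potts_form_eq config_elem_def)
  also have "\<dots> = (\<Sum>p\<in>UNIV. if p \<in> E then J $ fst p $ snd p * (if \<omega> (fst p) = \<omega> (snd p) then 1 else 0) else 0)"
    unfolding sum.cartesian_product UNIV_Times_UNIV
    by (intro sum.cong refl) (auto simp: edge_coupling_def adjacency_def)
  also have "\<dots> = (\<Sum>p\<in>E. J $ fst p $ snd p * (if \<omega> (fst p) = \<omega> (snd p) then 1 else 0))"
    by (rule sum.inter_restrict[of UNIV _ E, simplified, symmetric])
  also have "\<dots> = potts_hamiltonian E J \<omega>"
    by (simp add: potts_hamiltonian_def case_prod_beta)
  finally show ?thesis .
qed

lemma potts_form_basis:
  assumes "q > 0" "g \<in> carrier (Zmod q)"
  shows "potts_form q E J (basis_elem i g) (basis_elem j h)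
    = edge_coupling E J $ i $ j * (if g = h then 1 else 0)"
proof -
  have "(\<Sum>g'\<in>carrier (Zmod q). edge_coupling E J $ i' $ j' *
           (cnj (basis_elem i g i' g') * basis_elem j h j' g'))
      = (if j' = j then if i' = i then edge_coupling E J $ i $ j * (if g = h then 1 else 0) else 0 else 0)"
    for i' j'
  proof -
    have "(\<Sum>g'\<in>carrier (Zmod q). edge_coupling E J $ i' $ j' *
           (cnj (basis_elem i g i' g') * basis_elem j h j' g'))
        = (\<Sum>g'\<in>carrier (Zmod q). if g' = g then
            (if j' = j then if i' = i then edge_coupling E J $ i $ j * (if g = h then 1 else 0) else 0 else 0) else 0)"
      by (intro sum.cong refl) (auto simp: basis_elem_def delta_def)
    also have "\<dots> = (if j' = j then if i' = i then edge_coupling E J $ i $ j * (if g = h then 1 else 0) else 0 else 0)"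
      using assms by (simp add: finite_carrier_Zmod)
    finally show ?thesis .
  qed
  thus ?thesis by (simp add: potts_form_eq)
qed

lemma potts_form_ext_elementary:
  assumes "q > 0"
  shows "potts_form_ext q E J (\<lambda>i g. f i g *\<^sub>C a) (\<lambda>i g. h i g *\<^sub>C b)
    = potts_form q E J f h *\<^sub>C (star a * (b :: 's::unital_cstar_algebra))"
proof -
  let ?G = "carrier (Zmod q)"
  have fin: "finite ?G" using assms by (rule finite_carrier_Zmod)
  have "potts_form_ext q E J (\<lambda>i g. f i g *\<^sub>C a) (\<lambda>i g. h i g *\<^sub>C b)
     = (\<Sum>i\<in>UNIV. \<Sum>g\<in>?G. \<Sum>j\<in>UNIV. \<Sum>g'\<in>?G. if g' = g then
         (edge_coupling E J $ i $ j * (cnj (f i g) * h j g)) *\<^sub>C (star a * b) else 0)"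
    unfolding potts_form_ext_def
    by (intro sum.cong refl)
      (auto simp: potts_form_basis assms star_scaleC mult_scaleC_left mult_scaleC_right scaleC_scaleC
        mult.commute[of "cnj _"])
  also have "\<dots> = (\<Sum>i\<in>UNIV. \<Sum>g\<in>?G. \<Sum>j\<in>UNIV.
         (edge_coupling E J $ i $ j * (cnj (f i g) * h j g)) *\<^sub>C (star a * b))"
    by (intro sum.cong refl) (simp add: fin)
  also have "\<dots> = (\<Sum>i\<in>UNIV. \<Sum>j\<in>UNIV. \<Sum>g\<in>?G.
         (edge_coupling E J $ i $ j * (cnj (f i g) * h j g)) *\<^sub>C (star a * b))"
    by (intro sum.cong[OF refl] sum.swap)
  also have "\<dots> = potts_form q E J f h *\<^sub>C (star a * b)"
    using fin by (simp add: potts_form_eq scaleC_sum_left)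
  finally show ?thesis .
qed

lemma alpha_prime_elementary:
  "alpha_prime Q (\<lambda>k. if k = i then x else (\<lambda>_. 0)) = (\<lambda>j g. x g *\<^sub>C (Q $ j $ i))"
proof (intro ext)
  fix j g
  have "alpha_prime Q (\<lambda>k. if k = i then x else (\<lambda>_. 0)) j g
      = (\<Sum>k\<in>UNIV. if k = i then x g *\<^sub>C (Q $ j $ i) else 0)"
    unfolding alpha_prime_def by (intro sum.cong refl) auto
  thus "alpha_prime Q (\<lambda>k. if k = i then x else (\<lambda>_. 0)) j g = x g *\<^sub>C (Q $ j $ i)" by simp
qed

end

theory Submission
  imports Defs
begin

text \<open>
  Read entrywise, the co-action properties say that \<open>Q\<close> consists of projections, that each row is
  orthogonal with sum \<open>1\<close>, and that \<open>\<Delta>(q\<^sub>j\<^sub>i) = \<Sum>\<^sub>k q\<^sub>j\<^sub>k \<otimes> q\<^sub>k\<^sub>i\<close>. The density of \<open>\<alpha>(A)(1 \<otimes> S)\<close> provides approximate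
  right inverses of \<open>Q\<close>. The proof has two parts: the columns of \<open>Q\<close> are orthogonal with sum \<open>1\<close> too, so \<open>Q\<close>
  is a magic unitary, and a magic unitary that preserves the hamiltonian commutes with \<open>J'\<close>.

  For the second part, two-valued configurations evaluate \<open>Q\<^sup>T J' Q - J'\<close> on the cuts of the vertex set,
  and this makes its symmetrization vanish off the diagonal
  (\<open>cut_sums_determine_symmetrization\<close>, \<open>preserves_potts_symmetrized\<close>). If the entries of \<open>Q\<close>
  commuted, \<open>Q\<^sup>T J' Q\<close> would be symmetric and hence equal to \<open>J'\<close>; in general the symmetrization loses
  information. It still determines the diagonal blocks of each entry of \<open>J' Q\<close> with respect to the
  partition of unity given by a row of \<open>Q\<close>, and a count of squares shows that there is no room for
  other blocks (\<open>magic_unitary_commutes\<close>).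

  For the first part, a vector \<open>f > 0\<close> of scalar weights with \<open>f Q = f\<close> suffices: comparing sizes of the weights
  shows that they are constant along nonzero entries, and cancelling them gives the column sums
  (\<open>column_sums_one\<close>). Such weights come from a state \<open>h\<close> that plays the role of the Haar state.
  It is a limit of averages of convolution powers of a state \<open>\<omega>\<close>, and its invariance on the entries of \<open>Q\<close>
  follows from Van Daele's argument, with the approximate right inverses of \<open>Q\<close> in place of the
  cancellation law, once \<open>\<omega>\<close> is faithful on a suitable finite-dimensional space
  (\<open>stationary_vector_null\<close>, \<open>invariant_weights\<close>).

  Both parts use that a vanishing sum of squares has vanishing terms, and the first uses products of
  states on \<open>S \<otimes> S\<close>. Both are extracted from the formula for the minimal tensor norm:
  a supremum over states sees every nonzero element (\<open>states_detect_nonzero\<close>), and product functionals are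
  dominated by it because they are positive, which is Schur's product theorem for Gram matrices
  (\<open>Schur_product\<close>, \<open>product_state\<close>).
\<close>

section \<open>Positive functionals and states\<close>

lemma scaleC_zero_right [simp]: "c *\<^sub>C (0 :: 'a::unital_cstar_algebra) = 0"
  using scaleC_add_right[of c 0 "0::'a"] by simp

lemma scaleC_minus_one: "(- 1) *\<^sub>C (x :: 'a::unital_cstar_algebra) = - x"
  using scaleC_of_real[of "-1" x] by simp

lemma scaleC_diff_right: "c *\<^sub>C (x - y) = c *\<^sub>C x - c *\<^sub>C (y :: 's::unital_cstar_algebra)"
  using scaleC_add_right[of c "x - y" y] by (simp add: eq_diff_eq)

lemma scaleC_sum_right:
  "c *\<^sub>C (\<Sum>i\<in>A. f i :: 'a::unital_cstar_algebra) = (\<Sum>i\<in>A. c *\<^sub>C f i)"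
  by (induction A rule: infinite_finite_induct) (auto simp: scaleC_add_right)

lemma star_zero [simp]: "star (0 :: 'a::unital_cstar_algebra) = 0"
  using star_add[of 0 "0::'a"] by simp

lemma star_one [simp]: "star (1 :: 'a::unital_cstar_algebra) = 1"
  by (metis mult.right_neutral star_mult star_star)

lemma star_minus: "star (- x :: 'a::unital_cstar_algebra) = - star x"
  using star_scaleC[of "-1" x] by (simp add: scaleC_minus_one)

lemma star_diff: "star (x - y :: 'a::unital_cstar_algebra) = star x - star y"
  using star_add[of x "-y"] by (simp add: star_minus)

lemma star_sum: "star (\<Sum>i\<in>A. f i :: 'a::unital_cstar_algebra) = (\<Sum>i\<in>A. star (f i))"
  by (induction A rule: infinite_finite_induct) (auto simp: star_add)

lemma star_scaleR: "star (r *\<^sub>R x :: 'a::unital_cstar_algebra) = r *\<^sub>R star x"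
  using star_scaleC[of "complex_of_real r" x] by (simp add: scaleC_of_real)

lemma norm_star [simp]: "norm (star x :: 'a::unital_cstar_algebra) = norm x"
proof -
  have "norm y \<le> norm (star y)" for y :: 'a
  proof (cases "y = 0")
    case False
    have "norm y * norm y \<le> norm (star y) * norm y"
      using norm_mult_ineq[of "star y" y] cstar_identity[of y] by (simp add: power2_eq_square)
    with False show ?thesis by simp
  qed simp
  from this[of x] this[of "star x"] show ?thesis by (simp add: star_star)
qed

lemma bounded_linear_star: "bounded_linear (star :: 'a::unital_cstar_algebra \<Rightarrow> 'a)"
  by (rule bounded_linear_intro[of _ 1]) (simp_all add: star_add star_scaleR)

lemmas tendsto_star = bounded_linear.tendsto[OF bounded_linear_star]

lemma nonneg_Reals_sum:
  "(\<And>i. i \<in> A \<Longrightarrow> f i \<in> \<real>\<^sub>\<ge>\<^sub>0) \<Longrightarrow> (\<Sum>i\<in>A. f i) \<in> (\<real>\<^sub>\<ge>\<^sub>0 :: complex set)"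
  by (induction A rule: infinite_finite_induct) auto

text \<open>A form that is nonnegative on all vectors \<open>x + z y\<close> is hermitian and satisfies the
  Cauchy-Schwarz inequality; \<open>a\<close>, \<open>b\<close>, \<open>c\<close>, \<open>d\<close> are its entries on the pair \<open>x\<close>, \<open>y\<close>. Stated for numbers, it
  serves functionals, kernels and forms on lists alike.\<close>

lemma hermitian_form_Cauchy_Schwarz:
  fixes a b c d :: complex
  assumes a: "a \<in> \<real>\<^sub>\<ge>\<^sub>0" and d: "d \<in> \<real>\<^sub>\<ge>\<^sub>0"
    and form: "\<And>z. a + z * b + cnj z * c + of_real ((cmod z)\<^sup>2) * d \<in> \<real>\<^sub>\<ge>\<^sub>0"
  shows "c = cnj b" and "(cmod b)\<^sup>2 \<le> Re a * Re d"
proof -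
  have im: "Im a = 0" "Im d = 0" and re: "Re a \<ge> 0" "Re d \<ge> 0"
    using a d by (auto simp: complex_nonneg_Reals_iff)
  show c: "c = cnj b"
    using form[of 1] form[of \<i>] im by (auto simp: complex_nonneg_Reals_iff complex_eq_iff)
  have quad: "Re a - 2 * s * (cmod b)\<^sup>2 + s\<^sup>2 * (cmod b)\<^sup>2 * Re d \<ge> 0" for s :: real
  proof -
    have "0 \<le> Re (a + of_real (-s) * cnj b * b + cnj (of_real (-s) * cnj b) * c
        + of_real ((cmod (of_real (-s) * cnj b))\<^sup>2) * d)"
      using form[of "of_real (-s) * cnj b"] by (simp only: complex_nonneg_Reals_iff)
    moreover have "Re (cnj b * b) = (cmod b)\<^sup>2" "Re (b * cnj b) = (cmod b)\<^sup>2"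
      by (simp_all add: cmod_power2) (simp_all add: power2_eq_square)
    moreover have "Re (a + of_real (-s) * cnj b * b + cnj (of_real (-s) * cnj b) * c
        + of_real ((cmod (of_real (-s) * cnj b))\<^sup>2) * d) = Re a - s * Re (cnj b * b)
        - s * Re (b * cnj b) + (s\<^sup>2 * (cmod b)\<^sup>2) * Re d"
      by (simp add: c norm_mult power_mult_distrib algebra_simps)
    ultimately show ?thesis by (simp only:)
  qed
  show "(cmod b)\<^sup>2 \<le> Re a * Re d"
  proof (cases "Re d = 0")
    case True
    have "b = 0"
    proof (rule ccontr)
      assume "b \<noteq> 0"
      then have "(cmod b)\<^sup>2 > 0" by simp
      with quad[of "(Re a + 1) / (2 * (cmod b)\<^sup>2)"] True show False by (simp add: field_simps)
    qed
    with re show ?thesis by simp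
  next
    case False
    with re have "Re d > 0" by simp
    with quad[of "1 / Re d"] show ?thesis by (simp add: field_simps power2_eq_square)
  qed
qed

text \<open>States without the normalization and the norm bound; the bound turns out to be automatic.\<close>

definition positive_functional :: "('a::unital_cstar_algebra \<Rightarrow> complex) \<Rightarrow> bool" where
  "positive_functional \<phi> \<longleftrightarrow>
     (\<forall>x y. \<phi> (x + y) = \<phi> x + \<phi> y) \<and> (\<forall>c x. \<phi> (c *\<^sub>C x) = c * \<phi> x) \<and>
     (\<forall>x. \<phi> (star x * x) \<in> \<real>\<^sub>\<ge>\<^sub>0)"

lemma state_positive: "state \<phi> \<Longrightarrow> positive_functional \<phi>"
  by (simp add: state_def positive_functional_def)

context
  fixes \<phi> :: "'a::unital_cstar_algebra \<Rightarrow> complex"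
  assumes pos: "positive_functional \<phi>"
begin

lemma positive_functional_add: "\<phi> (x + y) = \<phi> x + \<phi> y"
  using pos by (simp add: positive_functional_def)

lemma positive_functional_scaleC: "\<phi> (c *\<^sub>C x) = c * \<phi> x"
  using pos by (simp add: positive_functional_def)

lemma positive_functional_nonneg: "\<phi> (star x * x) \<in> \<real>\<^sub>\<ge>\<^sub>0"
  using pos by (simp add: positive_functional_def)

lemma positive_functional_zero: "\<phi> 0 = 0"
  using positive_functional_scaleC[of 0 0] by simp

lemma positive_functional_minus: "\<phi> (- x) = - \<phi> x"
  using positive_functional_scaleC[of "-1" x] by (simp add: scaleC_minus_one)

lemma positive_functional_diff: "\<phi> (x - y) = \<phi> x - \<phi> y"
  using positive_functional_add[of x "-y"] by (simp add: positive_functional_minus)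

lemma positive_functional_scaleR: "\<phi> (r *\<^sub>R x) = of_real r * \<phi> x"
  using positive_functional_scaleC[of "of_real r" x] by (simp add: scaleC_of_real)

lemma positive_functional_sum: "\<phi> (\<Sum>i\<in>A. f i) = (\<Sum>i\<in>A. \<phi> (f i))"
  by (induction A rule: infinite_finite_induct)
    (auto simp: positive_functional_add positive_functional_zero)

lemma
  shows positive_functional_hermitian: "\<phi> (star y * x) = cnj (\<phi> (star x * y))"
    and positive_functional_Cauchy_Schwarz:
      "(cmod (\<phi> (star x * y)))\<^sup>2 \<le> Re (\<phi> (star x * x)) * Re (\<phi> (star y * y))"
proof -
  have "\<phi> (star x * x) + z * \<phi> (star x * y) + cnj z * \<phi> (star y * x)
        + of_real ((cmod z)\<^sup>2) * \<phi> (star y * y) = \<phi> (star (x + z *\<^sub>C y) * (x + z *\<^sub>C y))" for z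
    unfolding complex_norm_square
    by (simp add: star_add star_scaleC distrib_left distrib_right mult_scaleC_left mult_scaleC_right
        positive_functional_add positive_functional_scaleC scaleC_scaleC mult_ac)
  then have form: "\<phi> (star x * x) + z * \<phi> (star x * y) + cnj z * \<phi> (star y * x)
        + of_real ((cmod z)\<^sup>2) * \<phi> (star y * y) \<in> \<real>\<^sub>\<ge>\<^sub>0" for z
    using positive_functional_nonneg by presburger
  note cs = hermitian_form_Cauchy_Schwarz[OF positive_functional_nonneg positive_functional_nonneg form]
  show "\<phi> (star y * x) = cnj (\<phi> (star x * y))" by (rule cs(1))
  show "(cmod (\<phi> (star x * y)))\<^sup>2 \<le> Re (\<phi> (star x * x)) * Re (\<phi> (star y * y))" by (rule cs(2))
qed

text \<open>The left kernel of a positive functional is a left ideal. Evaluating a functional on a product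
  whose right factor is null is the way in which all vanishing statements below are exploited.\<close>

lemma positive_functional_null_left_ideal:
  assumes "\<phi> (star x * x) = 0"
  shows "\<phi> (y * x) = 0"
  using positive_functional_Cauchy_Schwarz[of "star y" x] assms by (simp add: star_star)

end

text \<open>The binomial series of \<open>sqrt (1 - a)\<close> converges absolutely in norm. Its square is computed by the
  Cauchy product and Vandermonde's identity, and its partial sums are selfadjoint.\<close>

lemma one_minus_selfadjoint_eq_square:
  fixes a :: "'a::unital_cstar_algebra"
  assumes sa: "star a = a" and less: "norm a < 1"
  shows "\<exists>c. star c * c = 1 - a"
proof -
  define g where "g n = ((1 / 2 :: real) gchoose n)" for n
  define f where "f n = g n *\<^sub>R (- a) ^ n" for n
  have half: "(1 / 2 :: real) \<notin> \<nat>"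
  proof
    assume "(1 / 2 :: real) \<in> \<nat>"
    then obtain n where "(1 / 2 :: real) = of_nat n" by (rule Nats_cases)
    then have "real (2 * n) = real 1" by simp
    then have "2 * n = 1" by (simp only: of_nat_eq_iff)
    then show False by presburger
  qed
  have "summable (\<lambda>n. norm (g n * norm a ^ n))"
    unfolding g_def using less half by (intro abs_summable_in_conv_radius) (simp add: conv_radius_gchoose)
  then have sum: "summable (\<lambda>n. norm (f n))"
  proof (rule summable_comparison_test[rotated], intro exI allI impI)
    fix n
    show "norm (norm (f n)) \<le> norm (g n * norm a ^ n)"
      using norm_power_ineq[of "- a" n] by (simp add: f_def abs_mult mult_left_mono)
  qed
  define c where "c = suminf f"
  have f: "f sums c" unfolding c_def by (rule summable_sums[OF summable_norm_cancel[OF sum]])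
  have "(\<lambda>n. \<Sum>i\<le>n. f i * f (n - i)) sums (c * c)"
    unfolding c_def by (rule Cauchy_product_sums[OF sum sum])
  moreover have "(\<Sum>i\<le>n. f i * f (n - i)) = (if n = 0 then 1 else if n = 1 then - a else 0)" for n
  proof -
    have "(\<Sum>i\<le>n. f i * f (n - i)) = (\<Sum>i\<le>n. (g i * g (n - i)) *\<^sub>R (- a) ^ n)"
      by (intro sum.cong refl) (simp add: f_def power_add[symmetric])
    also have "\<dots> = (\<Sum>i\<in>{0..n}. g i * g (n - i)) *\<^sub>R (- a) ^ n"
      by (simp add: scaleR_sum_left atMost_atLeast0)
    also have "(\<Sum>i\<in>{0..n}. g i * g (n - i)) = (1 :: real) gchoose n"
      unfolding g_def by (subst gbinomial_Vandermonde) simp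
    also have "(1 :: real) gchoose n = real (1 choose n)"
      using binomial_gbinomial[of 1 n, where 'a = real] by simp
    finally show ?thesis by (cases n rule: nat.exhaust) auto
  qed
  ultimately have "(\<lambda>n. if n = 0 then 1 else if n = 1 then - a else 0) sums (c * c)" by simp
  moreover have "(\<lambda>n. if n = 0 then 1 else if n = 1 then - a else 0) sums (1 - a)"
    using sums_finite[of "{0, 1 :: nat}" "\<lambda>n. if n = 0 then 1 else if n = 1 then - a else 0"] by simp
  ultimately have "c * c = 1 - a" by (rule sums_unique2)
  moreover have "star c = c"
  proof -
    have sf: "star (f n) = f n" for n
    proof -
      have "star ((- a) ^ n) = (- a) ^ n"
        by (induction n) (simp_all only: power_0 star_one power_Suc star_mult star_minus sa power_commutes)
      then show ?thesis by (simp add: f_def star_scaleR)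
    qed
    have "(\<lambda>n. star (\<Sum>i<n. f i)) \<longlonglongrightarrow> star c"
      using f unfolding sums_def by (rule tendsto_star)
    then have "f sums star c" by (simp add: sums_def star_sum sf)
    with f show ?thesis by (rule sums_unique2[symmetric])
  qed
  ultimately show ?thesis by metis
qed

lemma positive_functional_compress:
  assumes "positive_functional \<phi>"
  shows "positive_functional (\<lambda>x. \<phi> (star y * x * y))"
  unfolding positive_functional_def
proof (intro conjI allI)
  show "\<phi> (star y * (a + b) * y) = \<phi> (star y * a * y) + \<phi> (star y * b * y)" for a b
    by (simp add: algebra_simps positive_functional_add[OF assms])
  show "\<phi> (star y * (c *\<^sub>C a) * y) = c * \<phi> (star y * a * y)" for c a
    by (simp add: mult_scaleC_left mult_scaleC_right positive_functional_scaleC[OF assms])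
  show "\<phi> (star y * (star a * a) * y) \<in> \<real>\<^sub>\<ge>\<^sub>0" for a
    using positive_functional_nonneg[OF assms, of "a * y"] by (simp add: star_mult mult.assoc)
qed

text \<open>\<open>r\<^sup>2 - x\<^sup>* x\<close> is a square for every \<open>r > norm x\<close>, so a positive functional is nonnegative on it.
  The boundary case \<open>r = norm x\<close> is at the edge of the disc of convergence and is reached as a limit.\<close>

lemma positive_functional_bounded_by_one:
  assumes pos: "positive_functional \<phi>"
  shows "Re (\<phi> (star x * x)) \<le> (norm x)\<^sup>2 * Re (\<phi> 1)"
proof -
  have le: "Re (\<phi> (star x * x)) \<le> r\<^sup>2 * Re (\<phi> 1)" if r: "r > norm x" for r
  proof -
    have r0: "r > 0" using r by (meson norm_ge_zero order_le_less_trans)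
    have "star ((1 / r\<^sup>2) *\<^sub>R (star x * x)) = (1 / r\<^sup>2) *\<^sub>R (star x * x)"
      by (simp add: star_scaleR star_mult star_star)
    moreover have "norm ((1 / r\<^sup>2) *\<^sub>R (star x * x)) < 1"
      using r r0 by (simp add: cstar_identity field_simps power_strict_mono)
    ultimately obtain c where c: "star c * c = 1 - (1 / r\<^sup>2) *\<^sub>R (star x * x)"
      using one_minus_selfadjoint_eq_square by blast
    have "0 \<le> Re (\<phi> (star c * c))"
      using positive_functional_nonneg[OF pos, of c] by (simp add: complex_nonneg_Reals_iff)
    then show ?thesis
      using r0 by (simp add: c positive_functional_diff[OF pos] positive_functional_scaleR[OF pos] field_simps)
  qed
  have "(\<lambda>n. (norm x + inverse (real (Suc n)))\<^sup>2 * Re (\<phi> 1)) \<longlonglongrightarrow> (norm x + 0)\<^sup>2 * Re (\<phi> 1)"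
    by (intro tendsto_intros LIMSEQ_inverse_real_of_nat)
  then have "Re (\<phi> (star x * x)) \<le> (norm x + 0)\<^sup>2 * Re (\<phi> 1)"
    by (rule LIMSEQ_le_const) (intro exI allI impI le, simp)
  then show ?thesis by simp
qed

text \<open>Contractivity of normalized positive functionals need not be checked separately; this makes
  composites, averages and limits of states easy to recognize as states.\<close>

lemma stateI:
  assumes pos: "positive_functional \<phi>" and one: "\<phi> 1 = 1"
  shows "state \<phi>"
proof -
  have "cmod (\<phi> x) \<le> norm x" for x
  proof (rule power2_le_imp_le)
    have "(cmod (\<phi> x))\<^sup>2 \<le> Re (\<phi> (star x * x))"
      using positive_functional_Cauchy_Schwarz[OF pos, of 1 x] one by simp
    also have "\<dots> \<le> (norm x)\<^sup>2"
      using positive_functional_bounded_by_one[OF pos, of x] one by simp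
    finally show "(cmod (\<phi> x))\<^sup>2 \<le> (norm x)\<^sup>2" .
  qed simp
  with assms show ?thesis by (simp add: state_def positive_functional_def)
qed

context
  fixes \<phi> :: "'a::unital_cstar_algebra \<Rightarrow> complex"
  assumes st: "state \<phi>"
begin

lemma state_norm_le: "cmod (\<phi> x) \<le> norm x"
  and state_one: "\<phi> 1 = 1"
  using st by (auto simp: state_def)

lemma state_compress_le: "Re (\<phi> (star (x * y) * (x * y))) \<le> (norm x)\<^sup>2 * Re (\<phi> (star y * y))"
  using positive_functional_bounded_by_one[OF positive_functional_compress[OF state_positive[OF st]], of y x]
  by (simp add: star_mult mult.assoc)

text \<open>The vector states of the GNS representation of \<open>\<phi>\<close>.\<close>

lemma state_vector_state:
  assumes "\<phi> (star y * y) \<noteq> 0"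
  shows "state (\<lambda>x. \<phi> (star y * x * y) / \<phi> (star y * y))"
proof (rule stateI)
  note pos = positive_functional_compress[OF state_positive[OF st], of y]
  have "\<phi> (star y * (star x * x) * y) / \<phi> (star y * y) \<in> \<real>\<^sub>\<ge>\<^sub>0" for x
    using positive_functional_nonneg[OF pos, of x] positive_functional_nonneg[OF state_positive[OF st], of y]
    by (rule nonneg_Reals_divide_I)
  then show "positive_functional (\<lambda>x. \<phi> (star y * x * y) / \<phi> (star y * y))"
    by (simp add: positive_functional_def positive_functional_add[OF pos]
        positive_functional_scaleC[OF pos] add_divide_distrib)
qed (use assms in simp)

end

section \<open>Product states on the minimal tensor product\<close>

text \<open>Positive semidefinite matrices indexed by a set.\<close>

definition positive_kernel :: "'i set \<Rightarrow> ('i \<Rightarrow> 'i \<Rightarrow> complex) \<Rightarrow> bool" where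
  "positive_kernel I A \<longleftrightarrow> (\<forall>c. (\<Sum>m\<in>I. \<Sum>n\<in>I. cnj (c m) * c n * A m n) \<in> \<real>\<^sub>\<ge>\<^sub>0)"

lemma positive_kernelD:
  "positive_kernel I A \<Longrightarrow> (\<Sum>m\<in>I. \<Sum>n\<in>I. cnj (c m) * c n * A m n) \<in> \<real>\<^sub>\<ge>\<^sub>0"
  by (simp add: positive_kernel_def)

lemma positive_kernel_subset:
  assumes "positive_kernel I A" "J \<subseteq> I" "finite I"
  shows "positive_kernel J A"
  unfolding positive_kernel_def
proof
  fix c :: "'a \<Rightarrow> complex"
  define c' where "c' m = (if m \<in> J then c m else 0)" for m
  have "(\<Sum>m\<in>J. \<Sum>n\<in>J. cnj (c m) * c n * A m n) = (\<Sum>m\<in>J. \<Sum>n\<in>J. cnj (c' m) * c' n * A m n)"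
    by (simp add: c'_def)
  also have "\<dots> = (\<Sum>m\<in>J. \<Sum>n\<in>I. cnj (c' m) * c' n * A m n)"
    using assms by (intro sum.cong refl sum.mono_neutral_left) (auto simp: c'_def)
  also have "\<dots> = (\<Sum>m\<in>I. \<Sum>n\<in>I. cnj (c' m) * c' n * A m n)"
    using assms by (intro sum.mono_neutral_left) (auto simp: c'_def)
  finally show "(\<Sum>m\<in>J. \<Sum>n\<in>J. cnj (c m) * c n * A m n) \<in> \<real>\<^sub>\<ge>\<^sub>0"
    using positive_kernelD[OF assms(1), of c'] by simp
qed

lemma positive_kernel_diag:
  assumes "positive_kernel I A" "finite I" "k \<in> I"
  shows "A k k \<in> \<real>\<^sub>\<ge>\<^sub>0"
  using positive_kernelD[OF positive_kernel_subset[OF assms(1) _ assms(2), of "{k}"], of "\<lambda>_. 1"] assms(3)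
  by simp

lemma
  assumes A: "positive_kernel I A" and fin: "finite I" and k: "k \<in> I" and l: "l \<in> I"
  shows positive_kernel_hermitian: "A l k = cnj (A k l)"
    and positive_kernel_Cauchy_Schwarz: "(cmod (A k l))\<^sup>2 \<le> Re (A k k) * Re (A l l)"
proof -
  have "A l k = cnj (A k l) \<and> (cmod (A k l))\<^sup>2 \<le> Re (A k k) * Re (A l l)"
  proof (cases "k = l")
    case True
    then show ?thesis
      using positive_kernel_diag[OF A fin k]
      unfolding cmod_power2
      by (auto simp: complex_nonneg_Reals_iff complex_eq_iff power2_eq_square)
  next
    case False
    have "A k k + z * A k l + cnj z * A l k + of_real ((cmod z)\<^sup>2) * A l l \<in> \<real>\<^sub>\<ge>\<^sub>0" for z
      using positive_kernelD[OF positive_kernel_subset[OF A _ fin, of "{k, l}"], of "\<lambda>n. if n = k then 1 else z"]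
        False k l unfolding complex_norm_square by (simp add: mult_ac add_ac)
    from hermitian_form_Cauchy_Schwarz[OF positive_kernel_diag[OF A fin k] positive_kernel_diag[OF A fin l] this]
    show ?thesis by simp
  qed
  then show "A l k = cnj (A k l)" "(cmod (A k l))\<^sup>2 \<le> Re (A k k) * Re (A l l)" by auto
qed

lemma sum_insert_square:
  assumes "finite J" "o' \<notin> J"
  shows "(\<Sum>m\<in>insert o' J. \<Sum>n\<in>insert o' J. f m n :: complex)
    = f o' o' + (\<Sum>n\<in>J. f o' n) + (\<Sum>m\<in>J. f m o') + (\<Sum>m\<in>J. \<Sum>n\<in>J. f m n)"
  using assms by (simp add: sum.distrib)

text \<open>Induction on the index set: subtracting from \<open>B\<close> the rank one matrix through its \<open>k\<close>-th row leaves
  a positive matrix \<open>B'\<close> whose \<open>k\<close>-th row and column vanish (the Schur complement). The rank one part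
  contributes a value of the quadratic form of \<open>A\<close>, and \<open>B'\<close> is covered by the induction
  hypothesis.\<close>

lemma Schur_product:
  assumes "finite I" "positive_kernel I A" "positive_kernel I B"
  shows "(\<Sum>m\<in>I. \<Sum>n\<in>I. A m n * B m n) \<in> \<real>\<^sub>\<ge>\<^sub>0"
  using assms
proof (induction I arbitrary: B rule: finite_induct)
  case empty
  then show ?case by simp
next
  case (insert k J)
  note fin = finite.insertI[OF insert.hyps(1), of k]
  define \<beta> where "\<beta> = Re (B k k)"
  have \<beta>: "B k k = of_real \<beta>" "\<beta> \<ge> 0"
    using positive_kernel_diag[OF insert.prems(2) fin, of k]
    by (auto simp: \<beta>_def complex_nonneg_Reals_iff complex_eq_iff)
  have herm: "B m k = cnj (B k m)" if "m \<in> insert k J" for m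
    using positive_kernel_hermitian[OF insert.prems(2) fin insertI1 that] .
  have null: "B k m = 0" if "m \<in> insert k J" "\<beta> = 0" for m
    using positive_kernel_Cauchy_Schwarz[OF insert.prems(2) fin insertI1 that(1)] that(2) by (simp add: \<beta>)
  \<comment> \<open>For \<open>\<beta> = 0\<close> the quotient is \<open>0\<close> by convention; then the \<open>k\<close>-th row is zero and \<open>B'\<close> is \<open>B\<close>.\<close>
  define B' where "B' m n = B m n - cnj (B k m) * B k n / of_real \<beta>" for m n
  have B'0: "B' m k = 0" "B' k m = 0" if "m \<in> insert k J" for m
    using that null[OF that] herm[OF that] by (cases "\<beta> = 0"; simp add: B'_def \<beta>)+
  have "positive_kernel J B'"
    unfolding positive_kernel_def
  proof
    fix c :: "'a \<Rightarrow> complex"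
    define s where "s = (\<Sum>n\<in>J. c n * B k n)"
    \<comment> \<open>The \<open>k\<close>-th coefficient that minimizes the quadratic form of \<open>B\<close>.\<close>
    define c' where "c' n = (if n = k then - s / of_real \<beta> else c n)" for n
    have c'J: "c' n = c n" if "n \<in> J" for n using that insert.hyps by (auto simp: c'_def)
    have s': "cnj s = (\<Sum>m\<in>J. cnj (c m) * cnj (B k m))" by (simp add: s_def)
    have s0: "s = 0" if "\<beta> = 0" using null that by (simp add: s_def)
    have "(\<Sum>m\<in>insert k J. \<Sum>n\<in>insert k J. cnj (c' m) * c' n * B m n)
        = cnj (c' k) * c' k * of_real \<beta> + cnj (c' k) * s + c' k * cnj s
          + (\<Sum>m\<in>J. \<Sum>n\<in>J. cnj (c m) * c n * B m n)"
      unfolding sum_insert_square[OF insert.hyps(1,2)] s'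
      by (simp add: s_def sum_distrib_left herm c'J \<beta> mult_ac)
    also have "cnj (c' k) * c' k * of_real \<beta> + cnj (c' k) * s + c' k * cnj s = - (cnj s * s / of_real \<beta>)"
      using s0 by (cases "\<beta> = 0") (simp_all add: c'_def field_simps)
    also have "cnj s * s / of_real \<beta> = (\<Sum>m\<in>J. \<Sum>n\<in>J. cnj (c m) * c n * (cnj (B k m) * B k n / of_real \<beta>))"
      unfolding s' unfolding s_def sum_product sum_divide_distrib by (simp add: mult_ac)
    also have "- \<dots> + (\<Sum>m\<in>J. \<Sum>n\<in>J. cnj (c m) * c n * B m n)
        = (\<Sum>m\<in>J. \<Sum>n\<in>J. cnj (c m) * c n * B' m n)"
      by (simp add: B'_def algebra_simps sum_subtractf)
    finally show "(\<Sum>m\<in>J. \<Sum>n\<in>J. cnj (c m) * c n * B' m n) \<in> \<real>\<^sub>\<ge>\<^sub>0"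
      using positive_kernelD[OF insert.prems(2), of c'] by simp
  qed
  with insert.IH insert.prems(1)
  have "(\<Sum>m\<in>J. \<Sum>n\<in>J. A m n * B' m n) \<in> \<real>\<^sub>\<ge>\<^sub>0"
    using positive_kernel_subset[OF _ _ fin] by blast
  also have "(\<Sum>m\<in>J. \<Sum>n\<in>J. A m n * B' m n) = (\<Sum>m\<in>insert k J. \<Sum>n\<in>insert k J. A m n * B' m n)"
    unfolding sum_insert_square[OF insert.hyps(1,2)] by (simp add: B'0)
  finally have 1: "(\<Sum>m\<in>insert k J. \<Sum>n\<in>insert k J. A m n * B' m n) \<in> \<real>\<^sub>\<ge>\<^sub>0" .
  have 2: "(\<Sum>m\<in>insert k J. \<Sum>n\<in>insert k J. cnj (B k m) * B k n * A m n) / of_real \<beta> \<in> \<real>\<^sub>\<ge>\<^sub>0"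
    using positive_kernelD[OF insert.prems(1), of "B k"] \<beta>(2) by (intro nonneg_Reals_divide_I) auto
  have split: "A m n * B m n = A m n * B' m n + cnj (B k m) * B k n * A m n / of_real \<beta>" for m n
    by (simp add: B'_def right_diff_distrib mult_ac)
  have "(\<Sum>m\<in>insert k J. \<Sum>n\<in>insert k J. A m n * B m n)
      = (\<Sum>m\<in>insert k J. \<Sum>n\<in>insert k J. A m n * B' m n)
        + (\<Sum>m\<in>insert k J. \<Sum>n\<in>insert k J. cnj (B k m) * B k n * A m n) / of_real \<beta>"
    by (simp only: split sum.distrib sum_divide_distrib)
  then show ?case using nonneg_Reals_add_I[OF 1 2] by (simp only:)
qed

lemma positive_functional_combination:
  assumes "positive_functional \<phi>"
  shows "\<phi> (star (\<Sum>m\<in>I. c m *\<^sub>C x m) * (\<Sum>n\<in>I. d n *\<^sub>C y n))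
    = (\<Sum>m\<in>I. \<Sum>n\<in>I. cnj (c m) * d n * \<phi> (star (x m) * y n))"
  by (simp add: star_sum star_scaleC sum_product positive_functional_sum[OF assms] mult.commute[of "cnj _"]
      mult_scaleC_left mult_scaleC_right scaleC_scaleC positive_functional_scaleC[OF assms])

lemma positive_kernel_Gram:
  assumes "positive_functional \<phi>"
  shows "positive_kernel I (\<lambda>m n. \<phi> (star (x m) * x n))"
  using positive_functional_nonneg[OF assms]
  by (simp add: positive_kernel_def positive_functional_combination[OF assms, symmetric])

text \<open>Left multiplication by \<open>a\<close> is bounded by \<open>norm a\<close> on the GNS space, in terms of Gram matrices.\<close>

lemma positive_kernel_Gram_compress:
  assumes st: "state \<phi>"
  shows "positive_kernel I (\<lambda>m n. of_real ((norm a)\<^sup>2) * \<phi> (star (x m) * x n)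
           - \<phi> (star (a * x m) * (a * x n)))"
  unfolding positive_kernel_def
proof
  fix c
  note pos = state_positive[OF st]
  define y where "y = (\<Sum>m\<in>I. c m *\<^sub>C x m)"
  have ay: "a * y = (\<Sum>m\<in>I. c m *\<^sub>C (a * x m))"
    by (simp add: y_def sum_distrib_left mult_scaleC_right)
  have "(\<Sum>m\<in>I. \<Sum>n\<in>I. cnj (c m) * c n * (of_real ((norm a)\<^sup>2) * \<phi> (star (x m) * x n)
           - \<phi> (star (a * x m) * (a * x n))))
      = of_real ((norm a)\<^sup>2) * \<phi> (star y * y) - \<phi> (star (a * y) * (a * y))"
    unfolding ay unfolding y_def positive_functional_combination[OF pos]
    by (simp only: sum_distrib_left right_diff_distrib sum_subtractf mult.left_commute[of _ "of_real _"])
  also have "\<dots> \<in> \<real>\<^sub>\<ge>\<^sub>0"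
    using state_compress_le[OF st, of a y] positive_functional_nonneg[OF pos, of y]
      positive_functional_nonneg[OF pos, of "a * y"]
    by (auto simp: complex_nonneg_Reals_iff)
  finally show "(\<Sum>m\<in>I. \<Sum>n\<in>I. cnj (c m) * c n * (of_real ((norm a)\<^sup>2) * \<phi> (star (x m) * x n)
           - \<phi> (star (a * x m) * (a * x n)))) \<in> \<real>\<^sub>\<ge>\<^sub>0" .
qed

text \<open>The inner product \<open>(\<phi> \<otimes> \<psi>)(u\<^sup>* w)\<close> of the GNS representation of \<open>\<phi> \<otimes> \<psi>\<close>, on the algebraic tensor
  product.\<close>

definition tens_inner ::
  "('a::unital_cstar_algebra \<Rightarrow> complex) \<Rightarrow> ('b::unital_cstar_algebra \<Rightarrow> complex)
     \<Rightarrow> ('a \<times> 'b) list \<Rightarrow> ('a \<times> 'b) list \<Rightarrow> complex" where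
  "tens_inner \<phi> \<psi> u w = (\<Sum>(a, b)\<leftarrow>u. \<Sum>(c, d)\<leftarrow>w. \<phi> (star a * c) * \<psi> (star b * d))"

lemma tens_functional_append: "tens_functional \<phi> \<psi> (u @ w) = tens_functional \<phi> \<psi> u + tens_functional \<phi> \<psi> w"
  by (simp add: tens_functional_def)

lemma tens_functional_star_mult:
  "tens_functional \<phi> \<psi> (tens_mult (tens_star u) w) = tens_inner \<phi> \<psi> u w"
proof (induction u)
  case (Cons p u)
  have "tens_mult (tens_star (p # u)) w
      = map (\<lambda>(c, d). (star (fst p) * c, star (snd p) * d)) w @ tens_mult (tens_star u) w"
    by (cases p) (simp add: tens_mult_def tens_star_def)
  then show ?case
    by (simp add: Cons tens_functional_append)
      (simp add: tens_inner_def tens_functional_def case_prod_unfold o_def)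
qed (simp add: tens_inner_def tens_functional_def tens_mult_def tens_star_def)

lemma tens_inner_append:
  "tens_inner \<phi> \<psi> (u @ u') w = tens_inner \<phi> \<psi> u w + tens_inner \<phi> \<psi> u' w"
  "tens_inner \<phi> \<psi> u (w @ w') = tens_inner \<phi> \<psi> u w + tens_inner \<phi> \<psi> u w'"
  by (simp_all add: tens_inner_def case_prod_unfold sum_list_addf)

lemma tens_inner_nth:
  "tens_inner \<phi> \<psi> u w = (\<Sum>m<length u. \<Sum>n<length w.
     \<phi> (star (fst (u ! m)) * fst (w ! n)) * \<psi> (star (snd (u ! m)) * snd (w ! n)))"
  by (simp add: tens_inner_def case_prod_unfold sum_list_sum_nth atLeast0LessThan)

definition tens_scale :: "complex \<Rightarrow> ('a::unital_cstar_algebra \<times> 'b) list \<Rightarrow> ('a \<times> 'b) list" where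
  "tens_scale c u = map (\<lambda>(a, b). (c *\<^sub>C a, b)) u"

context
  fixes \<phi> :: "'a::unital_cstar_algebra \<Rightarrow> complex" and \<psi> :: "'b::unital_cstar_algebra \<Rightarrow> complex"
  assumes pos: "positive_functional \<phi>" "positive_functional \<psi>"
begin

lemma tens_functional_scale: "tens_functional \<phi> \<psi> (tens_scale c u) = c * tens_functional \<phi> \<psi> u"
  by (simp add: tens_functional_def tens_scale_def case_prod_unfold o_def
      positive_functional_scaleC[OF pos(1)] sum_list_const_mult mult.assoc)

lemma tens_inner_scale:
  "tens_inner \<phi> \<psi> (tens_scale c u) w = cnj c * tens_inner \<phi> \<psi> u w"
  "tens_inner \<phi> \<psi> u (tens_scale c w) = c * tens_inner \<phi> \<psi> u w"
  by (simp_all add: tens_inner_def tens_scale_def case_prod_unfold o_def star_scaleC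
      mult_scaleC_left mult_scaleC_right positive_functional_scaleC[OF pos(1)]
      sum_list_const_mult mult.assoc)

lemma tens_inner_nonneg: "tens_inner \<phi> \<psi> u u \<in> \<real>\<^sub>\<ge>\<^sub>0"
  unfolding tens_inner_nth
  by (rule Schur_product[OF finite_lessThan positive_kernel_Gram[OF pos(1)] positive_kernel_Gram[OF pos(2)]])

lemma tens_inner_Cauchy_Schwarz:
  "(cmod (tens_inner \<phi> \<psi> u w))\<^sup>2 \<le> Re (tens_inner \<phi> \<psi> u u) * Re (tens_inner \<phi> \<psi> w w)"
proof -
  have "tens_inner \<phi> \<psi> u u + z * tens_inner \<phi> \<psi> u w + cnj z * tens_inner \<phi> \<psi> w u
      + of_real ((cmod z)\<^sup>2) * tens_inner \<phi> \<psi> w w \<in> \<real>\<^sub>\<ge>\<^sub>0" for z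
    using tens_inner_nonneg[of "u @ tens_scale z w"] unfolding complex_norm_square
    by (simp add: tens_inner_append tens_inner_scale mult_ac add_ac)
  from hermitian_form_Cauchy_Schwarz(2)[OF tens_inner_nonneg tens_inner_nonneg this] show ?thesis .
qed

text \<open>Appending lists adds the tensors that they represent, so this is the parallelogram inequality
  \<open>\<parallel>u + w\<parallel>\<^sup>2 \<le> 2 \<parallel>u\<parallel>\<^sup>2 + 2 \<parallel>w\<parallel>\<^sup>2\<close>.\<close>

lemma tens_inner_append_le:
  "Re (tens_inner \<phi> \<psi> (u @ w) (u @ w)) \<le> 2 * Re (tens_inner \<phi> \<psi> u u) + 2 * Re (tens_inner \<phi> \<psi> w w)"
  using tens_inner_nonneg[of "u @ tens_scale (-1) w"]
  by (simp add: tens_inner_append tens_inner_scale complex_nonneg_Reals_iff)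

end

context
  fixes \<phi> :: "'a::unital_cstar_algebra \<Rightarrow> complex" and \<psi> :: "'b::unital_cstar_algebra \<Rightarrow> complex"
  assumes st: "state \<phi>" "state \<psi>"
begin

text \<open>The Gram matrix of the vectors on the left is an entrywise product. Its factors are replaced one
  at a time by \<open>(norm a)\<^sup>2\<close> and \<open>(norm b)\<^sup>2\<close> multiples of those of \<open>v\<close>; each replacement adds a
  Schur product of positive kernels.\<close>

lemma tens_inner_elementary_le:
  fixes v :: "('a \<times> 'b) list" and a :: 'a and b :: 'b
  defines "w \<equiv> map (\<lambda>(c, d). (a * c, b * d)) v"
  shows "Re (tens_inner \<phi> \<psi> w w) \<le> (norm a)\<^sup>2 * (norm b)\<^sup>2 * Re (tens_inner \<phi> \<psi> v v)"
proof -
  define I where "I = {..<length v}"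
  define x where "x m = fst (v ! m)" for m
  define y where "y m = snd (v ! m)" for m
  define A where "A m n = \<phi> (star (x m) * x n)" for m n
  define A' where "A' m n = \<phi> (star (a * x m) * (a * x n))" for m n
  define B where "B m n = \<psi> (star (y m) * y n)" for m n
  define B' where "B' m n = \<psi> (star (b * y m) * (b * y n))" for m n
  have fin: "finite I" by (simp add: I_def)
  have ww: "tens_inner \<phi> \<psi> w w = (\<Sum>m\<in>I. \<Sum>n\<in>I. A' m n * B' m n)"
    by (simp add: tens_inner_nth w_def I_def A'_def B'_def x_def y_def case_prod_unfold)
  have vv: "tens_inner \<phi> \<psi> v v = (\<Sum>m\<in>I. \<Sum>n\<in>I. A m n * B m n)"
    by (simp add: tens_inner_nth I_def A_def B_def x_def y_def)
  have pA: "positive_kernel I A" and pB': "positive_kernel I B'"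
    unfolding A_def B'_def by (rule positive_kernel_Gram[OF state_positive] st)+
  have dA: "positive_kernel I (\<lambda>m n. of_real ((norm a)\<^sup>2) * A m n - A' m n)"
    unfolding A_def A'_def by (rule positive_kernel_Gram_compress[OF st(1)])
  have dB: "positive_kernel I (\<lambda>m n. of_real ((norm b)\<^sup>2) * B m n - B' m n)"
    unfolding B_def B'_def by (rule positive_kernel_Gram_compress[OF st(2)])
  have "(\<Sum>m\<in>I. \<Sum>n\<in>I. (of_real ((norm a)\<^sup>2) * A m n - A' m n) * B' m n)
      = of_real ((norm a)\<^sup>2) * (\<Sum>m\<in>I. \<Sum>n\<in>I. A m n * B' m n) - (\<Sum>m\<in>I. \<Sum>n\<in>I. A' m n * B' m n)"
    by (simp only: left_diff_distrib sum_subtractf sum_distrib_left mult.assoc)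
  then have "0 \<le> Re (of_real ((norm a)\<^sup>2) * (\<Sum>m\<in>I. \<Sum>n\<in>I. A m n * B' m n) - tens_inner \<phi> \<psi> w w)"
    using Schur_product[OF fin dA pB'] by (simp only: ww complex_nonneg_Reals_iff)
  then have 1: "Re (tens_inner \<phi> \<psi> w w) \<le> (norm a)\<^sup>2 * Re (\<Sum>m\<in>I. \<Sum>n\<in>I. A m n * B' m n)"
    by (simp del: of_real_power Re_sum)
  have "(\<Sum>m\<in>I. \<Sum>n\<in>I. A m n * (of_real ((norm b)\<^sup>2) * B m n - B' m n))
      = of_real ((norm b)\<^sup>2) * (\<Sum>m\<in>I. \<Sum>n\<in>I. A m n * B m n) - (\<Sum>m\<in>I. \<Sum>n\<in>I. A m n * B' m n)"
    by (simp only: right_diff_distrib sum_subtractf sum_distrib_left mult.left_commute)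
  then have "0 \<le> Re (of_real ((norm b)\<^sup>2) * tens_inner \<phi> \<psi> v v - (\<Sum>m\<in>I. \<Sum>n\<in>I. A m n * B' m n))"
    using Schur_product[OF fin pA dB] by (simp only: vv complex_nonneg_Reals_iff)
  then have 2: "Re (\<Sum>m\<in>I. \<Sum>n\<in>I. A m n * B' m n) \<le> (norm b)\<^sup>2 * Re (tens_inner \<phi> \<psi> v v)"
    by (simp del: of_real_power Re_sum)
  have "(norm a)\<^sup>2 * Re (\<Sum>m\<in>I. \<Sum>n\<in>I. A m n * B' m n)
      \<le> (norm a)\<^sup>2 * ((norm b)\<^sup>2 * Re (tens_inner \<phi> \<psi> v v))"
    using 2 by (rule mult_left_mono) simp
  with 1 show ?thesis by (simp add: mult.assoc)
qed

end

lemma tens_mult_Cons: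
  "tens_mult ((a, b) # u) v = map (\<lambda>(c, d). (a * c, b * d)) v @ tens_mult u v"
  by (simp add: tens_mult_def)

text \<open>The bound is uniform in the states. It is what makes the supremum in the definition of
  \<^const>\<open>min_tensor_norm\<close> a supremum of a bounded set, so that it dominates each of its members.\<close>

lemma tens_mult_bounded:
  fixes u :: "('a::unital_cstar_algebra \<times> 'b::unital_cstar_algebra) list"
  shows "\<exists>C. \<forall>\<phi> \<psi> v. state \<phi> \<longrightarrow> state \<psi> \<longrightarrow>
    Re (tens_inner \<phi> \<psi> (tens_mult u v) (tens_mult u v)) \<le> C * Re (tens_inner \<phi> \<psi> v v)"
proof (induction u)
  case Nil
  show ?case by (rule exI[of _ 0]) (simp add: tens_mult_def tens_inner_def)
next
  case (Cons p u)
  obtain a b where p: "p = (a, b)" by (cases p)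
  from Cons obtain C where C: "Re (tens_inner \<phi> \<psi> (tens_mult u v) (tens_mult u v))
      \<le> C * Re (tens_inner \<phi> \<psi> v v)" if "state \<phi>" "state \<psi>" for \<phi> \<psi> v by blast
  show ?case
  proof (intro exI[of _ "2 * ((norm a)\<^sup>2 * (norm b)\<^sup>2) + 2 * C"] allI impI)
    fix \<phi> :: "'a \<Rightarrow> complex" and \<psi> :: "'b \<Rightarrow> complex" and v :: "('a \<times> 'b) list"
    assume st: "state \<phi>" "state \<psi>"
    show "Re (tens_inner \<phi> \<psi> (tens_mult (p # u) v) (tens_mult (p # u) v))
        \<le> (2 * ((norm a)\<^sup>2 * (norm b)\<^sup>2) + 2 * C) * Re (tens_inner \<phi> \<psi> v v)"
      using tens_inner_append_le[OF st[THEN state_positive], of "map (\<lambda>(c, d). (a * c, b * d)) v" "tens_mult u v"]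
        tens_inner_elementary_le[OF st, of a b v] C[OF st, of v]
      by (simp add: p tens_mult_Cons distrib_right)
  qed
qed

text \<open>Cauchy-Schwarz against the cyclic vector \<open>1 \<otimes> 1\<close> bounds the functional by the norm of the GNS vector
  of \<open>u\<close>, which is one of the quotients in the definition of the minimal norm.\<close>

lemma tens_functional_le_min_tensor_norm:
  fixes u :: "('a::unital_cstar_algebra \<times> 'b::unital_cstar_algebra) list"
  assumes st: "state \<phi>" "state \<psi>"
  shows "cmod (tens_functional \<phi> \<psi> u) \<le> min_tensor_norm u"
proof -
  define X where "X = {sqrt (Re (tens_inner \<phi> \<psi> (tens_mult u v) (tens_mult u v))
              / Re (tens_inner \<phi> \<psi> v v)) | (\<phi> :: 'a \<Rightarrow> complex) (\<psi> :: 'b \<Rightarrow> complex) v.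
          state \<phi> \<and> state \<psi> \<and> tens_inner \<phi> \<psi> v v \<noteq> 0}"
  have norm_eq: "min_tensor_norm u = Sup X"
    unfolding min_tensor_norm_def tens_functional_star_mult X_def ..
  obtain C where C: "Re (tens_inner \<phi> \<psi> (tens_mult u v) (tens_mult u v))
      \<le> C * Re (tens_inner \<phi> \<psi> v v)" if "state \<phi>" "state \<psi>" for \<phi> \<psi> v
    using tens_mult_bounded[of u] by blast
  have bdd: "bdd_above X"
  proof (rule bdd_aboveI[of _ "sqrt C"])
    fix r assume "r \<in> X"
    then obtain \<phi> :: "'a \<Rightarrow> complex" and \<psi> :: "'b \<Rightarrow> complex" and v where
      r: "r = sqrt (Re (tens_inner \<phi> \<psi> (tens_mult u v) (tens_mult u v)) / Re (tens_inner \<phi> \<psi> v v))"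
      and st': "state \<phi>" "state \<psi>" and nz: "tens_inner \<phi> \<psi> v v \<noteq> 0"
      unfolding X_def by blast
    have "Re (tens_inner \<phi> \<psi> v v) > 0"
      using tens_inner_nonneg[OF st'[THEN state_positive], of v] nz
      by (auto simp: complex_nonneg_Reals_iff complex_eq_iff)
    with C[OF st', of v] show "r \<le> sqrt C" unfolding r by (simp add: field_simps)
  qed
  define e :: "('a \<times> 'b) list" where "e = [(1, 1)]"
  have ee: "tens_inner \<phi> \<psi> e e = 1" "tens_inner \<phi> \<psi> e u = tens_functional \<phi> \<psi> u"
    by (simp_all add: e_def tens_inner_def tens_functional_def state_one st)
  have ue: "tens_mult u e = u"
    by (simp add: tens_mult_def e_def case_prod_unfold)
  have "cmod (tens_functional \<phi> \<psi> u) \<le> sqrt (Re (tens_inner \<phi> \<psi> u u))"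
    using tens_inner_Cauchy_Schwarz[OF st[THEN state_positive], of e u] ee by (simp add: real_le_rsqrt)
  also have "\<dots> \<le> Sup X"
  proof (rule cSup_upper[OF _ bdd])
    show "sqrt (Re (tens_inner \<phi> \<psi> u u)) \<in> X"
      unfolding X_def using st ee ue by (intro CollectI exI[of _ \<phi>] exI[of _ \<psi>] exI[of _ e]) simp
  qed
  finally show ?thesis by (simp add: norm_eq)
qed

definition tens_eval :: "('a \<Rightarrow> 'b \<Rightarrow> 'c::unital_cstar_algebra) \<Rightarrow> ('a \<times> 'b) list \<Rightarrow> 'c" where
  "tens_eval t u = (\<Sum>(a, b)\<leftarrow>u. t a b)"

lemma tens_eval_Nil [simp]: "tens_eval t [] = 0"
  and tens_eval_Cons [simp]: "tens_eval t (p # u) = t (fst p) (snd p) + tens_eval t u"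
  and tens_eval_append: "tens_eval t (u @ w) = tens_eval t u + tens_eval t w"
  by (simp_all add: tens_eval_def case_prod_unfold)

context
  fixes t :: "'a::unital_cstar_algebra \<Rightarrow> 'b::unital_cstar_algebra \<Rightarrow> 'c::unital_cstar_algebra"
  assumes mt: "min_tensor t"
begin

lemma min_tensor_add_left: "t (a + a') b = t a b + t a' b"
  and min_tensor_add_right: "t a (b + b') = t a b + t a b'"
  and min_tensor_scaleC_left: "t (c *\<^sub>C a) b = c *\<^sub>C t a b"
  and min_tensor_scaleC_right: "t a (c *\<^sub>C b) = c *\<^sub>C t a b"
  and min_tensor_mult: "t a b * t a' b' = t (a * a') (b * b')"
  and min_tensor_star: "star (t a b) = t (star a) (star b)"
  and min_tensor_one: "t 1 1 = 1"
  and min_tensor_norm: "norm (t a b) = norm a * norm b"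
  and min_tensor_eval_norm: "norm (tens_eval t u) = min_tensor_norm u"
  and min_tensor_dense: "closure (span {t a b | a b. True}) = UNIV"
  using mt unfolding min_tensor_def tens_eval_def by blast+

lemma min_tensor_zero_left [simp]: "t 0 b = 0"
  using min_tensor_add_left[of 0 0 b] by simp

lemma min_tensor_zero_right [simp]: "t a 0 = 0"
  using min_tensor_add_right[of a 0 0] by simp

lemma min_tensor_sum_left: "t (\<Sum>i\<in>I. f i) b = (\<Sum>i\<in>I. t (f i) b)"
  by (induction I rule: infinite_finite_induct) (auto simp: min_tensor_add_left)

lemma min_tensor_sum_right: "t a (\<Sum>i\<in>I. f i) = (\<Sum>i\<in>I. t a (f i))"
  by (induction I rule: infinite_finite_induct) (auto simp: min_tensor_add_right)

lemma min_tensor_diff_left: "t (a - a') b = t a b - t a' b"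
  using min_tensor_add_left[of "a - a'" a' b] by simp

lemma min_tensor_diff_right: "t a (b - b') = t a b - t a b'"
  using min_tensor_add_right[of a "b - b'" b'] by simp

lemma min_tensor_scaleR_left: "t (r *\<^sub>R a) b = r *\<^sub>R t a b"
  using min_tensor_scaleC_left[of "of_real r" a b] by (simp add: scaleC_of_real)

lemma min_tensor_scaleR_right: "t a (r *\<^sub>R b) = r *\<^sub>R t a b"
  using min_tensor_scaleC_right[of a "of_real r" b] by (simp add: scaleC_of_real)

lemma tens_eval_scale: "tens_eval t (tens_scale c u) = c *\<^sub>C tens_eval t u"
  by (induction u) (auto simp: tens_scale_def min_tensor_scaleC_left scaleC_add_right)

lemma tens_eval_star: "tens_eval t (tens_star u) = star (tens_eval t u)"
  by (induction u) (auto simp: tens_star_def min_tensor_star star_add)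

lemma tens_eval_mult: "tens_eval t (tens_mult u w) = tens_eval t u * tens_eval t w"
proof (induction u)
  case (Cons p u)
  obtain a b where p: "p = (a, b)" by (cases p)
  have "tens_eval t (map (\<lambda>(c, d). (a * c, b * d)) w) = t a b * tens_eval t w"
    by (induction w) (auto simp: min_tensor_mult distrib_left)
  then show ?case by (simp add: p tens_mult_Cons tens_eval_append Cons distrib_right)
qed (simp add: tens_mult_def)

lemma tens_eval_dense: "\<exists>u. (\<lambda>n. tens_eval t (u n)) \<longlonglongrightarrow> z"
proof -
  have ex: "\<exists>u. tens_eval t u = y" if "y \<in> span {t a b | a b. True}" for y
    using that
  proof (induction rule: span_induct_alt)
    case base
    show ?case by (rule exI[of _ "[]"]) simp
  next
    case (step r x y)
    then obtain a b u where "x = t a b" "tens_eval t u = y" by blast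
    then show ?case
      by (intro exI[of _ "(r *\<^sub>R a, b) # u"]) (simp add: min_tensor_scaleR_left)
  qed
  have "z \<in> closure (span {t a b | a b. True})" by (subst min_tensor_dense) (rule UNIV_I)
  then obtain y where y: "\<And>n. y n \<in> span {t a b | a b. True}" "y \<longlonglongrightarrow> z"
    unfolding closure_sequential by blast
  from ex[OF y(1)] obtain u where "\<And>n. tens_eval t (u n) = y n" by metis
  then have "(\<lambda>n. tens_eval t (u n)) = y" by blast
  with y(2) show ?thesis by blast
qed

lemma tens_functional_le:
  "state \<phi> \<Longrightarrow> state \<psi> \<Longrightarrow> cmod (tens_functional \<phi> \<psi> u) \<le> norm (tens_eval t u)"
  by (simp add: min_tensor_eval_norm tens_functional_le_min_tensor_norm)

text \<open>The product functional is contractive for the minimal norm on the algebraic tensor product, so it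
  extends by continuity to the completion. Positivity passes to the limit.\<close>

lemma product_state:
  assumes st: "state \<phi>" "state \<psi>"
  shows "\<exists>\<Phi>. state \<Phi> \<and> (\<forall>u. \<Phi> (tens_eval t u) = tens_functional \<phi> \<psi> u)"
proof -
  note pos = st[THEN state_positive]
  let ?F = "tens_functional \<phi> \<psi>"
  obtain U where U: "\<And>z. (\<lambda>n. tens_eval t (U z n)) \<longlonglongrightarrow> z"
    using tens_eval_dense by metis
  have diff: "cmod (?F u - ?F w) \<le> norm (tens_eval t u - tens_eval t w)" for u w
    using tens_functional_le[OF st, of "u @ tens_scale (-1) w"]
    by (simp add: tens_functional_append tens_functional_scale[OF pos] tens_eval_append
        tens_eval_scale scaleC_minus_one)
  define \<Phi> where "\<Phi> z = lim (\<lambda>n. ?F (U z n))" for z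
  have base: "(\<lambda>n. ?F (U z n)) \<longlonglongrightarrow> \<Phi> z" for z
  proof -
    have "Cauchy (\<lambda>n. tens_eval t (U z n))" using U by (rule LIMSEQ_imp_Cauchy)
    then have "Cauchy (\<lambda>n. ?F (U z n))"
      unfolding Cauchy_def dist_norm using diff by (meson le_less_trans)
    then show ?thesis
      unfolding \<Phi>_def by (simp add: Cauchy_convergent_iff convergent_LIMSEQ_iff)
  qed
  have lim: "(\<lambda>n. ?F (u n)) \<longlonglongrightarrow> \<Phi> z" if "(\<lambda>n. tens_eval t (u n)) \<longlonglongrightarrow> z" for u z
  proof -
    have "(\<lambda>n. tens_eval t (u n) - tens_eval t (U z n)) \<longlonglongrightarrow> z - z"
      by (intro tendsto_diff that U)
    then have "(\<lambda>n. norm (tens_eval t (u n) - tens_eval t (U z n))) \<longlonglongrightarrow> 0"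
      by (intro tendsto_norm_zero) simp
    then have "(\<lambda>n. ?F (u n) - ?F (U z n)) \<longlonglongrightarrow> 0"
      by (rule Lim_null_comparison[rotated]) (simp add: diff)
    from tendsto_add[OF this base[of z]] show ?thesis by simp
  qed
  have eval: "\<Phi> (tens_eval t u) = ?F u" for u
    using lim[of "\<lambda>_. u"] by (simp add: LIMSEQ_const_iff)
  have "state \<Phi>"
  proof (rule stateI)
    show "\<Phi> 1 = 1"
      using eval[of "[(1, 1)]"] by (simp add: min_tensor_one tens_functional_def state_one st)
    show "positive_functional \<Phi>"
      unfolding positive_functional_def
    proof (intro conjI allI)
      fix x y c
      have "(\<lambda>n. ?F (U x n @ U y n)) \<longlonglongrightarrow> \<Phi> (x + y)"
        by (rule lim) (simp add: tens_eval_append tendsto_add U)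
      moreover have "(\<lambda>n. ?F (U x n @ U y n)) \<longlonglongrightarrow> \<Phi> x + \<Phi> y"
        by (simp add: tens_functional_append tendsto_add base)
      ultimately show "\<Phi> (x + y) = \<Phi> x + \<Phi> y" by (rule LIMSEQ_unique)
      have "(\<lambda>n. c *\<^sub>C tens_eval t (U x n)) \<longlonglongrightarrow> c *\<^sub>C x"
        using tendsto_mult[OF tendsto_const[of "c *\<^sub>C 1"] U[of x]] by (simp add: mult_scaleC_left)
      then have "(\<lambda>n. ?F (tens_scale c (U x n))) \<longlonglongrightarrow> \<Phi> (c *\<^sub>C x)"
        by (intro lim) (simp add: tens_eval_scale)
      moreover have "(\<lambda>n. ?F (tens_scale c (U x n))) \<longlonglongrightarrow> c * \<Phi> x"
        by (simp add: tens_functional_scale[OF pos] tendsto_mult base)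
      ultimately show "\<Phi> (c *\<^sub>C x) = c * \<Phi> x" by (rule LIMSEQ_unique)
      have "(\<lambda>n. ?F (tens_mult (tens_star (U x n)) (U x n))) \<longlonglongrightarrow> \<Phi> (star x * x)"
        by (rule lim) (simp add: tens_eval_mult tens_eval_star tendsto_mult tendsto_star U)
      then have "(\<lambda>n. tens_inner \<phi> \<psi> (U x n) (U x n)) \<longlonglongrightarrow> \<Phi> (star x * x)"
        by (simp add: tens_functional_star_mult)
      then show "\<Phi> (star x * x) \<in> \<real>\<^sub>\<ge>\<^sub>0"
        by (rule Lim_in_closed_set[OF closed_nonneg_Reals_complex _ sequentially_bot, rotated])
          (simp add: tens_inner_nonneg[OF pos])
    qed
  qed
  with eval show ?thesis by blast
qed

text \<open>If all states vanish on \<open>x\<^sup>* x\<close>, then so do all vector states, and \<open>x \<otimes> 1\<close> and \<open>0 \<otimes> 1\<close> have the same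
  minimal norm. Thus the norm formula of the tensor product supplies the states that separate the
  points of the algebra, without the Hahn-Banach theorem.\<close>

lemma states_detect_nonzero:
  fixes x :: 'a
  assumes "x \<noteq> 0"
  shows "\<exists>\<phi>. state \<phi> \<and> \<phi> (star x * x) \<noteq> 0"
proof (rule ccontr)
  assume contra: "\<not> ?thesis"
  define X where "X u = {sqrt (Re (tens_inner \<phi> \<psi> (tens_mult u v) (tens_mult u v))
              / Re (tens_inner \<phi> \<psi> v v)) | (\<phi> :: 'a \<Rightarrow> complex) (\<psi> :: 'b \<Rightarrow> complex) v.
          state \<phi> \<and> state \<psi> \<and> tens_inner \<phi> \<psi> v v \<noteq> 0}" for u :: "('a \<times> 'b) list"
  have norm_eq: "norm (tens_eval t u) = Sup (X u)" for u
    unfolding min_tensor_eval_norm min_tensor_norm_def tens_functional_star_mult X_def ..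
  have null: "\<phi> (star (x * c) * (x * d)) = 0" if st: "state \<phi>" for \<phi> :: "'a \<Rightarrow> complex" and c d
  proof -
    note pos = state_positive[OF st]
    have "\<phi> (star (x * c) * (x * c)) = 0"
    proof (cases "\<phi> (star c * c) = 0")
      case True
      then show ?thesis
        using positive_functional_null_left_ideal[OF pos True, of "star (x * c) * x"]
        by (simp add: mult.assoc)
    next
      case False
      with contra state_vector_state[OF st False] show ?thesis by (auto simp: star_mult mult.assoc)
    qed
    then show ?thesis
      using positive_functional_null_left_ideal[OF pos, of "x * c" "star (x * d)"]
        positive_functional_hermitian[OF pos, of "x * c" "x * d"]
      by (metis complex_cnj_zero complex_cnj_cnj)
  qed
  have zero: "tens_inner \<phi> \<psi> (tens_mult [(y, 1)] v) (tens_mult [(y, 1)] v) = 0"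
    if "state \<phi>" "y = x \<or> y = 0" for \<phi> :: "'a \<Rightarrow> complex" and \<psi> :: "'b \<Rightarrow> complex" and v y
    unfolding tens_inner_nth using that
    by (intro sum.neutral ballI)
      (auto simp: tens_mult_def case_prod_unfold null positive_functional_zero[OF state_positive])
  \<comment> \<open>Both sets are contained in \<open>{0}\<close>; comparing them leaves open whether they are empty, in which case
    their supremum would be unspecified.\<close>
  have "X [(x, 1)] = X [(0, 1)]"
    unfolding X_def by (intro Collect_cong ex_cong1) (auto simp: zero)
  then have "norm (t x 1) = norm (t 0 1)"
    using norm_eq[of "[(x, 1)]"] norm_eq[of "[(0, 1)]"] by simp
  with assms show False by (simp add: min_tensor_norm)
qed

text \<open>Sums of squares are zero only trivially. This is the only form in which positivity in the algebra
  itself, rather than of functionals, enters the later arguments.\<close>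

lemma weighted_sum_of_squares_zero:
  fixes x :: "'i \<Rightarrow> 'a"
  assumes "finite I" and w: "\<And>i. i \<in> I \<Longrightarrow> 0 \<le> w i"
    and sum: "(\<Sum>i\<in>I. w i *\<^sub>R (star (x i) * x i)) = 0" and i: "i \<in> I" "0 < w i"
  shows "x i = 0"
proof (rule ccontr)
  assume "x i \<noteq> 0"
  then obtain \<phi> where st: "state \<phi>" and nz: "\<phi> (star (x i) * x i) \<noteq> 0"
    using states_detect_nonzero by blast
  note pos = state_positive[OF st]
  have nonneg: "Re (\<phi> (star (x j) * x j)) \<ge> 0" "Im (\<phi> (star (x j) * x j)) = 0" for j
    using positive_functional_nonneg[OF pos, of "x j"] by (auto simp: complex_nonneg_Reals_iff)
  have "(\<Sum>j\<in>I. w j * Re (\<phi> (star (x j) * x j))) = Re (\<phi> (\<Sum>i\<in>I. w i *\<^sub>R (star (x i) * x i)))"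
    by (simp add: positive_functional_sum[OF pos] positive_functional_scaleR[OF pos])
  also have "\<dots> = 0" by (simp add: sum positive_functional_zero[OF pos])
  finally have "w i * Re (\<phi> (star (x i) * x i)) = 0"
    using sum_nonneg_eq_0_iff[OF \<open>finite I\<close>, of "\<lambda>j. w j * Re (\<phi> (star (x j) * x j))"] w nonneg i by auto
  with i nz nonneg(2)[of i] show False by (simp add: complex_eq_iff)
qed

end

text \<open>Weak-* compactness of the state space: the states lie in a product of closed discs, which is
  compact by Tychonoff's theorem.\<close>

lemma state_sequence_cluster:
  fixes \<mu> :: "nat \<Rightarrow> 'a::unital_cstar_algebra \<Rightarrow> complex"
  assumes st: "\<And>n. state (\<mu> n)"
  shows "\<exists>h. state h \<and> (\<forall>x l. (\<lambda>n. \<mu> n x) \<longlonglongrightarrow> l \<longrightarrow> h x = l)"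
proof -
  let ?K = "PiE UNIV (\<lambda>x :: 'a. cball (0 :: complex) (norm x))"
  have "compactin (product_topology (\<lambda>_. euclidean) UNIV) ?K"
    by (subst compactin_PiE) (auto simp: compactin_euclidean_iff)
  then have K: "compact ?K" by (simp add: euclidean_product_topology compactin_euclidean_iff)
  define F where "F = filtermap \<mu> sequentially"
  have "F \<noteq> bot" by (simp add: F_def filtermap_bot_iff)
  moreover have evst: "eventually state F" by (simp add: F_def eventually_filtermap st)
  then have "eventually (\<lambda>f. f \<in> ?K) F"
    by (rule eventually_mono) (auto simp: state_def)
  ultimately obtain h where G: "inf (nhds h) F \<noteq> bot"
    using K unfolding compact_filter by blast
  have lim: "((\<lambda>f. f x) \<longlongrightarrow> h x) (inf (nhds h) F)" for x
  proof -
    have "((\<lambda>f :: 'a \<Rightarrow> complex. f x) \<longlongrightarrow> h x) (at h)"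
      using continuous_on_product_coordinates[of x] unfolding continuous_on_def by blast
    then have "((\<lambda>f. f x) \<longlongrightarrow> h x) (nhds h)"
      using tendsto_at_iff_tendsto_nhds[of "\<lambda>f. f x" h] by simp
    then show ?thesis by (rule filterlim_mono) auto
  qed
  have ev: "eventually state (inf (nhds h) F)"
    using evst by (rule filter_leD[rotated]) simp
  have uniq: "h x = l" if "(\<lambda>n. \<mu> n x) \<longlonglongrightarrow> l" for x l
  proof -
    have "((\<lambda>f. f x) \<longlongrightarrow> l) F" using that by (simp add: F_def filterlim_filtermap)
    then have "((\<lambda>f. f x) \<longlongrightarrow> l) (inf (nhds h) F)" by (rule filterlim_mono) auto
    with lim G show ?thesis by (meson tendsto_unique)
  qed
  have "state h"
  proof (rule stateI)
    show "h 1 = 1" by (rule uniq) (simp add: state_one[OF st])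
    show "positive_functional h"
      unfolding positive_functional_def
    proof (intro conjI allI)
      fix x y c
      have "((\<lambda>f. f (x + y)) \<longlongrightarrow> h x + h y) (inf (nhds h) F)"
        by (rule Lim_transform_eventually[OF tendsto_add[OF lim lim]])
          (use ev in \<open>auto elim!: eventually_mono simp: state_def\<close>)
      then show "h (x + y) = h x + h y" using tendsto_unique[OF G lim] by blast
      have "((\<lambda>f. f (c *\<^sub>C x)) \<longlongrightarrow> c * h x) (inf (nhds h) F)"
        by (rule Lim_transform_eventually[OF tendsto_mult[OF tendsto_const lim]])
          (use ev in \<open>auto elim!: eventually_mono simp: state_def\<close>)
      then show "h (c *\<^sub>C x) = c * h x" using tendsto_unique[OF G lim] by blast
      show "h (star x * x) \<in> \<real>\<^sub>\<ge>\<^sub>0"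
        by (rule Lim_in_closed_set[OF closed_nonneg_Reals_complex _ G lim])
          (use ev in \<open>auto elim!: eventually_mono simp: state_def\<close>)
    qed
  qed
  with uniq show ?thesis by blast
qed

section \<open>Convolution-invariant states\<close>

lemma state_average:
  assumes "state \<phi>" "state \<psi>"
  shows "state (\<lambda>x. (\<phi> x + \<psi> x) / 2)"
proof (rule stateI)
  note pos = assms[THEN state_positive]
  have "(\<phi> (star x * x) + \<psi> (star x * x)) / 2 \<in> \<real>\<^sub>\<ge>\<^sub>0" for x
    using pos[THEN positive_functional_nonneg, of x] by (intro nonneg_Reals_divide_I nonneg_Reals_add_I) auto
  then show "positive_functional (\<lambda>x. (\<phi> x + \<psi> x) / 2)"
    by (simp add: positive_functional_def pos[THEN positive_functional_add]
        pos[THEN positive_functional_scaleC] add_divide_distrib algebra_simps)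
qed (simp add: assms[THEN state_one])

text \<open>If \<open>y\<close> represents the shift of \<open>x\<close> along the sequence, then the averages of \<open>y - x\<close> telescope
  and tend to zero.\<close>

lemma Cesaro_limit_state:
  fixes \<theta> :: "nat \<Rightarrow> 'a::unital_cstar_algebra \<Rightarrow> complex"
  assumes st: "\<And>k. state (\<theta> k)"
  shows "\<exists>h. state h \<and> (\<forall>x y. (\<forall>k. \<theta> k y = \<theta> (Suc k) x) \<longrightarrow> h y = h x)"
proof -
  note pos = st[THEN state_positive]
  define \<mu> where "\<mu> N x = (\<Sum>k\<le>N. \<theta> k x) / of_nat (Suc N)" for N x
  have "state (\<mu> N)" for N
  proof (rule stateI)
    have "\<mu> N (star x * x) \<in> \<real>\<^sub>\<ge>\<^sub>0" for x
      unfolding \<mu>_def using pos[THEN positive_functional_nonneg, of _ x]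
      by (intro nonneg_Reals_divide_I nonneg_Reals_sum) auto
    then show "positive_functional (\<mu> N)"
      by (simp add: positive_functional_def) (simp add: \<mu>_def pos[THEN positive_functional_add]
          pos[THEN positive_functional_scaleC] sum.distrib add_divide_distrib sum_distrib_left)
    show "\<mu> N 1 = 1"
      unfolding \<mu>_def st[THEN state_one] by (simp del: of_nat_Suc add: of_nat_Suc[symmetric])
  qed
  then obtain h where h: "state h" and lim: "\<And>x l. (\<lambda>n. \<mu> n x) \<longlonglongrightarrow> l \<Longrightarrow> h x = l"
    using state_sequence_cluster by metis
  have "h y = h x" if shift: "\<And>k. \<theta> k y = \<theta> (Suc k) x" for x y
  proof -
    have tele: "\<mu> N (y - x) = (\<theta> (Suc N) x - \<theta> 0 x) / of_nat (Suc N)" for N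
    proof -
      have "(\<Sum>k\<le>N. \<theta> k (y - x)) = \<theta> (Suc N) x - \<theta> 0 x"
        by (induction N) (simp_all add: pos[THEN positive_functional_diff] shift)
      then show ?thesis by (simp add: \<mu>_def)
    qed
    have "(\<lambda>N. \<mu> N (y - x)) \<longlonglongrightarrow> 0"
    proof (rule Lim_null_comparison)
      show "\<forall>\<^sub>F N in sequentially. norm (\<mu> N (y - x)) \<le> 2 * norm x * inverse (real (Suc N))"
      proof (intro always_eventually allI)
        fix N
        have "cmod (\<theta> (Suc N) x - \<theta> 0 x) \<le> norm x + norm x"
          by (meson norm_triangle_ineq4 add_mono order_trans st state_norm_le)
        then show "norm (\<mu> N (y - x)) \<le> 2 * norm x * inverse (real (Suc N))"
          unfolding tele divide_inverse norm_mult norm_inverse norm_of_nat by (intro mult_right_mono) auto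
      qed
      have "(\<lambda>N. 2 * norm x * inverse (real (Suc N))) \<longlonglongrightarrow> 2 * norm x * 0"
        by (intro tendsto_intros LIMSEQ_inverse_real_of_nat)
      then show "(\<lambda>N. 2 * norm x * inverse (real (Suc N))) \<longlonglongrightarrow> 0" by simp
    qed
    then have "h (y - x) = 0" by (rule lim)
    then show ?thesis by (simp add: positive_functional_diff[OF state_positive[OF h]])
  qed
  with h show ?thesis by blast
qed

lemma finite_sum_as_tens_eval:
  assumes "finite I"
  shows "\<exists>u. tens_eval t u = (\<Sum>k\<in>I. t (f k) (g k)) \<and>
    (\<forall>\<phi> \<psi>. tens_functional \<phi> \<psi> u = (\<Sum>k\<in>I. \<phi> (f k) * \<psi> (g k)))"
proof -
  obtain xs where xs: "set xs = I" "distinct xs" using finite_distinct_list[OF assms] by blast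
  show ?thesis
    by (rule exI[of _ "map (\<lambda>k. (f k, g k)) xs"])
      (simp add: tens_eval_def tens_functional_def o_def sum_list_distinct_conv_sum_set xs)
qed

text \<open>For a co-representation matrix, this is what the density of \<open>\<alpha>(A)(1 \<otimes> S)\<close> amounts to.\<close>

definition approx_right_invertible :: "('v::finite \<Rightarrow> 'v \<Rightarrow> 's::unital_cstar_algebra) \<Rightarrow> bool" where
  "approx_right_invertible q \<longleftrightarrow>
     (\<forall>\<epsilon>>0. \<exists>r. \<forall>j l. norm ((\<Sum>i\<in>UNIV. q j i * r i l) - (if j = l then 1 else 0)) < \<epsilon>)"

context
  fixes t :: "'s::unital_cstar_algebra \<Rightarrow> 's \<Rightarrow> 'ss::unital_cstar_algebra" and \<Delta> :: "'s \<Rightarrow> 'ss"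
    and q :: "'v::finite \<Rightarrow> 'v \<Rightarrow> 's"
  assumes mt: "min_tensor t" and hom: "unital_star_hom \<Delta>"
    and corep: "\<And>j i. \<Delta> (q j i) = (\<Sum>k\<in>UNIV. t (q j k) (q k i))"
begin

lemma star_hom_add: "\<Delta> (x + y) = \<Delta> x + \<Delta> y"
  and star_hom_scaleC: "\<Delta> (c *\<^sub>C x) = c *\<^sub>C \<Delta> x"
  and star_hom_mult: "\<Delta> (x * y) = \<Delta> x * \<Delta> y"
  and star_hom_star: "\<Delta> (star x) = star (\<Delta> x)"
  and star_hom_one: "\<Delta> 1 = 1"
  using hom by (auto simp: unital_star_hom_def star_hom_def)

lemma star_hom_sum_scaleR: "\<Delta> (\<Sum>i\<in>I. r i *\<^sub>R x i) = (\<Sum>i\<in>I. r i *\<^sub>R \<Delta> (x i))"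
proof -
  have "\<Delta> 0 = 0" using star_hom_scaleC[of 0 0] by simp
  moreover have "\<Delta> (r *\<^sub>R y) = r *\<^sub>R \<Delta> y" for r y
    using star_hom_scaleC[of "of_real r" y] by (simp add: scaleC_of_real)
  ultimately show ?thesis
    by (induction I rule: infinite_finite_induct) (auto simp: star_hom_add)
qed

text \<open>\<open>\<theta>\<close> is the convolution \<open>(\<phi> \<otimes> \<psi>) \<circ> \<Delta>\<close>.\<close>

lemma convolution_state:
  assumes st: "state \<phi>" "state \<psi>"
  shows "\<exists>\<theta>. state \<theta> \<and> (\<forall>x u. \<Delta> x = tens_eval t u \<longrightarrow> \<theta> x = tens_functional \<phi> \<psi> u)"
proof -
  obtain \<Phi> where \<Phi>: "state \<Phi>" "\<And>u. \<Phi> (tens_eval t u) = tens_functional \<phi> \<psi> u"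
    using product_state[OF mt st] by blast
  have "state (\<lambda>x. \<Phi> (\<Delta> x))"
    by (rule stateI) (use state_positive[OF \<Phi>(1)] state_one[OF \<Phi>(1)] in
        \<open>simp_all add: positive_functional_def star_hom_add star_hom_scaleC star_hom_mult
          star_hom_star star_hom_one\<close>)
  with \<Phi>(2) show ?thesis by (intro exI[of _ "\<lambda>x. \<Phi> (\<Delta> x)"]) simp
qed

text \<open>\<open>h\<close> is a limit of averages of the convolution powers of \<open>\<omega>\<close>. It satisfies \<open>h * \<omega> = h\<close> on the entries of
  \<open>q\<close>, and \<open>\<omega> * h = h\<close> on every element whose comultiplication lies in the algebraic tensor product, in
  particular on products of entries. Restricting to such elements avoids slice maps on the
  completed tensor product.\<close>

lemma convolution_invariant_state:
  assumes \<omega>: "state \<omega>"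
  shows "\<exists>h. state h \<and> (\<forall>j i. (\<Sum>m\<in>UNIV. h (q j m) * \<omega> (q m i)) = h (q j i)) \<and>
    (\<forall>x u. \<Delta> x = tens_eval t u \<longrightarrow> tens_functional \<omega> h u = h x)"
proof -
  obtain C where C: "\<And>\<psi>. state \<psi> \<Longrightarrow> state (C \<psi>)"
    "\<And>\<psi> x u. state \<psi> \<Longrightarrow> \<Delta> x = tens_eval t u \<Longrightarrow> C \<psi> x = tens_functional \<omega> \<psi> u"
    using convolution_state[OF \<omega>] by metis
  define \<theta> where "\<theta> k = (C ^^ k) \<omega>" for k
  have st: "state (\<theta> k)" for k by (induction k) (simp_all add: \<theta>_def C(1) \<omega>)
  note pos = st[THEN state_positive]
  have step: "\<theta> (Suc k) x = tens_functional \<omega> (\<theta> k) u" if "\<Delta> x = tens_eval t u" for k x u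
    using C(2)[OF st that] by (simp add: \<theta>_def)
  have left: "\<theta> (Suc k) (q j i) = (\<Sum>m\<in>UNIV. \<omega> (q j m) * \<theta> k (q m i))" for k j i
    using finite_sum_as_tens_eval[OF finite_class.finite_UNIV, of t "q j" "\<lambda>m. q m i"] step corep by metis
  have right: "\<theta> (Suc k) (q j i) = (\<Sum>m\<in>UNIV. \<theta> k (q j m) * \<omega> (q m i))" for k j i
  proof (induction k arbitrary: j)
    case 0
    show ?case unfolding left by (simp add: \<theta>_def)
  next
    case (Suc k)
    \<comment> \<open>Both sides are entries of powers of the scalar matrix \<open>\<omega>(q)\<close>, which commute.\<close>
    have "\<theta> (Suc (Suc k)) (q j i) = (\<Sum>l\<in>UNIV. \<omega> (q j l) * (\<Sum>m\<in>UNIV. \<theta> k (q l m) * \<omega> (q m i)))"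
      unfolding left[of "Suc k"] Suc ..
    also have "\<dots> = (\<Sum>m\<in>UNIV. (\<Sum>l\<in>UNIV. \<omega> (q j l) * \<theta> k (q l m)) * \<omega> (q m i))"
      by (simp only: sum_distrib_left sum_distrib_right mult.assoc) (rule sum.swap)
    finally show ?case unfolding left[of k] .
  qed
  obtain h where h: "state h" and inv: "\<And>x y. (\<And>k. \<theta> k y = \<theta> (Suc k) x) \<Longrightarrow> h y = h x"
    using Cesaro_limit_state[OF st] by metis
  note hpos = state_positive[OF h]
  have "(\<Sum>m\<in>UNIV. h (q j m) * \<omega> (q m i)) = h (q j i)" for j i
  proof -
    have "h (\<Sum>m\<in>UNIV. \<omega> (q m i) *\<^sub>C q j m) = h (q j i)"
      by (rule inv) (simp add: right pos[THEN positive_functional_sum]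
          pos[THEN positive_functional_scaleC] mult.commute)
    then show ?thesis
      by (simp add: positive_functional_sum[OF hpos] positive_functional_scaleC[OF hpos] mult.commute)
  qed
  moreover have "tens_functional \<omega> h u = h x" if x: "\<Delta> x = tens_eval t u" for x u
  proof -
    \<comment> \<open>The slice \<open>(\<omega> \<otimes> id)(\<Delta> x)\<close>.\<close>
    define y where "y = (\<Sum>(a, b)\<leftarrow>u. \<omega> a *\<^sub>C b)"
    have y: "\<phi> y = tens_functional \<omega> \<phi> u" if "positive_functional \<phi>" for \<phi>
      unfolding y_def tens_functional_def
      by (induction u) (auto simp: positive_functional_zero[OF that] positive_functional_add[OF that]
          positive_functional_scaleC[OF that])
    have "h y = h x" by (rule inv) (simp add: y[OF pos] step[OF x])
    then show ?thesis by (simp add: y[OF hpos])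
  qed
  ultimately show ?thesis using h by blast
qed

text \<open>The argument that produces Haar states on compact quantum groups. For a row vector \<open>p\<close> that is
  stationary for the stochastic matrix \<open>\<omega>(q)\<close> put \<open>b = p q\<close>. Then \<open>X = \<Delta>(b) - 1 \<otimes> b\<close> is a null vector of
  \<open>\<omega> \<otimes> h\<close>: when \<open>X\<^sup>* X\<close> is expanded, each of the four terms has the value \<open>h(b\<^sup>2)\<close> up to sign, by
  stationarity of \<open>p\<close> and invariance of \<open>h\<close>. As \<open>X = \<Sum>\<^sub>a y\<^sub>a \<otimes> q\<^sub>a\<^sub>i\<close> with \<open>y = p q - p\<close>, an approximate
  right inverse of \<open>q\<close> in the second leg recovers \<open>y\<close> from \<open>X\<close>, so \<open>y\<close> is a null vector of
  \<open>\<omega>\<close>.\<close>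

lemma stationary_vector_null:
  fixes p :: "'v \<Rightarrow> real"
  assumes \<omega>: "state \<omega>" and sa: "\<And>j i. star (q j i) = q j i"
    and inv: "approx_right_invertible q"
    and stat: "\<And>i. (\<Sum>k\<in>UNIV. of_real (p k) * \<omega> (q k i)) = of_real (p i)"
  defines "y \<equiv> \<lambda>l. (\<Sum>k\<in>UNIV. p k *\<^sub>R q k l) - p l *\<^sub>R 1"
  shows "\<omega> (star (y l) * y l) = 0"
proof -
  obtain h where h: "state h"
    and hinv: "\<And>x u. \<Delta> x = tens_eval t u \<Longrightarrow> tens_functional \<omega> h u = h x"
    using convolution_invariant_state[OF \<omega>] by metis
  obtain \<Phi> where \<Phi>: "state \<Phi>" "\<And>u. \<Phi> (tens_eval t u) = tens_functional \<omega> h u"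
    using product_state[OF mt \<omega> h] by blast
  note \<omega>pos = state_positive[OF \<omega>] and hpos = state_positive[OF h] and \<Phi>pos = state_positive[OF \<Phi>(1)]
  have \<Phi>t: "\<Phi> (t a b) = \<omega> a * h b" for a b
    using \<Phi>(2)[of "[(a, b)]"] by (simp add: tens_functional_def)
  define b where "b i = (\<Sum>k\<in>UNIV. p k *\<^sub>R q k i)" for i
  define X where "X i = \<Delta> (b i) - t 1 (b i)" for i
  have \<omega>b: "\<omega> (b i) = of_real (p i)" for i
    by (simp add: b_def positive_functional_sum[OF \<omega>pos] positive_functional_scaleR[OF \<omega>pos] stat)
  have \<Delta>b: "\<Delta> (b i) = (\<Sum>a\<in>UNIV. t (b a) (q a i))" for i
  proof -
    have "\<Delta> (b i) = (\<Sum>k\<in>UNIV. \<Sum>a\<in>UNIV. t (p k *\<^sub>R q k a) (q a i))"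
      unfolding b_def star_hom_sum_scaleR corep
      by (simp add: scaleR_sum_right min_tensor_scaleR_left[OF mt])
    also have "\<dots> = (\<Sum>a\<in>UNIV. \<Sum>k\<in>UNIV. t (p k *\<^sub>R q k a) (q a i))" by (rule sum.swap)
    also have "\<dots> = (\<Sum>a\<in>UNIV. t (b a) (q a i))" by (simp add: b_def min_tensor_sum_left[OF mt])
    finally show ?thesis .
  qed
  have X: "X i = (\<Sum>a\<in>UNIV. t (y a) (q a i))" for i
  proof -
    have "t 1 (b i) = (\<Sum>a\<in>UNIV. t (p a *\<^sub>R 1) (q a i))"
      by (simp add: b_def min_tensor_sum_right[OF mt] min_tensor_scaleR_left[OF mt] min_tensor_scaleR_right[OF mt])
    moreover have "y a = b a - p a *\<^sub>R 1" for a by (simp add: y_def b_def)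
    ultimately show ?thesis
      by (simp add: X_def \<Delta>b min_tensor_diff_left[OF mt] sum_subtractf)
  qed
  have null: "\<Phi> (star (X i) * X i) = 0" for i
  proof -
    have sb: "star (b i) = b i" by (simp add: b_def star_sum star_scaleR sa)
    have b': "h (b i * b i) = (\<Sum>a\<in>UNIV. of_real (p a) * h (b i * q a i))"
      "h (b i * b i) = (\<Sum>a\<in>UNIV. of_real (p a) * h (q a i * b i))"
    proof -
      have "b i * c = (\<Sum>a\<in>UNIV. p a *\<^sub>R (q a i * c))" "c * b i = (\<Sum>a\<in>UNIV. p a *\<^sub>R (c * q a i))" for c
        by (simp_all add: b_def sum_distrib_right sum_distrib_left)
      then have "h (b i * c) = (\<Sum>a\<in>UNIV. of_real (p a) * h (q a i * c))"
        "h (c * b i) = (\<Sum>a\<in>UNIV. of_real (p a) * h (c * q a i))" for c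
        by (simp_all only: positive_functional_sum[OF hpos] positive_functional_scaleR[OF hpos])
      then show "h (b i * b i) = (\<Sum>a\<in>UNIV. of_real (p a) * h (b i * q a i))"
        "h (b i * b i) = (\<Sum>a\<in>UNIV. of_real (p a) * h (q a i * b i))"
        by blast+
    qed
    have 1: "\<Phi> (\<Delta> (b i) * \<Delta> (b i)) = h (b i * b i)"
    proof -
      obtain u where u: "tens_eval t u = \<Delta> (b i)"
        using finite_sum_as_tens_eval[OF finite_class.finite_UNIV, of t b "\<lambda>a. q a i"] \<Delta>b by metis
      have "\<Delta> (b i * b i) = tens_eval t (tens_mult u u)"
        by (simp add: star_hom_mult tens_eval_mult[OF mt] u)
      from hinv[OF this] \<Phi>(2)[of "tens_mult u u"] show ?thesis
        by (simp add: tens_eval_mult[OF mt] u)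
    qed
    have 2: "\<Phi> (\<Delta> (b i) * t 1 (b i)) = h (b i * b i)"
      unfolding \<Delta>b b'(2)
      by (simp add: sum_distrib_right min_tensor_mult[OF mt] positive_functional_sum[OF \<Phi>pos] \<Phi>t \<omega>b)
    have 3: "\<Phi> (t 1 (b i) * \<Delta> (b i)) = h (b i * b i)"
      unfolding \<Delta>b b'(1)
      by (simp add: sum_distrib_left min_tensor_mult[OF mt] positive_functional_sum[OF \<Phi>pos] \<Phi>t \<omega>b)
    have 4: "\<Phi> (t 1 (b i) * t 1 (b i)) = h (b i * b i)"
      by (simp add: min_tensor_mult[OF mt] \<Phi>t state_one[OF \<omega>])
    have sX: "star (X i) = X i"
      unfolding X_def star_diff star_hom_star[symmetric] min_tensor_star[OF mt] by (simp add: sb)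
    have "star (X i) * X i = \<Delta> (b i) * \<Delta> (b i) - \<Delta> (b i) * t 1 (b i)
        - (t 1 (b i) * \<Delta> (b i) - t 1 (b i) * t 1 (b i))"
      unfolding sX unfolding X_def by (simp add: left_diff_distrib right_diff_distrib)
    then show ?thesis by (simp add: positive_functional_diff[OF \<Phi>pos] 1 2 3 4)
  qed
  \<comment> \<open>\<open>y l\<close> is recovered from the \<open>X i\<close> with an error of at most \<open>M \<epsilon>\<close>.\<close>
  define M where "M = (\<Sum>a\<in>UNIV. cmod (\<omega> (star (y l) * y a)))"
  have bound: "cmod (\<omega> (star (y l) * y l)) \<le> M * \<epsilon>" if \<epsilon>: "\<epsilon> > 0" for \<epsilon>
  proof -
    obtain r where r: "\<And>j l. norm ((\<Sum>i\<in>UNIV. q j i * r i l) - (if j = l then 1 else 0)) < \<epsilon>"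
      using inv \<epsilon> unfolding approx_right_invertible_def by metis
    define e where "e a = (\<Sum>i\<in>UNIV. q a i * r i l) - (if a = l then 1 else 0)" for a
    have e: "norm (e a) < \<epsilon>" for a unfolding e_def by (rule r)
    have "0 = (\<Sum>i\<in>UNIV. \<Phi> (t (star (y l)) (star (r i l)) * X i))"
      by (simp add: positive_functional_null_left_ideal[OF \<Phi>pos null])
    also have "\<dots> = (\<Sum>i\<in>UNIV. \<Sum>a\<in>UNIV. \<omega> (star (y l) * y a) * h (star (r i l) * q a i))"
      by (simp add: X sum_distrib_left min_tensor_mult[OF mt] positive_functional_sum[OF \<Phi>pos] \<Phi>t)
    also have "\<dots> = (\<Sum>a\<in>UNIV. \<omega> (star (y l) * y a) * h (\<Sum>i\<in>UNIV. star (r i l) * q a i))"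
      by (subst sum.swap) (simp add: sum_distrib_left positive_functional_sum[OF hpos])
    also have "\<dots> = (\<Sum>a\<in>UNIV. \<omega> (star (y l) * y a) * h (star ((if a = l then 1 else 0) + e a)))"
      by (simp add: e_def star_sum star_mult sa)
    also have "\<dots> = (\<Sum>a\<in>UNIV. (if a = l then \<omega> (star (y l) * y l) else 0)
          + \<omega> (star (y l) * y a) * h (star (e a)))"
      by (intro sum.cong refl) (auto simp: star_add positive_functional_add[OF hpos]
          positive_functional_zero[OF hpos] state_one[OF h] distrib_left)
    also have "\<dots> = \<omega> (star (y l) * y l) + (\<Sum>a\<in>UNIV. \<omega> (star (y l) * y a) * h (star (e a)))"
      by (simp add: sum.distrib)
    finally have "\<omega> (star (y l) * y l) = - (\<Sum>a\<in>UNIV. \<omega> (star (y l) * y a) * h (star (e a)))"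
      by (simp add: eq_neg_iff_add_eq_0)
    then have "cmod (\<omega> (star (y l) * y l)) = cmod (\<Sum>a\<in>UNIV. \<omega> (star (y l) * y a) * h (star (e a)))"
      by simp
    also have "\<dots> \<le> (\<Sum>a\<in>UNIV. cmod (\<omega> (star (y l) * y a)) * \<epsilon>)"
    proof (rule sum_norm_le)
      fix a
      have "cmod (h (star (e a))) \<le> \<epsilon>"
        using state_norm_le[OF h, of "star (e a)"] e[of a] by simp
      then show "cmod (\<omega> (star (y l) * y a) * h (star (e a))) \<le> cmod (\<omega> (star (y l) * y a)) * \<epsilon>"
        by (simp add: norm_mult mult_left_mono)
    qed
    also have "\<dots> = M * \<epsilon>" by (simp add: M_def sum_distrib_right)
    finally show ?thesis .
  qed
  have "M \<ge> 0" by (simp add: M_def sum_nonneg)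
  have "cmod (\<omega> (star (y l) * y l)) \<le> 0"
  proof (rule field_le_epsilon)
    fix e :: real assume "e > 0"
    have "cmod (\<omega> (star (y l) * y l)) \<le> M * (e / (M + 1))"
      using \<open>e > 0\<close> \<open>M \<ge> 0\<close> by (intro bound) auto
    also have "\<dots> \<le> e" using \<open>e > 0\<close> \<open>M \<ge> 0\<close> by (simp add: field_simps)
    finally show "cmod (\<omega> (star (y l) * y l)) \<le> 0 + e" by simp
  qed
  then show ?thesis by simp
qed

end

section \<open>Column sums of the co-representation matrix\<close>

lemma null_space_add:
  assumes st: "state \<phi>" and "\<phi> (star x * x) = 0" "\<phi> (star y * y) = 0"
  shows "\<phi> (star (x + y) * (x + y)) = 0"
  using positive_functional_null_left_ideal[OF state_positive[OF st] assms(2)]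
    positive_functional_null_left_ideal[OF state_positive[OF st] assms(3)]
  by (simp add: distrib_left positive_functional_add[OF state_positive[OF st]])

text \<open>If \<open>\<omega>\<close> were faithful, the rows \<open>p\<close> of \<open>h(q)\<close>, which are stationary, would satisfy \<open>p q = p\<close> by
  \<open>stationary_vector_null\<close>. Faithfulness is needed only on the finite-dimensional space of the vectors
  \<open>c q - c\<close> with \<open>c\<close> a real row vector. It holds for a state whose null space there has least
  dimension, because averaging with a further state would shrink a nonzero null space.\<close>

lemma invariant_weights:
  fixes t :: "'s::unital_cstar_algebra \<Rightarrow> 's \<Rightarrow> 'ss::unital_cstar_algebra" and \<Delta> :: "'s \<Rightarrow> 'ss"
    and q :: "'v::finite \<Rightarrow> 'v \<Rightarrow> 's"
  assumes mt: "min_tensor t" and hom: "unital_star_hom \<Delta>"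
    and corep: "\<And>j i. \<Delta> (q j i) = (\<Sum>k\<in>UNIV. t (q j k) (q k i))"
    and sa: "\<And>j i. star (q j i) = q j i" and idem: "\<And>j i. q j i * q j i = q j i"
    and inv: "approx_right_invertible q"
  shows "\<exists>h. state h \<and> (\<forall>j l. (\<Sum>k\<in>UNIV. Re (h (q j k)) *\<^sub>R q k l) = Re (h (q j l)) *\<^sub>R 1)"
proof -
  define y where "y c l = (\<Sum>k\<in>UNIV. (c $ k) *\<^sub>R q k l) - (c $ l) *\<^sub>R 1" for c :: "real ^ 'v" and l
  define K :: "('s \<Rightarrow> complex) \<Rightarrow> (real ^ 'v) set" where "K \<omega> = {c. \<forall>l. \<omega> (star (y c l) * y c l) = 0}" for \<omega>
  have y_add: "y (c + d) l = y c l + y d l" for c d l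
    by (simp add: y_def scaleR_add_left sum.distrib)
  have y_scale: "y (r *\<^sub>R c) l = r *\<^sub>R y c l" for r c l
    by (simp add: y_def scaleR_sum_right scaleR_diff_right)
  have y_zero: "y 0 l = 0" for l by (simp add: y_def)
  have K: "subspace (K \<omega>)" if st: "state \<omega>" for \<omega>
    unfolding subspace_def
    using null_space_add[OF st] positive_functional_zero[OF state_positive[OF st]]
      positive_functional_scaleR[OF state_positive[OF st]]
    by (auto simp: K_def y_add y_scale y_zero star_scaleR)
  obtain \<omega>0 :: "'s \<Rightarrow> complex" where "state \<omega>0"
    using states_detect_nonzero[OF mt, of 1] by auto
  then obtain \<omega> where \<omega>: "state \<omega>" and least: "\<And>\<omega>'. state \<omega>' \<Longrightarrow> dim (K \<omega>) \<le> dim (K \<omega>')"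
    using ex_has_least_nat[of state \<omega>0 "\<lambda>\<omega>. dim (K \<omega>)"] by blast
  have faithful: "y c l = 0" if c: "c \<in> K \<omega>" for c l
  proof (rule ccontr)
    assume "y c l \<noteq> 0"
    then obtain \<phi> where \<phi>: "state \<phi>" "\<phi> (star (y c l) * y c l) \<noteq> 0"
      using states_detect_nonzero[OF mt] by blast
    define \<omega>' where "\<omega>' x = (\<omega> x + \<phi> x) / 2" for x
    have st': "state \<omega>'" unfolding \<omega>'_def by (rule state_average[OF \<omega> \<phi>(1)])
    have "K \<omega>' \<subseteq> K \<omega>"
    proof
      fix d assume "d \<in> K \<omega>'"
      have "\<omega> (star (y d l) * y d l) = 0" for l
      proof -
        have "\<omega> (star (y d l) * y d l) + \<phi> (star (y d l) * y d l) = 0"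
          using \<open>d \<in> K \<omega>'\<close> by (simp add: K_def \<omega>'_def)
        then show ?thesis
          using positive_functional_nonneg[OF state_positive[OF \<omega>], of "y d l"]
            positive_functional_nonneg[OF state_positive[OF \<phi>(1)], of "y d l"]
          by (auto simp: complex_nonneg_Reals_iff complex_eq_iff)
      qed
      then show "d \<in> K \<omega>" by (simp add: K_def)
    qed
    moreover have "c \<notin> K \<omega>'"
      using c \<phi>(2) by (auto simp: K_def \<omega>'_def)
    ultimately have "K \<omega>' \<subset> K \<omega>" using c by blast
    then have "dim (K \<omega>') < dim (K \<omega>)"
      using K[OF \<omega>] K[OF st'] by (intro dim_psubset) (metis span_eq_iff)
    with least[OF st'] show False by simp
  qed
  obtain h where h: "state h"
    and hinv: "\<And>j i. (\<Sum>m\<in>UNIV. h (q j m) * \<omega> (q m i)) = h (q j i)"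
    using convolution_invariant_state[OF mt hom corep \<omega>] by metis
  have real: "of_real (Re (h (q j i))) = h (q j i)" for j i
    using positive_functional_nonneg[OF state_positive[OF h], of "q j i"]
    by (simp add: sa idem complex_nonneg_Reals_iff complex_eq_iff)
  have "(\<Sum>k\<in>UNIV. Re (h (q j k)) *\<^sub>R q k l) = Re (h (q j l)) *\<^sub>R 1" for j l
  proof -
    have "(\<chi> k. Re (h (q j k))) \<in> K \<omega>"
      using stationary_vector_null[OF mt hom corep \<omega> sa inv, of "\<lambda>k. Re (h (q j k))"]
      by (simp add: K_def y_def real hinv)
    from faithful[OF this, of l] show ?thesis by (simp add: y_def)
  qed
  with h show ?thesis by blast
qed

lemma projection_norm_le_one:
  fixes p :: "'s::unital_cstar_algebra"
  assumes "star p = p" "p * p = p"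
  shows "norm p \<le> 1"
  using cstar_identity[of p] assms by (auto simp: power2_eq_square)

text \<open>Summing the invariant rows of \<open>h(q)\<close> gives a weight vector \<open>f \<ge> 0\<close> with \<open>f q = f\<close>. An entry
  \<open>q\<^sub>j\<^sub>i\<close> can be nonzero only if \<open>f\<^sub>j \<le> f\<^sub>i\<close>, since \<open>f\<^sub>j q\<^sub>j\<^sub>i\<close> is at most \<open>f\<^sub>i\<close> as an operator. The row
  sums make \<open>\<Sum> f\<^sub>j (f\<^sub>i - f\<^sub>j) q\<^sub>j\<^sub>i\<close> vanish, so \<open>f\<close> is constant along nonzero entries where it is positive,
  and \<open>f q = f\<close> becomes the claim after division by \<open>f\<^sub>i\<close>. It remains to exclude zeros of \<open>f\<close>: on
  the rows of \<open>Z = {f = 0}\<close> an approximate right inverse would have to use only columns in \<open>Z\<close>, all of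
  whose entries are null for \<open>h\<close>.\<close>

lemma column_sums_one:
  fixes t :: "'s::unital_cstar_algebra \<Rightarrow> 's \<Rightarrow> 'ss::unital_cstar_algebra" and \<Delta> :: "'s \<Rightarrow> 'ss"
    and q :: "'v::finite \<Rightarrow> 'v \<Rightarrow> 's"
  assumes mt: "min_tensor t" and hom: "unital_star_hom \<Delta>"
    and corep: "\<And>j i. \<Delta> (q j i) = (\<Sum>k\<in>UNIV. t (q j k) (q k i))"
    and sa: "\<And>j i. star (q j i) = q j i"
    and row_orth: "\<And>j i k. q j i * q j k = (if i = k then q j i else 0)"
    and row_sum: "\<And>j. (\<Sum>i\<in>UNIV. q j i) = 1"
    and inv: "approx_right_invertible q"
  shows "(\<Sum>j\<in>UNIV. q j i) = 1"
proof -
  have idem: "q j i * q j i = q j i" for j i by (simp add: row_orth)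
  obtain h where h: "state h"
    and hinv: "\<And>j l. (\<Sum>k\<in>UNIV. Re (h (q j k)) *\<^sub>R q k l) = Re (h (q j l)) *\<^sub>R 1"
    using invariant_weights[OF mt hom corep sa idem inv] by metis
  note hpos = state_positive[OF h]
  have h_nonneg: "h (q j i) \<in> \<real>\<^sub>\<ge>\<^sub>0" for j i
    using positive_functional_nonneg[OF hpos, of "q j i"] by (simp add: sa idem)
  then have re_nonneg: "Re (h (q j i)) \<ge> 0" for j i by (simp add: complex_nonneg_Reals_iff)
  define f where "f i = (\<Sum>j\<in>UNIV. Re (h (q j i)))" for i
  have f_nonneg: "f i \<ge> 0" for i by (simp add: f_def sum_nonneg re_nonneg)
  have f_inv: "(\<Sum>j\<in>UNIV. f j *\<^sub>R q j i) = f i *\<^sub>R 1" for i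
  proof -
    have "(\<Sum>k\<in>UNIV. f k *\<^sub>R q k i) = (\<Sum>k\<in>UNIV. \<Sum>j\<in>UNIV. Re (h (q j k)) *\<^sub>R q k i)"
      by (simp add: f_def scaleR_sum_left)
    also have "\<dots> = (\<Sum>j\<in>UNIV. \<Sum>k\<in>UNIV. Re (h (q j k)) *\<^sub>R q k i)" by (rule sum.swap)
    also have "\<dots> = f i *\<^sub>R 1" by (simp add: hinv f_def scaleR_sum_left)
    finally show ?thesis .
  qed
  have smaller: "q j i = 0" if less: "f i < f j" for i j
  proof -
    \<comment> \<open>Compressing \<open>f q = f\<close> by \<open>q\<^sub>j\<^sub>i\<close> exhibits a vanishing sum of squares; its \<open>j\<close>-th weight is
      \<open>f\<^sub>j - f\<^sub>i > 0\<close>.\<close>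
    let ?w = "\<lambda>k. f k - (if k = j then f i else 0)"
    have sq: "star (q k i * q j i) * (q k i * q j i) = q j i * q k i * q j i" for k
      by (simp add: star_mult sa mult.assoc) (simp add: mult.assoc[symmetric] idem)
    have "(\<Sum>k\<in>UNIV. ?w k *\<^sub>R (star (q k i * q j i) * (q k i * q j i)))
        = (\<Sum>k\<in>UNIV. q j i * (f k *\<^sub>R q k i) * q j i - (if k = j then f i *\<^sub>R q j i else 0))"
      unfolding sq by (intro sum.cong refl) (auto simp: scaleR_diff_left idem)
    also have "\<dots> = q j i * (\<Sum>k\<in>UNIV. f k *\<^sub>R q k i) * q j i - f i *\<^sub>R q j i"
      by (simp add: sum_subtractf sum_distrib_left sum_distrib_right)
    also have "\<dots> = 0" unfolding f_inv by (simp add: idem)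
    finally have "q j i * q j i = 0"
      using less f_nonneg by (intro weighted_sum_of_squares_zero[OF mt finite_class.finite_UNIV, of ?w "\<lambda>k. q k i * q j i" j]) auto
    then show ?thesis by (simp add: idem)
  qed
  have level: "f j = 0 \<or> f i = f j" if nz: "q j i \<noteq> 0" for i j
  proof (rule ccontr)
    assume neg: "\<not> ?thesis"
    \<comment> \<open>The weight is set to zero on vanishing entries, where \<open>f\<^sub>i - f\<^sub>j\<close> may be negative.\<close>
    let ?w = "\<lambda>(j, i). if q j i = 0 then 0 else f j * (f i - f j)"
    have "(\<Sum>x\<in>UNIV. ?w x *\<^sub>R (star (case x of (j, i) \<Rightarrow> q j i) * (case x of (j, i) \<Rightarrow> q j i)))
        = (\<Sum>j\<in>UNIV. \<Sum>i\<in>UNIV. (f j * (f i - f j)) *\<^sub>R q j i)"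
      unfolding sum.cartesian_product UNIV_Times_UNIV
      by (intro sum.cong refl) (auto simp: sa idem)
    also have "\<dots> = (\<Sum>j\<in>UNIV. \<Sum>i\<in>UNIV. f i *\<^sub>R f j *\<^sub>R q j i) - (\<Sum>j\<in>UNIV. \<Sum>i\<in>UNIV. (f j * f j) *\<^sub>R q j i)"
      by (simp add: sum_subtractf right_diff_distrib scaleR_diff_left mult.commute)
    also have "(\<Sum>j\<in>UNIV. \<Sum>i\<in>UNIV. f i *\<^sub>R f j *\<^sub>R q j i) = (\<Sum>i\<in>UNIV. \<Sum>j\<in>UNIV. f i *\<^sub>R f j *\<^sub>R q j i)"
      by (rule sum.swap)
    also have "\<dots> = (\<Sum>i\<in>UNIV. (f i * f i) *\<^sub>R 1)"
      unfolding scaleR_sum_right[symmetric] f_inv by simp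
    also have "(\<Sum>j\<in>UNIV. \<Sum>i\<in>UNIV. (f j * f j) *\<^sub>R q j i) = (\<Sum>j\<in>UNIV. (f j * f j) *\<^sub>R 1)"
      by (simp add: scaleR_sum_right[symmetric] row_sum)
    finally have sum0: "(\<Sum>x\<in>UNIV. ?w x *\<^sub>R (star (case x of (j, i) \<Rightarrow> q j i) * (case x of (j, i) \<Rightarrow> q j i))) = 0"
      by simp
    have w_nonneg: "0 \<le> ?w x" for x
    proof (cases x)
      case (Pair j i)
      show ?thesis
      proof (cases "f i < f j")
        case True
        then show ?thesis by (simp add: Pair smaller)
      next
        case False
        then show ?thesis using f_nonneg[of j] by (simp add: Pair)
      qed
    qed
    have "f i > f j" using neg smaller nz by (meson linorder_neqE)
    then have "0 < ?w (j, i)" using nz neg f_nonneg[of j] by simp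
    from weighted_sum_of_squares_zero[OF mt finite_class.finite_UNIV w_nonneg sum0 UNIV_I this] nz
    show False by simp
  qed
  define Z where "Z = {i. f i = 0}"
  have colZ: "(\<Sum>j\<in>-Z. q j i) = 1" if i: "i \<notin> Z" for i
  proof -
    have "f i *\<^sub>R (\<Sum>j\<in>-Z. q j i) = (\<Sum>j\<in>-Z. f j *\<^sub>R q j i)"
      unfolding scaleR_sum_right
    proof (intro sum.cong refl)
      fix j assume "j \<in> - Z"
      then show "f i *\<^sub>R q j i = f j *\<^sub>R q j i" using level[of j i] by (cases "q j i = 0") (auto simp: Z_def)
    qed
    also have "\<dots> = (\<Sum>j\<in>UNIV. f j *\<^sub>R q j i)" by (rule sum.mono_neutral_left) (auto simp: Z_def)
    also have "\<dots> = f i *\<^sub>R 1" by (rule f_inv)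
    finally show ?thesis using i by (simp add: Z_def)
  qed
  have blockZ: "q j i = 0" if "i \<in> Z" "j \<notin> Z" for i j
    using that f_nonneg[of j] by (intro smaller) (auto simp: Z_def)
  have hZ: "h (q j i * z) = 0" if "i \<in> Z" for j i z
  proof -
    have "Re (h (q j i)) = 0"
      using that sum_nonneg_eq_0_iff[of UNIV "\<lambda>j. Re (h (q j i))"] re_nonneg by (simp add: Z_def f_def)
    then have "h (q j i) = 0" using h_nonneg[of j i] by (simp add: complex_nonneg_Reals_iff complex_eq_iff)
    then have "h (star (q j i) * q j i) = 0" by (simp add: sa idem)
    from positive_functional_null_left_ideal[OF hpos this, of "star z"]
      positive_functional_hermitian[OF hpos, of "q j i" z]
    show ?thesis by (simp add: sa)
  qed
  have "Z = {}"
  proof (rule ccontr)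
    assume "Z \<noteq> {}"
    then obtain l where l: "l \<in> Z" by blast
    define n where "n = real (card (UNIV :: 'v set))"
    have n: "n \<ge> 0" by (simp add: n_def)
    \<comment> \<open>The choice makes the total error \<open>n (n \<epsilon>) + \<epsilon>\<close> equal to \<open>1 / 2\<close>.\<close>
    define \<epsilon> where "\<epsilon> = 1 / (2 * (1 + n * n))"
    have \<epsilon>: "\<epsilon> > 0" using n by (simp add: \<epsilon>_def add_pos_nonneg)
    obtain r where r: "\<And>j l. norm ((\<Sum>i\<in>UNIV. q j i * r i l) - (if j = l then 1 else 0)) < \<epsilon>"
      using inv \<epsilon> unfolding approx_right_invertible_def by metis
    define e where "e j = (\<Sum>i\<in>UNIV. q j i * r i l) - (if j = l then 1 else 0)" for j
    have e: "norm (e j) \<le> \<epsilon>" for j unfolding e_def using r[of j l] by (rule less_imp_le)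
    \<comment> \<open>Rows outside \<open>Z\<close> are supported outside \<open>Z\<close>, where the columns sum to \<open>1\<close>; they can be solved for
      \<open>r k l\<close>, and the right-hand side is an error term because \<open>l\<close> belongs to \<open>Z\<close>.\<close>
    have r_small: "norm (r k l) \<le> n * \<epsilon>" if k: "k \<notin> Z" for k
    proof -
      have "r k l = (\<Sum>j\<in>-Z. q j k * r k l)"
        using colZ[OF k] by (simp add: sum_distrib_right[symmetric])
      also have "\<dots> = (\<Sum>j\<in>-Z. q j k * e j)"
      proof (intro sum.cong refl)
        fix j assume "j \<in> - Z"
        then have "e j = (\<Sum>i\<in>UNIV. q j i * r i l)" using l by (auto simp: e_def)
        then have "q j k * e j = (\<Sum>i\<in>UNIV. (q j k * q j i) * r i l)"
          by (simp add: sum_distrib_left mult.assoc)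
        also have "\<dots> = (\<Sum>i\<in>UNIV. if k = i then q j k * r i l else 0)"
          by (intro sum.cong refl) (simp add: row_orth)
        finally show "q j k * r k l = q j k * e j" by simp
      qed
      also have "norm \<dots> \<le> (\<Sum>j\<in>-Z. \<epsilon>)"
      proof (rule sum_norm_le)
        fix j
        have "norm (q j k * e j) \<le> norm (q j k) * norm (e j)" by (rule norm_mult_ineq)
        also have "\<dots> \<le> 1 * \<epsilon>"
          using projection_norm_le_one[OF sa idem] e by (intro mult_mono) auto
        finally show "norm (q j k * e j) \<le> \<epsilon>" by simp
      qed
      also have "\<dots> \<le> n * \<epsilon>"
        using \<epsilon> by (simp add: n_def card_mono mult_right_mono)
      finally show ?thesis .
    qed
    have "1 = h (\<Sum>i\<in>UNIV. q l i * r i l) - h (e l)"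
      by (simp add: e_def positive_functional_diff[OF hpos] state_one[OF h])
    also have "h (\<Sum>i\<in>UNIV. q l i * r i l) = (\<Sum>i\<in>-Z. h (q l i * r i l))"
      unfolding positive_functional_sum[OF hpos]
      by (rule sum.mono_neutral_right) (auto simp: hZ)
    finally have "1 = cmod ((\<Sum>i\<in>-Z. h (q l i * r i l)) - h (e l))" by (metis norm_one)
    also have "\<dots> \<le> cmod (\<Sum>i\<in>-Z. h (q l i * r i l)) + cmod (h (e l))" by (rule norm_triangle_ineq4)
    also have "\<dots> \<le> (\<Sum>i\<in>-Z. n * \<epsilon>) + \<epsilon>"
    proof (intro add_mono sum_norm_le)
      show "cmod (h (e l)) \<le> \<epsilon>" using state_norm_le[OF h, of "e l"] e[of l] by simp
      fix i assume "i \<in> - Z"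
      then have i: "i \<notin> Z" by simp
      have "cmod (h (q l i * r i l)) \<le> norm (q l i) * norm (r i l)"
        using state_norm_le[OF h] norm_mult_ineq order_trans by blast
      also have "\<dots> \<le> 1 * (n * \<epsilon>)"
        using projection_norm_le_one[OF sa idem] r_small[OF i] by (intro mult_mono) auto
      finally show "cmod (h (q l i * r i l)) \<le> n * \<epsilon>" by simp
    qed
    also have "\<dots> \<le> n * (n * \<epsilon>) + \<epsilon>"
      using \<epsilon> n by (simp add: n_def card_mono mult_right_mono)
    also have "\<dots> = 1 / 2" using n by (simp add: \<epsilon>_def field_simps add_nonneg_eq_0_iff)
    finally show False by simp
  qed
  with colZ[of i] show ?thesis by simp
qed

text \<open>Compressing the sum of the other projections by \<open>p k\<close> gives a vanishing sum of squares.\<close>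

lemma column_orthogonal:
  fixes t :: "'s::unital_cstar_algebra \<Rightarrow> 's \<Rightarrow> 'ss::unital_cstar_algebra"
    and p :: "'v::finite \<Rightarrow> 's"
  assumes mt: "min_tensor t" and sa: "\<And>j. star (p j) = p j" and idem: "\<And>j. p j * p j = p j"
    and sum: "(\<Sum>j\<in>UNIV. p j) = 1" and jk: "j \<noteq> k"
  shows "p j * p k = 0"
proof -
  have sq: "star (p j * p k) * (p j * p k) = p k * p j * p k" for j
    by (simp add: star_mult sa mult.assoc) (simp add: mult.assoc[symmetric] idem)
  have "(\<Sum>j\<in>UNIV - {k}. 1 *\<^sub>R (star (p j * p k) * (p j * p k))) = p k * (\<Sum>j\<in>UNIV - {k}. p j) * p k"
    by (simp add: sq sum_distrib_left sum_distrib_right)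
  also have "(\<Sum>j\<in>UNIV - {k}. p j) = 1 - p k"
    by (simp add: sum_diff1 sum)
  also have "p k * (1 - p k) * p k = 0" by (simp add: right_diff_distrib idem)
  finally show ?thesis
    using jk by (intro weighted_sum_of_squares_zero[OF mt, of "UNIV - {k}" "\<lambda>_. 1" "\<lambda>j. p j * p k" j]) auto
qed

section \<open>The co-representation matrix of a co-action on a finite set\<close>

lemma cfun_eqI: "(\<And>v. cfun_apply f v = cfun_apply g v) \<Longrightarrow> f = g"
  by (simp add: cfun_apply_inject[symmetric] fun_eq_iff)

lemma cfun_apply_sum: "cfun_apply (\<Sum>i\<in>I. f i) v = (\<Sum>i\<in>I. cfun_apply (f i :: 'v::finite cfun) v)"
  by (induction I rule: infinite_finite_induct) (simp_all add: zero_cfun.rep_eq plus_cfun.rep_eq)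

lemma cfun_apply_char_fun: "cfun_apply (char_fun i) k = (if k = i then 1 else 0)"
  by (simp add: char_fun_def Cfun_inverse)

lemma char_fun_mult: "char_fun i * char_fun k = (if i = k then char_fun i else (0 :: 'v::finite cfun))"
  by (rule cfun_eqI) (simp add: times_cfun.rep_eq zero_cfun.rep_eq cfun_apply_char_fun)

lemma star_char_fun: "star (char_fun i) = (char_fun i :: 'v::finite cfun)"
  by (rule cfun_eqI) (simp add: star_cfun.rep_eq cfun_apply_char_fun)

lemma sum_char_fun: "(\<Sum>i\<in>UNIV. char_fun i) = (1 :: 'v::finite cfun)"
  by (rule cfun_eqI) (simp add: cfun_apply_sum one_cfun.rep_eq cfun_apply_char_fun)

lemma norm_char_fun: "norm (char_fun i :: 'v::finite cfun) = 1"
proof (rule antisym)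
  show "norm (char_fun i) \<le> 1" by (rule cfun_norm_le) (simp add: cfun_apply_char_fun)
  show "1 \<le> norm (char_fun i)" using cfun_norm_ge[of "char_fun i" i] by (simp add: cfun_apply_char_fun)
qed

lemma char_fun_expansion: "a = (\<Sum>i\<in>UNIV. cfun_apply a i *\<^sub>C char_fun (i :: 'v::finite))"
  by (rule cfun_eqI) (simp add: cfun_apply_sum scaleC_cfun.rep_eq cfun_apply_char_fun if_distrib cong: if_cong)

context
  fixes t :: "'v::finite cfun \<Rightarrow> 's::unital_cstar_algebra \<Rightarrow> 'as::unital_cstar_algebra"
  assumes mt: "min_tensor t"
begin

text \<open>Multiplication by \<open>\<chi>\<^sub>j \<otimes> 1\<close> picks out the \<open>j\<close>-th component of an element of \<open>C(V) \<otimes> S\<close>.\<close>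

lemma cfun_tensor_component_le: "norm (x j) \<le> norm (\<Sum>k\<in>UNIV. t (char_fun k) (x k))"
proof -
  have "t (char_fun j) 1 * (\<Sum>k\<in>UNIV. t (char_fun k) (x k))
      = (\<Sum>k\<in>UNIV. if j = k then t (char_fun j) (x j) else 0)"
    unfolding sum_distrib_left min_tensor_mult[OF mt] char_fun_mult
    by (intro sum.cong refl) (simp add: min_tensor_zero_left[OF mt])
  then have "t (char_fun j) (x j) = t (char_fun j) 1 * (\<Sum>k\<in>UNIV. t (char_fun k) (x k))"
    by simp
  then have "norm (t (char_fun j) (x j)) \<le> norm (t (char_fun j) 1) * norm (\<Sum>k\<in>UNIV. t (char_fun k) (x k))"
    by (simp only: norm_mult_ineq)
  then show ?thesis by (simp add: min_tensor_norm[OF mt] norm_char_fun)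
qed

lemma cfun_tensor_component_eq:
  assumes "(\<Sum>k\<in>UNIV. t (char_fun k) (x k)) = (\<Sum>k\<in>UNIV. t (char_fun k) (z k))"
  shows "x j = z j"
  using cfun_tensor_component_le[of "\<lambda>k. x k - z k" j] assms
  by (simp add: min_tensor_diff_right[OF mt] sum_subtractf)

end

lemma star_hom_sum:
  assumes "star_hom f"
  shows "f (\<Sum>i\<in>I. x i) = (\<Sum>i\<in>I. f (x i))"
proof -
  have add: "f (a + b) = f a + f b" for a b using assms by (simp add: star_hom_def)
  from add[of 0 0] have "f 0 = 0" by simp
  with add show ?thesis by (induction I rule: infinite_finite_induct) auto
qed

context
  fixes t :: "'s::unital_cstar_algebra \<Rightarrow> 's \<Rightarrow> 'ss::unital_cstar_algebra"
    and \<Delta> :: "'s \<Rightarrow> 'ss"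
    and t_as :: "'v::finite cfun \<Rightarrow> 's \<Rightarrow> 'as::unital_cstar_algebra"
    and t_as_s :: "'as \<Rightarrow> 's \<Rightarrow> 'ass::unital_cstar_algebra"
    and t_a_ss :: "'v cfun \<Rightarrow> 'ss \<Rightarrow> 'ass"
    and \<alpha> :: "'v cfun \<Rightarrow> 'as"
    and Q :: "'s ^ 'v ^ 'v"
  assumes coaction: "coaction t \<Delta> t_as t_as_s t_a_ss \<alpha>"
    and corep: "corepresentation_matrix t_as \<alpha> Q"
begin

lemma
  shows coaction_min_tensor: "min_tensor t_as"
    and coaction_min_tensor': "min_tensor t_as_s" "min_tensor t_a_ss"
    and coaction_reassociate: "t_as_s (t_as a b) c = t_a_ss a (t b c)"
  using coaction by (auto simp: coaction_def triple_tensor_def)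

lemma coaction_hom: "star_hom \<alpha>"
  using coaction by (simp add: coaction_def)

lemma coaction_char_fun: "\<alpha> (char_fun i) = (\<Sum>j\<in>UNIV. t_as (char_fun j) (Q $ j $ i))"
  using corep by (simp add: corepresentation_matrix_def)

lemma coaction_dense: "closure (span {\<alpha> a * t_as 1 s | a s. True}) = UNIV"
  using coaction min_tensor_dense[OF coaction_min_tensor]
  by (simp add: coaction_def coacts_into_def tensor_sub_def)

lemma corep_entry_star: "star (Q $ j $ i) = Q $ j $ i"
proof -
  have "star (\<alpha> (char_fun i)) = \<alpha> (char_fun i)"
    using coaction_hom by (metis star_hom_def star_char_fun)
  then have "(\<Sum>j\<in>UNIV. t_as (char_fun j) (star (Q $ j $ i))) = (\<Sum>j\<in>UNIV. t_as (char_fun j) (Q $ j $ i))"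
    by (simp add: coaction_char_fun star_sum min_tensor_star[OF coaction_min_tensor] star_char_fun)
  then show ?thesis
    by (rule cfun_tensor_component_eq[OF coaction_min_tensor, of "\<lambda>j. star (Q $ j $ i)" "\<lambda>j. Q $ j $ i"])
qed

lemma corep_row_orthogonal: "Q $ j $ i * Q $ j $ k = (if i = k then Q $ j $ i else 0)"
proof -
  have "(\<Sum>j\<in>UNIV. t_as (char_fun j) (Q $ j $ i * Q $ j $ k))
      = (\<Sum>j\<in>UNIV. \<Sum>l\<in>UNIV. if j = l then t_as (char_fun j) (Q $ j $ i * Q $ j $ k) else 0)"
    by simp
  also have "\<dots> = \<alpha> (char_fun i) * \<alpha> (char_fun k)"
    unfolding coaction_char_fun sum_product min_tensor_mult[OF coaction_min_tensor] char_fun_mult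
    by (intro sum.cong refl) (auto simp: min_tensor_zero_left[OF coaction_min_tensor])
  also have "\<dots> = \<alpha> (char_fun i * char_fun k)"
    using coaction_hom by (simp add: star_hom_def)
  also have "\<dots> = (\<Sum>j\<in>UNIV. t_as (char_fun j) (if i = k then Q $ j $ i else 0))"
    using star_hom_sum[OF coaction_hom, of _ "{}"]
    by (simp add: char_fun_mult coaction_char_fun min_tensor_zero_right[OF coaction_min_tensor])
  finally show ?thesis
    by (rule cfun_tensor_component_eq[OF coaction_min_tensor, of "\<lambda>j. Q $ j $ i * Q $ j $ k"
        "\<lambda>j. if i = k then Q $ j $ i else 0"])
qed

text \<open>\<open>\<alpha>(1)\<close> is a left unit on the dense subspace \<open>\<alpha>(A)(1 \<otimes> S)\<close>.\<close>

lemma coaction_unital: "\<alpha> 1 = 1"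
proof -
  have mult: "\<alpha> (a * b) = \<alpha> a * \<alpha> b" for a b
    using coaction_hom by (simp add: star_hom_def)
  have "span {\<alpha> a * t_as 1 s | a s. True} \<subseteq> {x. \<alpha> 1 * x = x}"
  proof (rule span_minimal)
    show "{\<alpha> a * t_as 1 s | a s. True} \<subseteq> {x. \<alpha> 1 * x = x}"
      by (auto simp: mult.assoc[symmetric] mult[symmetric])
    show "subspace {x. \<alpha> 1 * x = x}"
      by (auto simp: subspace_def distrib_left)
  qed
  moreover have "closed {x. \<alpha> 1 * x = x}"
    by (intro closed_Collect_eq continuous_intros)
  ultimately have "closure (span {\<alpha> a * t_as 1 s | a s. True}) \<subseteq> {x. \<alpha> 1 * x = x}"
    by (rule closure_minimal)
  then have "\<alpha> 1 * 1 = 1" unfolding coaction_dense by blast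
  then show ?thesis by simp
qed

lemma corep_row_sum: "(\<Sum>i\<in>UNIV. Q $ j $ i) = 1"
proof -
  have "(\<Sum>j\<in>UNIV. t_as (char_fun j) (\<Sum>i\<in>UNIV. Q $ j $ i))
      = (\<Sum>j\<in>UNIV. \<Sum>i\<in>UNIV. t_as (char_fun j) (Q $ j $ i))"
    by (simp add: min_tensor_sum_right[OF coaction_min_tensor])
  also have "\<dots> = (\<Sum>i\<in>UNIV. \<alpha> (char_fun i))"
    unfolding coaction_char_fun by (rule sum.swap)
  also have "\<dots> = \<alpha> 1" by (simp add: star_hom_sum[OF coaction_hom, symmetric] sum_char_fun)
  also have "\<dots> = t_as (\<Sum>j\<in>UNIV. char_fun j) 1"
    by (simp add: coaction_unital sum_char_fun min_tensor_one[OF coaction_min_tensor])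
  also have "\<dots> = (\<Sum>j\<in>UNIV. t_as (char_fun j) 1)"
    by (rule min_tensor_sum_left[OF coaction_min_tensor])
  finally show ?thesis
    by (rule cfun_tensor_component_eq[OF coaction_min_tensor, of "\<lambda>j. \<Sum>i\<in>UNIV. Q $ j $ i" "\<lambda>_. 1"])
qed

text \<open>Comparison of the components of both sides of the co-action identity at \<open>\<chi>\<^sub>i\<close>.\<close>

lemma corep_comultiplication: "\<Delta> (Q $ j $ i) = (\<Sum>k\<in>UNIV. t (Q $ j $ k) (Q $ k $ i))"
proof -
  obtain F G where F: "star_hom F" "\<And>a b. F (t_as a b) = t_as_s (\<alpha> a) b"
    and G: "star_hom G" "\<And>a b. G (t_as a b) = t_a_ss a (\<Delta> b)"
    and FG: "\<And>a. F (\<alpha> a) = G (\<alpha> a)"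
    using coaction unfolding coaction_def is_tensor_hom_def by auto
  have "(\<Sum>j\<in>UNIV. t_a_ss (char_fun j) (\<Delta> (Q $ j $ i))) = G (\<alpha> (char_fun i))"
    by (simp add: coaction_char_fun star_hom_sum[OF G(1)] G(2))
  also have "\<dots> = F (\<alpha> (char_fun i))" by (rule FG[symmetric])
  also have "\<dots> = (\<Sum>k\<in>UNIV. t_as_s (\<alpha> (char_fun k)) (Q $ k $ i))"
    unfolding coaction_char_fun[of i] by (simp add: star_hom_sum[OF F(1)] F(2))
  also have "\<dots> = (\<Sum>k\<in>UNIV. \<Sum>j\<in>UNIV. t_a_ss (char_fun j) (t (Q $ j $ k) (Q $ k $ i)))"
    by (simp add: coaction_char_fun min_tensor_sum_left[OF coaction_min_tensor'(1)] coaction_reassociate)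
  also have "\<dots> = (\<Sum>j\<in>UNIV. \<Sum>k\<in>UNIV. t_a_ss (char_fun j) (t (Q $ j $ k) (Q $ k $ i)))"
    by (rule sum.swap)
  also have "\<dots> = (\<Sum>j\<in>UNIV. t_a_ss (char_fun j) (\<Sum>k\<in>UNIV. t (Q $ j $ k) (Q $ k $ i)))"
    by (simp add: min_tensor_sum_right[OF coaction_min_tensor'(2)])
  finally show ?thesis
    by (rule cfun_tensor_component_eq[OF coaction_min_tensor'(2), of "\<lambda>j. \<Delta> (Q $ j $ i)"
        "\<lambda>j. \<Sum>k\<in>UNIV. t (Q $ j $ k) (Q $ k $ i)"])
qed

text \<open>The elements of \<open>\<alpha>(A)(1 \<otimes> S)\<close> have components \<open>\<Sum>\<^sub>i q\<^sub>j\<^sub>i r\<^sub>i\<close>; approximating \<open>\<chi>\<^sub>l \<otimes> 1\<close> by them gives the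
  \<open>l\<close>-th column of an approximate right inverse.\<close>

lemma corep_approx_right_invertible: "approx_right_invertible (\<lambda>j i. Q $ j $ i)"
  unfolding approx_right_invertible_def
proof (intro allI impI)
  fix \<epsilon> :: real assume \<epsilon>: "\<epsilon> > 0"
  have form: "\<exists>r. y = (\<Sum>j\<in>UNIV. t_as (char_fun j) (\<Sum>i\<in>UNIV. Q $ j $ i * r i))"
    if "y \<in> span {\<alpha> a * t_as 1 s | a s. True}" for y
    using that
  proof (induction rule: span_induct_alt)
    case base
    show ?case by (rule exI[of _ "\<lambda>_. 0"]) (simp add: min_tensor_zero_right[OF coaction_min_tensor])
  next
    case (step c x y)
    then obtain a s r where x: "x = \<alpha> a * t_as 1 s"
      and y: "y = (\<Sum>j\<in>UNIV. t_as (char_fun j) (\<Sum>i\<in>UNIV. Q $ j $ i * r i))" by blast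
    have sc: "\<alpha> (c *\<^sub>C z) = c *\<^sub>C \<alpha> z" for c z using coaction_hom by (simp add: star_hom_def)
    have "\<alpha> a = (\<Sum>i\<in>UNIV. \<Sum>j\<in>UNIV. t_as (char_fun j) (cfun_apply a i *\<^sub>C (Q $ j $ i)))"
      by (subst char_fun_expansion[of a]) (simp add: star_hom_sum[OF coaction_hom] sc coaction_char_fun
          scaleC_sum_right min_tensor_scaleC_right[OF coaction_min_tensor])
    also have "\<dots> = (\<Sum>j\<in>UNIV. \<Sum>i\<in>UNIV. t_as (char_fun j) (cfun_apply a i *\<^sub>C (Q $ j $ i)))"
      by (rule sum.swap)
    also have "\<dots> * t_as 1 s = (\<Sum>j\<in>UNIV. t_as (char_fun j) (\<Sum>i\<in>UNIV. Q $ j $ i * (cfun_apply a i *\<^sub>C s)))"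
      by (simp add: sum_distrib_right min_tensor_mult[OF coaction_min_tensor] mult_scaleC_left
          mult_scaleC_right min_tensor_sum_right[OF coaction_min_tensor])
    finally have x': "x = (\<Sum>j\<in>UNIV. t_as (char_fun j) (\<Sum>i\<in>UNIV. Q $ j $ i * (cfun_apply a i *\<^sub>C s)))"
      unfolding x .
    show ?case
      by (rule exI[of _ "\<lambda>i. c *\<^sub>R (cfun_apply a i *\<^sub>C s) + r i"])
        (simp add: x' y distrib_left sum.distrib scaleR_sum_right[symmetric]
          min_tensor_add_right[OF coaction_min_tensor] min_tensor_scaleR_right[OF coaction_min_tensor])
  qed
  have "\<exists>r. \<forall>j. norm ((\<Sum>i\<in>UNIV. Q $ j $ i * r i) - (if j = l then 1 else 0)) < \<epsilon>" for l
  proof -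
    have "t_as (char_fun l) 1 \<in> closure (span {\<alpha> a * t_as 1 s | a s. True})"
      unfolding coaction_dense by (rule UNIV_I)
    then obtain y where y: "y \<in> span {\<alpha> a * t_as 1 s | a s. True}" "dist y (t_as (char_fun l) 1) < \<epsilon>"
      using \<epsilon> unfolding closure_approachable by blast
    obtain r where r: "y = (\<Sum>j\<in>UNIV. t_as (char_fun j) (\<Sum>i\<in>UNIV. Q $ j $ i * r i))"
      using form[OF y(1)] by blast
    have "t_as (char_fun l) 1 = (\<Sum>j\<in>UNIV. if j = l then t_as (char_fun l) 1 else 0)" by simp
    also have "\<dots> = (\<Sum>j\<in>UNIV. t_as (char_fun j) (if j = l then 1 else 0))"
      by (intro sum.cong refl) (simp add: min_tensor_zero_right[OF coaction_min_tensor])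
    finally have "y - t_as (char_fun l) 1
        = (\<Sum>j\<in>UNIV. t_as (char_fun j) ((\<Sum>i\<in>UNIV. Q $ j $ i * r i) - (if j = l then 1 else 0)))"
      by (simp add: r min_tensor_diff_right[OF coaction_min_tensor] sum_subtractf)
    then have "norm ((\<Sum>i\<in>UNIV. Q $ j $ i * r i) - (if j = l then 1 else 0)) \<le> norm (y - t_as (char_fun l) 1)" for j
      using cfun_tensor_component_le[OF coaction_min_tensor,
          of "\<lambda>j. (\<Sum>i\<in>UNIV. Q $ j $ i * r i) - (if j = l then 1 else 0)" j] by simp
    with y(2) show ?thesis unfolding dist_norm by (meson le_less_trans)
  qed
  then obtain r where "\<And>j l. norm ((\<Sum>i\<in>UNIV. Q $ j $ i * r l i) - (if j = l then 1 else 0)) < \<epsilon>"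
    by metis
  then show "\<exists>r. \<forall>j l. norm ((\<Sum>i\<in>UNIV. Q $ j $ i * r i l) - (if j = l then 1 else 0)) < \<epsilon>"
    by (intro exI[of _ "\<lambda>i l. r l i"]) simp
qed

end

section \<open>Invariance of the Potts hamiltonian\<close>

text \<open>Inclusion-exclusion over the four cuts given by the subsets of \<open>{u, v}\<close>: only the pairs
  \<open>(u, v)\<close> and \<open>(v, u)\<close> survive, each counted twice.\<close>

lemma cut_sums_determine_symmetrization:
  fixes D :: "'v::finite \<Rightarrow> 'v \<Rightarrow> 's::unital_cstar_algebra"
  assumes cut: "\<And>A. (\<Sum>k\<in>UNIV. \<Sum>l\<in>UNIV. if k \<in> A \<longleftrightarrow> l \<in> A then D k l else 0) = 0"
    and uv: "u \<noteq> v"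
  shows "D u v + D v u = 0"
proof -
  let ?e = "\<lambda>A k l. if k \<in> A \<longleftrightarrow> l \<in> A then D k l else 0"
  have pt: "?e {} k l - ?e {u} k l - ?e {v} k l + ?e {u, v} k l
      = (if k = u then if l = v then 2 *\<^sub>R D u v else 0 else 0)
        + (if k = v then if l = u then 2 *\<^sub>R D v u else 0 else 0)" for k l
    using uv by (auto simp: scaleR_2)
  have "0 = (\<Sum>k\<in>UNIV. \<Sum>l\<in>UNIV. ?e {} k l) - (\<Sum>k\<in>UNIV. \<Sum>l\<in>UNIV. ?e {u} k l)
      - (\<Sum>k\<in>UNIV. \<Sum>l\<in>UNIV. ?e {v} k l) + (\<Sum>k\<in>UNIV. \<Sum>l\<in>UNIV. ?e {u, v} k l)"
    unfolding cut by simp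
  also have "\<dots> = (\<Sum>k\<in>UNIV. \<Sum>l\<in>UNIV. ?e {} k l - ?e {u} k l - ?e {v} k l + ?e {u, v} k l)"
    by (simp only: sum_subtractf sum.distrib)
  also have "\<dots> = (\<Sum>k\<in>UNIV. \<Sum>l\<in>UNIV. (if k = u then if l = v then 2 *\<^sub>R D u v else 0 else 0)
        + (if k = v then if l = u then 2 *\<^sub>R D v u else 0 else 0))"
    by (simp only: pt)
  also have "\<dots> = (\<Sum>k\<in>UNIV. (if k = u then 2 *\<^sub>R D u v else 0) + (if k = v then 2 *\<^sub>R D v u else 0))"
  proof (intro sum.cong refl)
    fix k
    show "(\<Sum>l\<in>UNIV. (if k = u then if l = v then 2 *\<^sub>R D u v else 0 else 0)
        + (if k = v then if l = u then 2 *\<^sub>R D v u else 0 else 0))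
        = (if k = u then 2 *\<^sub>R D u v else 0) + (if k = v then 2 *\<^sub>R D v u else 0)"
      by (cases "k = u"; cases "k = v") (simp_all add: sum.distrib)
  qed
  also have "\<dots> = 2 *\<^sub>R (D u v + D v u)" by (simp add: sum.distrib scaleR_add_right)
  finally show ?thesis by simp
qed

lemma potts_form_ext_config:
  fixes Q :: "'s::unital_cstar_algebra ^ 'v ^ 'v::finite"
  assumes q: "q > 0" and \<omega>: "\<omega> \<in> potts_configs q" and sa: "\<And>j i. star (Q $ j $ i) = Q $ j $ i"
  shows "potts_form_ext q E J (alpha_prime Q (config_elem \<omega>)) (alpha_prime Q (config_elem \<omega>))
    = (\<Sum>k\<in>UNIV. \<Sum>l\<in>UNIV. if \<omega> k = \<omega> l
         then \<Sum>i\<in>UNIV. \<Sum>j\<in>UNIV. (edge_coupling E J $ i $ j) *\<^sub>C (Q $ i $ k * Q $ j $ l) else 0)"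
proof -
  let ?G = "carrier (Zmod q)" and ?J = "edge_coupling E J"
  have fin: "finite ?G" using q by (rule finite_carrier_Zmod)
  define X where "X j g = (\<Sum>k\<in>UNIV. if g = \<omega> k then Q $ j $ k else 0)" for j g
  have aX: "alpha_prime Q (config_elem \<omega>) = X"
    unfolding alpha_prime_def config_elem_def delta_def X_def by (intro ext sum.cong refl) simp
  have sX: "star (X j g) = X j g" for j g
    unfolding X_def star_sum by (intro sum.cong refl) (simp add: sa)
  have "potts_form_ext q E J X X
      = (\<Sum>i\<in>UNIV. \<Sum>g\<in>?G. \<Sum>j\<in>UNIV. \<Sum>h\<in>?G. if g = h then (?J $ i $ j) *\<^sub>C (X i g * X j g) else 0)"
    unfolding potts_form_ext_def by (intro sum.cong refl) (simp add: potts_form_basis[OF q] sX)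
  also have "\<dots> = (\<Sum>i\<in>UNIV. \<Sum>g\<in>?G. \<Sum>j\<in>UNIV. (?J $ i $ j) *\<^sub>C (X i g * X j g))"
    by (intro sum.cong refl) (simp add: fin)
  also have "\<dots> = (\<Sum>i\<in>UNIV. \<Sum>j\<in>UNIV. \<Sum>g\<in>?G. (?J $ i $ j) *\<^sub>C (X i g * X j g))"
    by (intro sum.cong[OF refl] sum.swap)
  also have "\<dots> = (\<Sum>i\<in>UNIV. \<Sum>j\<in>UNIV. (?J $ i $ j) *\<^sub>C
      (\<Sum>k\<in>UNIV. \<Sum>l\<in>UNIV. if \<omega> k = \<omega> l then Q $ i $ k * Q $ j $ l else 0))"
  proof (intro sum.cong refl)
    fix i j
    have "(\<Sum>g\<in>?G. X i g * X j g)
        = (\<Sum>g\<in>?G. \<Sum>k\<in>UNIV. \<Sum>l\<in>UNIV. if g = \<omega> k then if \<omega> k = \<omega> l then Q $ i $ k * Q $ j $ l else 0 else 0)"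
      unfolding X_def sum_product by (intro sum.cong refl) simp
    also have "\<dots> = (\<Sum>k\<in>UNIV. \<Sum>g\<in>?G. \<Sum>l\<in>UNIV. if g = \<omega> k then if \<omega> k = \<omega> l then Q $ i $ k * Q $ j $ l else 0 else 0)"
      by (rule sum.swap)
    also have "\<dots> = (\<Sum>k\<in>UNIV. \<Sum>l\<in>UNIV. \<Sum>g\<in>?G. if g = \<omega> k then if \<omega> k = \<omega> l then Q $ i $ k * Q $ j $ l else 0 else 0)"
      by (intro sum.cong[OF refl] sum.swap)
    also have "\<dots> = (\<Sum>k\<in>UNIV. \<Sum>l\<in>UNIV. if \<omega> k = \<omega> l then Q $ i $ k * Q $ j $ l else 0)"
    proof (intro sum.cong refl)
      fix k l
      have "\<omega> k \<in> ?G" using \<omega> by (simp add: potts_configs_def)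
      then show "(\<Sum>g\<in>?G. if g = \<omega> k then if \<omega> k = \<omega> l then Q $ i $ k * Q $ j $ l else 0 else 0)
          = (if \<omega> k = \<omega> l then Q $ i $ k * Q $ j $ l else 0)"
        using fin by simp
    qed
    finally show "(\<Sum>g\<in>?G. (?J $ i $ j) *\<^sub>C (X i g * X j g)) = (?J $ i $ j) *\<^sub>C
        (\<Sum>k\<in>UNIV. \<Sum>l\<in>UNIV. if \<omega> k = \<omega> l then Q $ i $ k * Q $ j $ l else 0)"
      by (simp only: scaleC_sum_right[symmetric])
  qed
  also have "\<dots> = (\<Sum>i\<in>UNIV. \<Sum>j\<in>UNIV. \<Sum>k\<in>UNIV. \<Sum>l\<in>UNIV.
      if \<omega> k = \<omega> l then (?J $ i $ j) *\<^sub>C (Q $ i $ k * Q $ j $ l) else 0)"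
    unfolding scaleC_sum_right by (intro sum.cong refl) simp
  also have "\<dots> = (\<Sum>i\<in>UNIV. \<Sum>k\<in>UNIV. \<Sum>j\<in>UNIV. \<Sum>l\<in>UNIV.
      if \<omega> k = \<omega> l then (?J $ i $ j) *\<^sub>C (Q $ i $ k * Q $ j $ l) else 0)"
    by (intro sum.cong[OF refl] sum.swap)
  also have "\<dots> = (\<Sum>k\<in>UNIV. \<Sum>i\<in>UNIV. \<Sum>j\<in>UNIV. \<Sum>l\<in>UNIV.
      if \<omega> k = \<omega> l then (?J $ i $ j) *\<^sub>C (Q $ i $ k * Q $ j $ l) else 0)"
    by (rule sum.swap)
  also have "\<dots> = (\<Sum>k\<in>UNIV. \<Sum>i\<in>UNIV. \<Sum>l\<in>UNIV. \<Sum>j\<in>UNIV.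
      if \<omega> k = \<omega> l then (?J $ i $ j) *\<^sub>C (Q $ i $ k * Q $ j $ l) else 0)"
    by (intro sum.cong[OF refl] sum.swap)
  also have "\<dots> = (\<Sum>k\<in>UNIV. \<Sum>l\<in>UNIV. \<Sum>i\<in>UNIV. \<Sum>j\<in>UNIV.
      if \<omega> k = \<omega> l then (?J $ i $ j) *\<^sub>C (Q $ i $ k * Q $ j $ l) else 0)"
    by (intro sum.cong[OF refl] sum.swap)
  also have "\<dots> = (\<Sum>k\<in>UNIV. \<Sum>l\<in>UNIV. if \<omega> k = \<omega> l
         then \<Sum>i\<in>UNIV. \<Sum>j\<in>UNIV. (?J $ i $ j) *\<^sub>C (Q $ i $ k * Q $ j $ l) else 0)"
    by (intro sum.cong refl) simp
  finally show ?thesis by (simp only: aX)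
qed

lemma potts_form_config_coupling:
  fixes E :: "('v::finite \<times> 'v) set"
  assumes q: "q > 0" and \<omega>: "\<omega> \<in> potts_configs q"
  shows "potts_form q E J (config_elem \<omega>) (config_elem \<omega>)
    = (\<Sum>k\<in>UNIV. \<Sum>l\<in>UNIV. if \<omega> k = \<omega> l then edge_coupling E J $ k $ l else 0)"
  unfolding potts_form_eq
proof (intro sum.cong refl)
  fix k l
  have "\<omega> k \<in> carrier (Zmod q)" using \<omega> by (simp add: potts_configs_def)
  moreover have "(\<Sum>g\<in>carrier (Zmod q). edge_coupling E J $ k $ l * (cnj (config_elem \<omega> k g) * config_elem \<omega> l g))
      = (\<Sum>g\<in>carrier (Zmod q). if g = \<omega> k then if \<omega> k = \<omega> l then edge_coupling E J $ k $ l else 0 else 0)"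
    by (intro sum.cong refl) (simp add: config_elem_def delta_def)
  ultimately show "(\<Sum>g\<in>carrier (Zmod q). edge_coupling E J $ k $ l * (cnj (config_elem \<omega> k g) * config_elem \<omega> l g))
      = (if \<omega> k = \<omega> l then edge_coupling E J $ k $ l else 0)"
    using finite_carrier_Zmod[OF q] by simp
qed

text \<open>Only configurations with values in \<open>{0, 1}\<close> are used; they are admissible because \<open>q \<ge> 2\<close>. For
  these, preservation of the hamiltonian says that the cut sums of \<open>Q\<^sup>T J' Q - J'\<close> vanish.\<close>

lemma preserves_potts_symmetrized:
  fixes Q :: "'s::unital_cstar_algebra ^ 'v ^ 'v::finite"
  assumes q: "q \<ge> 2" and sa: "\<And>j i. star (Q $ j $ i) = Q $ j $ i"
    and pres: "preserves_potts_hamiltonian q E J Q" and kl: "k \<noteq> l"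
  defines "M \<equiv> \<lambda>k l. \<Sum>i\<in>UNIV. \<Sum>j\<in>UNIV. (edge_coupling E J $ i $ j) *\<^sub>C (Q $ i $ k * Q $ j $ l)"
  shows "M k l + M l k = (edge_coupling E J $ k $ l + edge_coupling E J $ l $ k) *\<^sub>C 1"
proof -
  let ?J = "edge_coupling E J"
  have q0: "q > 0" using q by simp
  define D where "D k l = M k l - (?J $ k $ l) *\<^sub>C 1" for k l
  have "D k l + D l k = 0"
  proof (rule cut_sums_determine_symmetrization[OF _ kl])
    fix A :: "'v set"
    define \<omega> where "\<omega> k = (if k \<in> A then 1 else 0 :: int)" for k
    have \<omega>: "\<omega> \<in> potts_configs q"
      using q by (auto simp: potts_configs_def \<omega>_def carrier_integer_mod_group)
    have eq: "\<omega> k = \<omega> l \<longleftrightarrow> (k \<in> A \<longleftrightarrow> l \<in> A)" for k l by (auto simp: \<omega>_def)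
    have "(\<Sum>k\<in>UNIV. \<Sum>l\<in>UNIV. if \<omega> k = \<omega> l then M k l else 0)
        = (\<Sum>k\<in>UNIV. \<Sum>l\<in>UNIV. if \<omega> k = \<omega> l then ?J $ k $ l else 0) *\<^sub>C 1"
      using bspec[OF pres[unfolded preserves_potts_hamiltonian_def] \<omega>]
      unfolding potts_form_ext_config[OF q0 \<omega> sa] potts_form_config_coupling[OF q0 \<omega>] M_def .
    also have "\<dots> = (\<Sum>k\<in>UNIV. \<Sum>l\<in>UNIV. if \<omega> k = \<omega> l then (?J $ k $ l) *\<^sub>C 1 else 0)"
      unfolding scaleC_sum_left[OF finite_class.finite_UNIV] by (intro sum.cong refl) simp
    finally have "0 = (\<Sum>k\<in>UNIV. \<Sum>l\<in>UNIV. if \<omega> k = \<omega> l then M k l else 0)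
        - (\<Sum>k\<in>UNIV. \<Sum>l\<in>UNIV. if \<omega> k = \<omega> l then (?J $ k $ l) *\<^sub>C 1 else 0)" by simp
    also have "\<dots> = (\<Sum>k\<in>UNIV. \<Sum>l\<in>UNIV. if \<omega> k = \<omega> l then D k l else 0)"
      unfolding sum_subtractf[symmetric] by (intro sum.cong refl) (simp add: D_def)
    finally show "(\<Sum>k\<in>UNIV. \<Sum>l\<in>UNIV. if k \<in> A \<longleftrightarrow> l \<in> A then D k l else 0) = 0"
      by (simp add: eq)
  qed
  then show ?thesis by (simp add: D_def scaleC_add_left algebra_simps)
qed

text \<open>Put \<open>T = A x\<close>. Compressing the symmetrized relation by \<open>x\<^sub>a\<^sub>k\<close> gives \<open>x\<^sub>a\<^sub>k T\<^sub>a\<^sub>l x\<^sub>a\<^sub>k = A\<^sub>k\<^sub>l x\<^sub>a\<^sub>k\<close>, so the diagonal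
  blocks of \<open>T\<^sub>a\<^sub>l\<close> for the partition \<open>1 = \<Sum>\<^sub>k x\<^sub>a\<^sub>k\<close> are as desired. That the other blocks vanish is a
  Hilbert-Schmidt count: the squares of \<open>z = T\<^sub>a\<^sub>l x\<^sub>a\<^sub>k - A\<^sub>k\<^sub>l x\<^sub>a\<^sub>k\<close> sum to
  \<open>\<Sum> (r\<^sub>a - r\<^sub>k) x\<^sub>a\<^sub>k = 0\<close>, where \<open>r\<^sub>a = \<Sum>\<^sub>j \<bar>A\<^sub>a\<^sub>j\<bar>\<^sup>2\<close>, because rows and columns sum to \<open>1\<close>.\<close>

lemma magic_unitary_commutes:
  fixes t :: "'s::unital_cstar_algebra \<Rightarrow> 's \<Rightarrow> 'ss::unital_cstar_algebra"
    and x :: "'v::finite \<Rightarrow> 'v \<Rightarrow> 's" and A :: "'v \<Rightarrow> 'v \<Rightarrow> complex"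
  assumes mt: "min_tensor t"
    and sa: "\<And>j i. star (x j i) = x j i"
    and row_orth: "\<And>j i k. x j i * x j k = (if i = k then x j i else 0)"
    and col_orth: "\<And>j k i. x j i * x k i = (if j = k then x j i else 0)"
    and row_sum: "\<And>j. (\<Sum>i\<in>UNIV. x j i) = 1" and col_sum: "\<And>i. (\<Sum>j\<in>UNIV. x j i) = 1"
    and A_sym: "\<And>i j. A i j = A j i" and A_diag: "\<And>i. A i i = 0"
    and sym: "\<And>k l. k \<noteq> l \<Longrightarrow>
      (\<Sum>i\<in>UNIV. \<Sum>j\<in>UNIV. A i j *\<^sub>C (x i k * x j l)) + (\<Sum>i\<in>UNIV. \<Sum>j\<in>UNIV. A i j *\<^sub>C (x i l * x j k))
      = (2 * A k l) *\<^sub>C 1"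
  shows "(\<Sum>k\<in>UNIV. A k l *\<^sub>C x a k) = (\<Sum>j\<in>UNIV. A a j *\<^sub>C x j l)"
proof -
  define T where "T a l = (\<Sum>j\<in>UNIV. A a j *\<^sub>C x j l)" for a l
  have diag_block: "x a k * T a l * x a k = A k l *\<^sub>C x a k" for a k l
  proof (cases "k = l")
    case True
    have "x a l * T a l = (\<Sum>j\<in>UNIV. if a = j then A a j *\<^sub>C x a l else 0)"
      unfolding T_def sum_distrib_left by (intro sum.cong refl) (simp add: mult_scaleC_right col_orth)
    then show ?thesis using True by (simp add: A_diag)
  next
    case False
    let ?S1 = "\<Sum>i\<in>UNIV. \<Sum>j\<in>UNIV. A i j *\<^sub>C (x i k * x j l)"
    let ?S2 = "\<Sum>i\<in>UNIV. \<Sum>j\<in>UNIV. A i j *\<^sub>C (x i l * x j k)"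
    have S1: "x a k * ?S1 = x a k * T a l"
    proof -
      have "x a k * ?S1 = (\<Sum>i\<in>UNIV. \<Sum>j\<in>UNIV. A i j *\<^sub>C ((x a k * x i k) * x j l))"
        by (simp add: sum_distrib_left mult_scaleC_right mult.assoc)
      also have "\<dots> = (\<Sum>i\<in>UNIV. if a = i then \<Sum>j\<in>UNIV. A i j *\<^sub>C (x a k * x j l) else 0)"
        by (intro sum.cong refl) (simp add: col_orth)
      also have "\<dots> = x a k * T a l" by (simp add: T_def sum_distrib_left mult_scaleC_right)
      finally show ?thesis .
    qed
    have S2: "?S2 * x a k = T a l * x a k"
    proof -
      have "?S2 * x a k = (\<Sum>i\<in>UNIV. \<Sum>j\<in>UNIV. A i j *\<^sub>C (x i l * (x j k * x a k)))"
        by (simp add: sum_distrib_right mult_scaleC_left mult.assoc)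
      also have "\<dots> = (\<Sum>i\<in>UNIV. \<Sum>j\<in>UNIV. if j = a then A i j *\<^sub>C (x i l * x a k) else 0)"
        by (intro sum.cong refl) (simp add: col_orth)
      also have "\<dots> = (\<Sum>i\<in>UNIV. A a i *\<^sub>C (x i l * x a k))" by (simp add: A_sym[of _ a])
      also have "\<dots> = T a l * x a k" by (simp add: T_def sum_distrib_right mult_scaleC_left)
      finally show ?thesis .
    qed
    have "x a k * (?S1 + ?S2) * x a k = x a k * ?S1 * x a k + x a k * (?S2 * x a k)"
      by (simp only: distrib_left distrib_right mult.assoc)
    also have "\<dots> = 2 *\<^sub>R (x a k * T a l * x a k)"
      unfolding S1 S2 by (simp only: scaleR_2 mult.assoc)
    finally have "2 *\<^sub>R (x a k * T a l * x a k) = 2 *\<^sub>R (A k l *\<^sub>C x a k)"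
      unfolding sym[OF False]
      using scaleC_scaleC[of 2 "A k l" "x a k"] scaleC_of_real[of 2 "A k l *\<^sub>C x a k"]
      by (simp add: mult_scaleC_left mult_scaleC_right row_orth)
    then show ?thesis by simp
  qed
  have TT: "star (T a l) * T a l = (\<Sum>j\<in>UNIV. ((cmod (A a j))\<^sup>2) *\<^sub>R x j l)" for a l
  proof -
    have "star (T a l) * T a l
        = (\<Sum>i\<in>UNIV. \<Sum>j\<in>UNIV. if i = j then (cnj (A a i) * A a i) *\<^sub>C x i l else 0)"
      unfolding T_def star_sum sum_product star_scaleC sa
      by (intro sum.cong refl) (simp add: mult_scaleC_left mult_scaleC_right scaleC_scaleC col_orth mult.commute)
    also have "\<dots> = (\<Sum>j\<in>UNIV. of_real ((cmod (A a j))\<^sup>2) *\<^sub>C x j l)"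
      by (simp add: complex_norm_square mult.commute del: of_real_power)
    finally show ?thesis by (simp only: scaleC_of_real)
  qed
  define r where "r a = (\<Sum>j\<in>UNIV. (cmod (A a j))\<^sup>2)" for a
  define z where "z a k l = T a l * x a k - A k l *\<^sub>C x a k" for a k l
  have zz: "star (z a k l) * z a k l
      = x a k * (star (T a l) * T a l) * x a k - ((cmod (A k l))\<^sup>2) *\<^sub>R x a k" for a k l
  proof -
    have idem: "x a k * x a k = x a k" by (simp add: row_orth)
    have adj: "x a k * star (T a l) * x a k = cnj (A k l) *\<^sub>C x a k"
    proof -
      have "star (x a k * T a l * x a k) = star (A k l *\<^sub>C x a k)" by (simp only: diag_block)
      then show ?thesis by (simp add: star_mult star_scaleC sa mult.assoc)
    qed
    have N: "((cmod (A k l))\<^sup>2) *\<^sub>R x a k = (A k l * cnj (A k l)) *\<^sub>C x a k"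
      unfolding scaleC_of_real[symmetric] complex_norm_square ..
    have sz: "star (z a k l) = x a k * star (T a l) - cnj (A k l) *\<^sub>C x a k"
      by (simp add: z_def star_diff star_mult star_scaleC sa)
    have "star (z a k l) * z a k l
        = (x a k * (star (T a l) * T a l) * x a k - A k l *\<^sub>C (x a k * star (T a l) * x a k))
          - (cnj (A k l) *\<^sub>C (x a k * T a l * x a k) - (A k l * cnj (A k l)) *\<^sub>C x a k)"
      unfolding sz unfolding z_def
      by (simp add: left_diff_distrib right_diff_distrib scaleC_diff_right mult_scaleC_left
          mult_scaleC_right scaleC_scaleC mult.assoc idem mult.commute[of "cnj _"])
    then show ?thesis
      unfolding adj diag_block N by (simp add: scaleC_scaleC mult.commute)
  qed
  have sum_l: "(\<Sum>l\<in>UNIV. star (z a k l) * z a k l) = r a *\<^sub>R x a k - r k *\<^sub>R x a k" for a k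
  proof -
    have "(\<Sum>l\<in>UNIV. star (T a l) * T a l) = (\<Sum>j\<in>UNIV. \<Sum>l\<in>UNIV. ((cmod (A a j))\<^sup>2) *\<^sub>R x j l)"
      unfolding TT by (rule sum.swap)
    also have "\<dots> = r a *\<^sub>R 1" by (simp add: scaleR_sum_right[symmetric] row_sum r_def scaleR_sum_left)
    finally have "(\<Sum>l\<in>UNIV. x a k * (star (T a l) * T a l) * x a k) = r a *\<^sub>R x a k"
      by (simp add: sum_distrib_left[symmetric] sum_distrib_right[symmetric] row_orth)
    then show ?thesis by (simp add: zz sum_subtractf r_def scaleR_sum_left)
  qed
  have total: "(\<Sum>a\<in>UNIV. \<Sum>k\<in>UNIV. \<Sum>l\<in>UNIV. star (z a k l) * z a k l) = 0"
  proof -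
    have "(\<Sum>a\<in>UNIV. \<Sum>k\<in>UNIV. \<Sum>l\<in>UNIV. star (z a k l) * z a k l)
        = (\<Sum>a\<in>UNIV. \<Sum>k\<in>UNIV. r a *\<^sub>R x a k) - (\<Sum>a\<in>UNIV. \<Sum>k\<in>UNIV. r k *\<^sub>R x a k)"
      by (simp only: sum_l sum_subtractf)
    also have "(\<Sum>a\<in>UNIV. \<Sum>k\<in>UNIV. r k *\<^sub>R x a k) = (\<Sum>k\<in>UNIV. \<Sum>a\<in>UNIV. r k *\<^sub>R x a k)"
      by (rule sum.swap)
    finally show ?thesis by (simp add: scaleR_sum_right[symmetric] row_sum col_sum)
  qed
  have z0: "z a k l = 0" for a k l
  proof -
    define Z where "Z = (\<lambda>(a, k, l). z a k l)"
    have "(\<Sum>p\<in>UNIV. 1 *\<^sub>R (star (Z p) * Z p))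
        = (\<Sum>a\<in>UNIV. \<Sum>k\<in>UNIV. \<Sum>l\<in>UNIV. star (z a k l) * z a k l)"
      unfolding sum.cartesian_product UNIV_Times_UNIV by (intro sum.cong refl) (auto simp: Z_def)
    then have "(\<Sum>p\<in>UNIV. 1 *\<^sub>R (star (Z p) * Z p)) = 0" by (simp only: total)
    then have "Z (a, k, l) = 0"
      using weighted_sum_of_squares_zero[OF mt finite_class.finite_UNIV, of "\<lambda>_. 1" Z "(a, k, l)"]
      by simp
    then show ?thesis by (simp add: Z_def)
  qed
  have "T a l = (\<Sum>k\<in>UNIV. T a l * x a k)"
    by (simp add: sum_distrib_left[symmetric] row_sum)
  also have "\<dots> = (\<Sum>k\<in>UNIV. A k l *\<^sub>C x a k)"
    using z0[of a _ l] by (intro sum.cong refl) (simp add: z_def)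
  finally show ?thesis by (simp add: T_def)
qed

theorem theorem3p9:
  fixes E :: "('v::finite \<times> 'v) set"
    and J :: "complex ^ 'v ^ 'v"
    and q :: nat
    and t_ss :: "'s::unital_cstar_algebra \<Rightarrow> 's \<Rightarrow> 'ss::unital_cstar_algebra"
    and t_ss_s :: "'ss \<Rightarrow> 's \<Rightarrow> 'sss::unital_cstar_algebra"
    and t_s_ss :: "'s \<Rightarrow> 'ss \<Rightarrow> 'sss"
    and \<Delta> :: "'s \<Rightarrow> 'ss"
    and t_as :: "'v cfun \<Rightarrow> 's \<Rightarrow> 'as::unital_cstar_algebra"
    and t_as_s :: "'as \<Rightarrow> 's \<Rightarrow> 'ass::unital_cstar_algebra"
    and t_a_ss :: "'v cfun \<Rightarrow> 'ss \<Rightarrow> 'ass"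
    and \<alpha> :: "'v cfun \<Rightarrow> 'as"
    and Q :: "'s ^ 'v ^ 'v"
  assumes "sym E" and "irrefl E"
    and "q \<ge> 2"
    and "\<And>i j. J $ i $ j = J $ j $ i"
    and "compact_quantum_group t_ss t_ss_s t_s_ss \<Delta>"
    and "faithful_coaction t_ss \<Delta> t_as t_as_s t_a_ss \<alpha>"
    and "corepresentation_matrix t_as \<alpha> Q"
    and "preserves_potts_hamiltonian q E J Q"
  shows "Q ** scalar_matrix (edge_coupling E J) = scalar_matrix (edge_coupling E J) ** Q"
proof -
  let ?J = "edge_coupling E J"
  have mt: "min_tensor t_ss" and hom: "unital_star_hom \<Delta>"
    using assms(5) by (auto simp: compact_quantum_group_def triple_tensor_def)
  have co: "coaction t_ss \<Delta> t_as t_as_s t_a_ss \<alpha>"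
    using assms(6) by (simp add: faithful_coaction_def)
  note sa = corep_entry_star[OF co assms(7)] and row_orth = corep_row_orthogonal[OF co assms(7)]
    and row_sum = corep_row_sum[OF co assms(7)]
  have col_sum: "(\<Sum>j\<in>UNIV. Q $ j $ i) = 1" for i
    by (rule column_sums_one[OF mt hom corep_comultiplication[OF co assms(7)] sa row_orth row_sum
        corep_approx_right_invertible[OF co assms(7)]])
  have col_orth: "Q $ j $ i * Q $ k $ i = (if j = k then Q $ j $ i else 0)" for i j k
    using column_orthogonal[OF mt sa _ col_sum, of i j k] by (simp add: row_orth)
  have J_sym: "?J $ i $ j = ?J $ j $ i" for i j
    using assms(1,4) by (auto simp: edge_coupling_def adjacency_def sym_def)
  have J_diag: "?J $ i $ i = 0" for i
    using assms(2) by (simp add: edge_coupling_def adjacency_def irrefl_def)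
  have "(\<Sum>k\<in>UNIV. (?J $ k $ l) *\<^sub>C (Q $ a $ k)) = (\<Sum>j\<in>UNIV. (?J $ a $ j) *\<^sub>C (Q $ j $ l))" for a l
  proof (rule magic_unitary_commutes[OF mt sa row_orth col_orth row_sum col_sum J_sym J_diag])
    fix k l :: 'v assume "k \<noteq> l"
    from preserves_potts_symmetrized[OF assms(3) sa assms(8) this]
    show "(\<Sum>i\<in>UNIV. \<Sum>j\<in>UNIV. (?J $ i $ j) *\<^sub>C (Q $ i $ k * Q $ j $ l))
        + (\<Sum>i\<in>UNIV. \<Sum>j\<in>UNIV. (?J $ i $ j) *\<^sub>C (Q $ i $ l * Q $ j $ k)) = (2 * ?J $ k $ l) *\<^sub>C 1"
      by (simp add: J_sym[of l k])
  qed
  then show ?thesis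
    by (simp add: vec_eq_iff matrix_matrix_mult_def scalar_matrix_def mult_scaleC_left mult_scaleC_right)
qed

end
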